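(* Let $\pi=(\pi^n)_{n\ge 1}$, $\pi^n=(0=t^n_0<t^n_1<\cdots<t^n_{m(n)}=T)$, be a sequence of partitions of $[0,T]$, and let $\omega\in Q_\pi([0,T],\mathbb{R}^d)\cap C^{\nu}([0,T],\mathbb{R}^d)$ with $\nu>\frac{\sqrt3-1}{2}$, such that $$\mathrm{osc}(\omega,\pi^n):=\max_{0\le j\le m(n)-1}\ \sup_{t\in(t^n_j,t^n_{j+1}]}|\omega(t)-\omega(t^n_j)|\xrightarrow[n\to\infty]{}0 .$$ Let $F\in\mathbb{C}^{1,2}_b(\Lambda^d_T)\cap Lip(\Lambda^d_T,\|\cdot\|_\infty)$ with $\nabla_\omega F\in\mathbb{C}^{1,1}_b(\Lambda^d_T)$ be such that $$\max_{0\le i\le m(n)-1}|F(t^n_{i+1},\omega)-F(t^n_i,\omega)|\xrightarrow[n\to\infty]{}0 .$$ Then $$[F(\cdot,\omega_\cdot)]_\pi(T)=\Big[\int_0^{\cdot}\nabla_\omega F(s,\omega_s)\,d^\pi\omega\Big]_\pi(T)=\int_0^T\big\langle \nabla_\omega F(s,\omega_s)\,{}^t\nabla_\omega F(s,\omega_s),\ d[\omega]_\pi(s)\big\rangle .$$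
   Context: Fix $T>0$ and $d\ge 1$. $D([0,T],\mathbb{R}^d)$ is the set of càdlàg paths. For a path $\omega$, $\omega_t:=\omega(t\wedge\cdot)$ is the path stopped at $t$, and $\omega_{t-}$ is the path equal to $\omega$ on $[0,t)$ and to $\omega(t-)$ on $[t,T]$. The space of stopped paths $\Lambda^d_T=\{(t,\omega_t):(t,\omega)\in[0,T]\times D([0,T],\mathbb{R}^d)\}$ carries the metric $d_\infty((t,\omega),(t',\omega'))=\|\omega_t-\omega'_{t'}\|_\infty+|t-t'|$, where $\|\cdot\|_\infty$ is the sup norm on $[0,T]$. A non-anticipative functional is a measurable map $F:(\Lambda^d_T,d_\infty)\to\mathbb{R}$ (so $F(t,\omega)=F(t,\omega_t)$); vector- or matrix-valued functionals are treated componentwise. Regularity: $F$ is continuous at fixed times if for all $t,\omega,\epsilon>0$ there is $\eta>0$ such that $\|\omega_t-\omega'_t\|_\infty<\eta$ implies $|F(t,\omega)-F(t,\omega')|<\epsilon$. $F$ is left-continuous ($F\in\mathbb{C}^{0,0}_l(\Lambda^d_T)$) if for all $(t,\omega)\in\Lambda_T^d$, $\epsilon>0$ there is $\eta>0$ such that for $(t',\omega')\in\Lambda_T^d$, $t'<t$ and $d_\infty((t,\omega),(t',\omega'))<\eta$ imply $|F(t,\omega)-F(t',\omega')|<\epsilon$. $F$ is boundedness-preserving ($F\in\mathbb{B}(\Lambda^d_T)$) if for every compact $K\subset\mathbb{R}^d$ and $t_0\in[0,T]$ there is $C(K,t_0)>0$ with $|F(t,\omega)|<C(K,t_0)$ whenever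 $t\le t_0$ and $\omega([0,t])\subset K$. Derivatives: the horizontal derivative is $\mathcal{D}F(t,\omega)=\lim_{h\to0^+}\frac{F(t+h,\omega_t)-F(t,\omega_t)}{h}$ (for $t<T$, so that $t+h\le T$). The vertical derivative $\nabla_\omega F(t,\omega)\in\mathbb{R}^d$ is the gradient at $e=0$ of $e\mapsto F(t,\omega_t+e\mathbf{1}_{[t,T]})$ (this map being required to be differentiable at $0$); $\nabla^j_\omega F$ is the iterated vertical derivative, $\nabla_\omega^0F=F$. $\mathbb{C}^{1,k}_b(\Lambda^d_T)$ is the set of non-anticipative functionals $F$ that are horizontally differentiable with $\mathcal{D}F$ continuous at fixed times, $k$ times vertically differentiable with $\nabla^j_\omega F\in\mathbb{C}^{0,0}_l(\Lambda^d_T)$ for $j=0,\dots,k$, and with $\mathcal{D}F,\nabla_\omega F,\dots,\nabla^k_\omega F\in\mathbb{B}(\Lambda^d_T)$. $Lip(\Lambda^d_T,\|\cdot\|_\infty)$ is the set of non-anticipative functionals for which there is $K>0$ with $|F(t,\omega)-F(t,\omega')|\le K\|\omega_t-\omega'_t\|_\infty$ for all $t\in[0,T]$ and all $\omega,\omega'\in D([0,T],\mathbb{R}^d)$. Quadratic variation: a càdlàg $x:[0,T]\to\mathbb{R}$ is in $Q_\pi([0,T],\mathbb{R})$ if for every $t\in[0,T]$ the limit $[x]_\pi(t)=\lim_{n}\sum_{t^n_{i+1}\le t}(x(t^n_{i+1})-x(t^n_i))^2<\infty$ exists and $[x]_\pi(t)=[x]^c_\pi(t)+\sum_{0<s\le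 t}|\Delta x(s)|^2$ with $[x]_\pi^c$ continuous and increasing (so for continuous $x$, $[x]_\pi$ is continuous). $x\in Q_\pi([0,T],\mathbb{R}^d)$ if $x^i$ and $x^i+x^j$ are in $Q_\pi([0,T],\mathbb{R})$ for all $i,j$; then $[x]_\pi$ is the $d\times d$ symmetric matrix-valued function $[x]^{ij}_\pi=\frac12([x^i+x^j]_\pi-[x^i]_\pi-[x^j]_\pi)$. For square matrices $\langle A,B\rangle=\mathrm{tr}(AB)$, and ${}^t$ denotes transpose. $C^\nu([0,T],\mathbb{R}^d)$, $0<\nu<1$, is the space of $\nu$-Hölder continuous functions. Pathwise integral: for continuous $\omega$ let $\omega^n=\sum_{i}\omega(t^n_{i+1})\mathbf{1}_{[t^n_i,t^n_{i+1})}+\omega(T)\mathbf{1}_{\{T\}}$. Then $\int_0^t\nabla_\omega F(s,\omega)\,d^\pi\omega:=\lim_{n}\sum_{i=0}^{m(n)-1}\nabla_\omega F(t^n_i,\omega^n_{t^n_i-})\cdot(\omega(t^n_{i+1}\wedge t)-\omega(t^n_i\wedge t))$. *)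

theory Defs
  imports "HOL-Analysis.Analysis"
begin

section \<open>Cadlag paths and stopped paths\<close>

text \<open>
  A path on \<open>[0,T]\<close> is a total function that is \<^const>\<open>undefined\<close> outside \<open>[0,T]\<close>, so that two
  paths are equal iff they agree on \<open>[0,T]\<close>. The value \<open>\<omega>(0-)\<close> is read as \<open>\<omega>(0)\<close>.
\<close>

definition cadlag_on :: "real \<Rightarrow> (real \<Rightarrow> 'a::topological_space) \<Rightarrow> bool" where
  "cadlag_on T x \<longleftrightarrow>
     (\<forall>t\<in>{0..<T}. (x \<longlongrightarrow> x t) (at_right t)) \<and>
     (\<forall>t\<in>{0<..T}. \<exists>l. (x \<longlongrightarrow> l) (at_left t))"

definition Dpaths :: "real \<Rightarrow> (real \<Rightarrow> 'a::topological_space) set" where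
  "Dpaths T = {x \<in> extensional {0..T}. cadlag_on T x}"

definition left_value :: "(real \<Rightarrow> 'a::t2_space) \<Rightarrow> real \<Rightarrow> 'a" where
  "left_value x t = (if t = 0 then x 0 else Lim (at_left t) x)"

definition stop :: "real \<Rightarrow> real \<Rightarrow> (real \<Rightarrow> 'a) \<Rightarrow> real \<Rightarrow> 'a" where
  "stop T t x = (\<lambda>s\<in>{0..T}. x (min t s))"

definition stop_left :: "real \<Rightarrow> real \<Rightarrow> (real \<Rightarrow> 'a::t2_space) \<Rightarrow> real \<Rightarrow> 'a" where
  "stop_left T t x = (\<lambda>s\<in>{0..T}. if s < t then x s else left_value x t)"

definition Stopped :: "real \<Rightarrow> (real \<times> (real \<Rightarrow> 'a::topological_space)) set" where
  "Stopped T = {(t, stop T t x) | t x. t \<in> {0..T} \<and> x \<in> Dpaths T}"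

definition sup_dist :: "real \<Rightarrow> (real \<Rightarrow> 'a::metric_space) \<Rightarrow> (real \<Rightarrow> 'a) \<Rightarrow> real" where
  "sup_dist T = mdist (funspace {0..T} euclidean_metric)"

definition d_inf ::
    "real \<Rightarrow> real \<times> (real \<Rightarrow> 'a::metric_space) \<Rightarrow> real \<times> (real \<Rightarrow> 'a) \<Rightarrow> real" where
  "d_inf T p q = sup_dist T (snd p) (snd q) + \<bar>fst p - fst q\<bar>"

lemma cadlag_on_bounded:
  fixes x :: "real \<Rightarrow> 'a::metric_space"
  assumes "cadlag_on T x"
  shows "bounded (x ` {0..T})"
proof -
  have near: "\<exists>\<delta>>0. bounded (x ` ({t-\<delta><..<t+\<delta>} \<inter> {0..T}))" if t: "t \<in> {0..T}" for t
  proof -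
    have "\<exists>\<delta>>0. bounded (x ` ({t-\<delta><..<t} \<inter> {0..T}))"
    proof (cases "t = 0")
      case True
      then have "{t-1<..<t} \<inter> {0..T} = {}" by auto
      then have "bounded (x ` ({t-1<..<t} \<inter> {0..T}))" by (metis bounded_empty image_empty)
      then show ?thesis using zero_less_one by blast
    next
      case False
      with t have "t \<in> {0<..T}" by auto
      then obtain l where "(x \<longlongrightarrow> l) (at_left t)"
        using assms unfolding cadlag_on_def by blast
      then have "eventually (\<lambda>s. dist (x s) l < 1) (at_left t)"
        by (rule tendstoD) simp
      then obtain b where b: "b < t" "\<And>s. b < s \<Longrightarrow> s < t \<Longrightarrow> dist (x s) l < 1"
        by (auto simp: eventually_at_left[of "t - 1"])
      have "bounded (x ` ({t-(t-b)<..<t} \<inter> {0..T}))"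
        unfolding bounded_def using b(2)
        by (intro exI[of _ l] exI[of _ 1]) (auto simp: dist_commute less_imp_le)
      then show ?thesis using b(1) by (intro exI[of _ "t-b"]) auto
    qed
    then obtain \<delta>1 where d1: "\<delta>1 > 0" "bounded (x ` ({t-\<delta>1<..<t} \<inter> {0..T}))" by blast
    have "\<exists>\<delta>>0. bounded (x ` ({t<..<t+\<delta>} \<inter> {0..T}))"
    proof (cases "t = T")
      case True
      then have "{t<..<t+1} \<inter> {0..T} = {}" by auto
      then have "bounded (x ` ({t<..<t+1} \<inter> {0..T}))" by (metis bounded_empty image_empty)
      then show ?thesis using zero_less_one by blast
    next
      case False
      with t have "t \<in> {0..<T}" by auto
      then have "(x \<longlongrightarrow> x t) (at_right t)"
        using assms unfolding cadlag_on_def by blast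
      then have "eventually (\<lambda>s. dist (x s) (x t) < 1) (at_right t)"
        by (rule tendstoD) simp
      then obtain b where b: "t < b" "\<And>s. t < s \<Longrightarrow> s < b \<Longrightarrow> dist (x s) (x t) < 1"
        by (auto simp: eventually_at_right[of t "t + 1"])
      have "bounded (x ` ({t<..<t+(b-t)} \<inter> {0..T}))"
        unfolding bounded_def using b(2)
        by (intro exI[of _ "x t"] exI[of _ 1]) (auto simp: dist_commute less_imp_le)
      then show ?thesis using b(1) by (intro exI[of _ "b-t"]) auto
    qed
    then obtain \<delta>2 where d2: "\<delta>2 > 0" "bounded (x ` ({t<..<t+\<delta>2} \<inter> {0..T}))" by blast
    define \<delta> where "\<delta> = min \<delta>1 \<delta>2"
    have "{t-\<delta><..<t+\<delta>} \<inter> {0..T} \<subseteq>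
        ({t-\<delta>1<..<t} \<inter> {0..T}) \<union> ({t<..<t+\<delta>2} \<inter> {0..T}) \<union> {t}"
      by (auto simp: \<delta>_def)
    then have "x ` ({t-\<delta><..<t+\<delta>} \<inter> {0..T}) \<subseteq>
        x ` ({t-\<delta>1<..<t} \<inter> {0..T}) \<union> x ` ({t<..<t+\<delta>2} \<inter> {0..T}) \<union> {x t}"
      by blast
    then have "bounded (x ` ({t-\<delta><..<t+\<delta>} \<inter> {0..T}))"
      by (rule bounded_subset[rotated]) (simp add: d1(2) d2(2))
    moreover have "\<delta> > 0" using d1 d2 by (simp add: \<delta>_def)
    ultimately show ?thesis by blast
  qed
  then have "\<forall>t\<in>{0..T}. \<exists>\<delta>. \<delta> > 0 \<and> bounded (x ` ({t-\<delta><..<t+\<delta>} \<inter> {0..T}))"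
    by blast
  from bchoice[OF this] obtain \<delta> where d: "\<And>t. t \<in> {0..T} \<Longrightarrow>
      \<delta> t > 0 \<and> bounded (x ` ({t-\<delta> t<..<t+\<delta> t} \<inter> {0..T}))"
    by blast
  have "compact {0..T}" by simp
  moreover have "open {t-\<delta> t<..<t+\<delta> t}" for t by simp
  moreover have "{0..T} \<subseteq> (\<Union>t\<in>{0..T}. {t-\<delta> t<..<t+\<delta> t})"
  proof
    fix t assume "t \<in> {0..T}"
    then show "t \<in> (\<Union>t\<in>{0..T}. {t-\<delta> t<..<t+\<delta> t})"
      using d[of t] by (intro UN_I[of t]) auto
  qed
  ultimately obtain S where S: "S \<subseteq> {0..T}" "finite S" "{0..T} \<subseteq> (\<Union>t\<in>S. {t-\<delta> t<..<t+\<delta> t})"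
    by (rule compactE_image)
  have "x ` {0..T} \<subseteq> (\<Union>t\<in>S. x ` ({t-\<delta> t<..<t+\<delta> t} \<inter> {0..T}))"
    using S(3) by blast
  moreover have "bounded (\<Union>t\<in>S. x ` ({t-\<delta> t<..<t+\<delta> t} \<inter> {0..T}))"
    using S(1,2) d by (intro bounded_UN) auto
  ultimately show ?thesis by (rule bounded_subset[rotated])
qed

lemma Dpaths_fspace:
  fixes x :: "real \<Rightarrow> 'a::metric_space"
  assumes "x \<in> Dpaths T"
  shows "x \<in> Met_TC.fspace {0..T}"
  using assms cadlag_on_bounded[of T x] by (simp add: Met_TC.fspace_def Dpaths_def)

lemma sup_dist_eq_SUP:
  fixes x y :: "real \<Rightarrow> 'a::metric_space"
  assumes "0 \<le> T" "x \<in> Dpaths T" "y \<in> Dpaths T"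
  shows "sup_dist T x y = (SUP s\<in>{0..T}. dist (x s) (y s))"
  using assms Dpaths_fspace[of x T] Dpaths_fspace[of y T]
  by (simp add: sup_dist_def Met_TC.fdist_def)

lemma stop_Dpaths:
  fixes x :: "real \<Rightarrow> 'a::metric_space"
  assumes x: "x \<in> Dpaths T" and t: "t \<in> {0..T}"
  shows "stop T t x \<in> Dpaths T"
proof -
  have R: "(stop T t x \<longlongrightarrow> stop T t x u) (at_right u)" if u: "u \<in> {0..<T}" for u
  proof (cases "u < t")
    case True
    have "(x \<longlongrightarrow> x u) (at_right u)"
      using x u by (auto simp: Dpaths_def cadlag_on_def)
    moreover have "eventually (\<lambda>s. x s = stop T t x s) (at_right u)"
      using True u t by (auto simp: eventually_at_right[OF True] stop_def intro!: exI[of _ t])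
    ultimately have "(stop T t x \<longlongrightarrow> x u) (at_right u)"
      by (rule Lim_transform_eventually)
    then show ?thesis using True u by (simp add: stop_def)
  next
    case False
    have "eventually (\<lambda>s. x t = stop T t x s) (at_right u)"
      using False u by (auto simp: eventually_at_right[of u T] stop_def min_def intro!: exI[of _ T])
    then have "(stop T t x \<longlongrightarrow> x t) (at_right u)"
      by (rule Lim_transform_eventually[OF tendsto_const])
    then show ?thesis using False u by (simp add: stop_def min_def)
  qed
  have L: "\<exists>l. (stop T t x \<longlongrightarrow> l) (at_left u)" if u: "u \<in> {0<..T}" for u
  proof (cases "u \<le> t")
    case True
    obtain l where "(x \<longlongrightarrow> l) (at_left u)"
      using x u unfolding Dpaths_def cadlag_on_def by blast
    moreover have "eventually (\<lambda>s. x s = stop T t x s) (at_left u)"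
      using True u t by (auto simp: eventually_at_left[of 0 u] stop_def intro!: exI[of _ 0])
    ultimately show ?thesis
      using Lim_transform_eventually by blast
  next
    case False
    have "eventually (\<lambda>s. x t = stop T t x s) (at_left u)"
      using False u t by (auto simp: eventually_at_left[of t u] stop_def min_def intro!: exI[of _ t])
    then show ?thesis
      using Lim_transform_eventually[OF tendsto_const] by blast
  qed
  show ?thesis using R L by (auto simp: Dpaths_def cadlag_on_def stop_def)
qed

lemma Metric_space_Stopped:
  "Metric_space (Stopped T) (d_inf T :: real \<times> (real \<Rightarrow> 'a::metric_space) \<Rightarrow> _)"
proof -
  interpret B: Metric_space "Met_TC.fspace {0..T}"
      "sup_dist T :: (real \<Rightarrow> 'a) \<Rightarrow> (real \<Rightarrow> 'a) \<Rightarrow> real"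
    by (simp add: sup_dist_def Met_TC.Metric_space_funspace)
  have mem: "snd p \<in> Met_TC.fspace {0..T}"
    if "p \<in> Stopped T" for p :: "real \<times> (real \<Rightarrow> 'a)"
    using that by (auto simp: Stopped_def intro!: Dpaths_fspace stop_Dpaths)
  show ?thesis
  proof
    fix p q r :: "real \<times> (real \<Rightarrow> 'a)"
    show "0 \<le> d_inf T p q" by (simp add: d_inf_def)
    show "d_inf T p q = d_inf T q p" by (simp add: d_inf_def B.commute abs_minus_commute)
    show "d_inf T p q = 0 \<longleftrightarrow> p = q" if "p \<in> Stopped T" "q \<in> Stopped T"
      using B.zero[OF mem[OF that(1)] mem[OF that(2)]] B.nonneg[of "snd p" "snd q"]
      by (auto simp: d_inf_def prod_eq_iff add_nonneg_eq_0_iff)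
    show "d_inf T p r \<le> d_inf T p q + d_inf T q r"
      if "p \<in> Stopped T" "q \<in> Stopped T" "r \<in> Stopped T"
      using B.triangle[OF mem[OF that(1)] mem[OF that(2)] mem[OF that(3)]]
      by (simp add: d_inf_def)
  qed
qed


section \<open>Non-anticipative functionals\<close>

definition Stopped_borel ::
    "real \<Rightarrow> (real \<times> (real \<Rightarrow> 'a::metric_space)) measure" where
  "Stopped_borel T =
     sigma (Stopped T) {U. openin (Metric_space.mtopology (Stopped T) (d_inf T)) U}"

text \<open>
  Functionals are curried and extended from stopped paths to \<open>[0,T] \<times> D([0,T])\<close> by
  \<open>F(t,\<omega>) = F(t,\<omega>\<^sub>t)\<close>. Measurability concerns the restriction to stopped paths.
\<close>

type_synonym 'd fnl = "real \<Rightarrow> (real \<Rightarrow> real^'d) \<Rightarrow> real"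

definition nonanticipative :: "real \<Rightarrow> 'd::finite fnl \<Rightarrow> bool" where
  "nonanticipative T F \<longleftrightarrow>
     (\<forall>t\<in>{0..T}. \<forall>\<omega>\<in>Dpaths T. F t \<omega> = F t (stop T t \<omega>)) \<and>
     (\<lambda>(t, \<omega>). F t \<omega>) \<in> borel_measurable (Stopped_borel T)"

text \<open>
  The set \<open>I\<close> of times is \<open>[0,T]\<close>, except for horizontal derivatives, where it is \<open>[0,T)\<close>.
\<close>

definition continuous_fixed_times :: "real \<Rightarrow> real set \<Rightarrow> 'd::finite fnl \<Rightarrow> bool" where
  "continuous_fixed_times T I F \<longleftrightarrow>
     (\<forall>t\<in>I. \<forall>\<omega>\<in>Dpaths T. \<forall>\<epsilon>>0. \<exists>\<eta>>0. \<forall>\<omega>'\<in>Dpaths T.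
        sup_dist T (stop T t \<omega>) (stop T t \<omega>') < \<eta> \<longrightarrow> \<bar>F t \<omega> - F t \<omega>'\<bar> < \<epsilon>)"

definition boundedness_preserving :: "real \<Rightarrow> real set \<Rightarrow> 'd::finite fnl \<Rightarrow> bool" where
  "boundedness_preserving T I F \<longleftrightarrow>
     (\<forall>K t0. compact K \<and> t0 \<in> {0..T} \<longrightarrow>
        (\<exists>C>0. \<forall>t\<in>I. \<forall>\<omega>\<in>Dpaths T. t \<le> t0 \<and> \<omega> ` {0..t} \<subseteq> K \<longrightarrow> \<bar>F t \<omega>\<bar> < C))"

definition left_continuous :: "real \<Rightarrow> 'd::finite fnl \<Rightarrow> bool" where
  "left_continuous T F \<longleftrightarrow> nonanticipative T F \<and>
     (\<forall>(t, \<omega>)\<in>Stopped T. \<forall>\<epsilon>>0. \<exists>\<eta>>0. \<forall>(t', \<omega>')\<in>Stopped T.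
        t' < t \<and> d_inf T (t, \<omega>) (t', \<omega>') < \<eta> \<longrightarrow> \<bar>F t \<omega> - F t' \<omega>'\<bar> < \<epsilon>)"

definition Lip :: "real \<Rightarrow> 'd::finite fnl set" where
  "Lip T = {F. nonanticipative T F \<and>
     (\<exists>K>0. \<forall>t\<in>{0..T}. \<forall>\<omega>\<in>Dpaths T. \<forall>\<omega>'\<in>Dpaths T.
        \<bar>F t \<omega> - F t \<omega>'\<bar> \<le> K * sup_dist T (stop T t \<omega>) (stop T t \<omega>'))}"


section \<open>Horizontal and vertical derivatives\<close>

definition h_quotient ::
    "real \<Rightarrow> 'd::finite fnl \<Rightarrow> real \<Rightarrow> (real \<Rightarrow> real^'d) \<Rightarrow> real \<Rightarrow> real" where
  "h_quotient T F t \<omega> h = (F (t + h) (stop T t \<omega>) - F t (stop T t \<omega>)) / h"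

definition h_differentiable :: "real \<Rightarrow> 'd::finite fnl \<Rightarrow> bool" where
  "h_differentiable T F \<longleftrightarrow>
     (\<forall>t\<in>{0..<T}. \<forall>\<omega>\<in>Dpaths T. \<exists>l. (h_quotient T F t \<omega> \<longlongrightarrow> l) (at_right 0))"

definition h_deriv :: "real \<Rightarrow> 'd::finite fnl \<Rightarrow> 'd fnl" where
  "h_deriv T F t \<omega> = Lim (at_right 0) (h_quotient T F t \<omega>)"

definition bump :: "real \<Rightarrow> real \<Rightarrow> (real \<Rightarrow> real^'d) \<Rightarrow> real^'d \<Rightarrow> real \<Rightarrow> real^'d" where
  "bump T t \<omega> e = (\<lambda>s\<in>{0..T}. stop T t \<omega> s + (if t \<le> s then e else 0))"

definition v_differentiable :: "real \<Rightarrow> 'd::finite fnl \<Rightarrow> bool" where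
  "v_differentiable T F \<longleftrightarrow>
     (\<forall>t\<in>{0..T}. \<forall>\<omega>\<in>Dpaths T. \<exists>g. GDERIV (\<lambda>e. F t (bump T t \<omega> e)) 0 :> g)"

definition v_grad :: "real \<Rightarrow> 'd::finite fnl \<Rightarrow> real \<Rightarrow> (real \<Rightarrow> real^'d) \<Rightarrow> real^'d" where
  "v_grad T F t \<omega> = (THE g. GDERIV (\<lambda>e. F t (bump T t \<omega> e)) 0 :> g)"

text \<open>
  The components of the \<open>j\<close>-th iterated vertical derivative are the \<open>v_iter T F is\<close> with
  \<open>length is = j\<close>.
\<close>

fun v_iter :: "real \<Rightarrow> 'd::finite fnl \<Rightarrow> 'd list \<Rightarrow> 'd fnl" where
  "v_iter T F [] = F"
| "v_iter T F (i # is) = (\<lambda>t \<omega>. v_grad T (v_iter T F is) t \<omega> $ i)"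

definition C1b :: "real \<Rightarrow> nat \<Rightarrow> 'd::finite fnl set" where
  "C1b T k = {F. nonanticipative T F \<and>
     h_differentiable T F \<and>
     continuous_fixed_times T {0..<T} (h_deriv T F) \<and>
     boundedness_preserving T {0..<T} (h_deriv T F) \<and>
     (\<forall>is. length is < k \<longrightarrow> v_differentiable T (v_iter T F is)) \<and>
     (\<forall>is. length is \<le> k \<longrightarrow> left_continuous T (v_iter T F is)) \<and>
     (\<forall>is. 1 \<le> length is \<and> length is \<le> k \<longrightarrow>
        boundedness_preserving T {0..T} (v_iter T F is))}"


section \<open>Partitions and quadratic variation\<close>

text \<open>
  A sequence of partitions of \<open>[0,T]\<close> is given by the numbers \<open>m n\<close> of intervals and the points \<open>\<tau> n i\<close>,
  \<open>i \<le> m n\<close>.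
\<close>

definition partitions :: "real \<Rightarrow> (nat \<Rightarrow> nat) \<Rightarrow> (nat \<Rightarrow> nat \<Rightarrow> real) \<Rightarrow> bool" where
  "partitions T m \<tau> \<longleftrightarrow>
     (\<forall>n. \<tau> n 0 = 0 \<and> \<tau> n (m n) = T \<and> (\<forall>i<m n. \<tau> n i < \<tau> n (Suc i)))"

definition osc ::
    "(nat \<Rightarrow> nat) \<Rightarrow> (nat \<Rightarrow> nat \<Rightarrow> real) \<Rightarrow> (real \<Rightarrow> real^'d) \<Rightarrow> nat \<Rightarrow> real" where
  "osc m \<tau> \<omega> n =
     (MAX j\<in>{..<m n}. SUP t\<in>{\<tau> n j<..\<tau> n (Suc j)}. norm (\<omega> t - \<omega> (\<tau> n j)))"

definition qv_sum ::
    "(nat \<Rightarrow> nat) \<Rightarrow> (nat \<Rightarrow> nat \<Rightarrow> real) \<Rightarrow> (real \<Rightarrow> real) \<Rightarrow> real \<Rightarrow> nat \<Rightarrow> real" where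
  "qv_sum m \<tau> x t n =
     (\<Sum>i | i < m n \<and> \<tau> n (Suc i) \<le> t. (x (\<tau> n (Suc i)) - x (\<tau> n i))\<^sup>2)"

definition qv ::
    "(nat \<Rightarrow> nat) \<Rightarrow> (nat \<Rightarrow> nat \<Rightarrow> real) \<Rightarrow> (real \<Rightarrow> real) \<Rightarrow> real \<Rightarrow> real" where
  "qv m \<tau> x t = lim (qv_sum m \<tau> x t)"

definition Q1 ::
    "real \<Rightarrow> (nat \<Rightarrow> nat) \<Rightarrow> (nat \<Rightarrow> nat \<Rightarrow> real) \<Rightarrow> (real \<Rightarrow> real) set" where
  "Q1 T m \<tau> = {x. cadlag_on T x \<and>
     (\<forall>t\<in>{0..T}. convergent (qv_sum m \<tau> x t)) \<and>
     (\<exists>c. continuous_on {0..T} c \<and> mono_on {0..T} c \<and>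
        (\<forall>t\<in>{0..T}. ((\<lambda>s. (x s - left_value x s)\<^sup>2) has_sum (qv m \<tau> x t - c t)) {0<..t}))}"

definition Q ::
    "real \<Rightarrow> (nat \<Rightarrow> nat) \<Rightarrow> (nat \<Rightarrow> nat \<Rightarrow> real) \<Rightarrow> (real \<Rightarrow> real^'d::finite) set" where
  "Q T m \<tau> = {\<omega> \<in> extensional {0..T}.
     (\<forall>i. (\<lambda>t. \<omega> t $ i) \<in> Q1 T m \<tau>) \<and>
     (\<forall>i j. (\<lambda>t. \<omega> t $ i + \<omega> t $ j) \<in> Q1 T m \<tau>)}"

definition Hoelder :: "real \<Rightarrow> real \<Rightarrow> (real \<Rightarrow> real^'d) set" where
  "Hoelder T \<nu> = {\<omega> \<in> extensional {0..T}.
     \<exists>C. \<forall>s\<in>{0..T}. \<forall>t\<in>{0..T}. norm (\<omega> t - \<omega> s) \<le> C * \<bar>t - s\<bar> powr \<nu>}"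


section \<open>Integrals\<close>

definition step_path ::
    "real \<Rightarrow> (nat \<Rightarrow> nat) \<Rightarrow> (nat \<Rightarrow> nat \<Rightarrow> real) \<Rightarrow> (real \<Rightarrow> real^'d) \<Rightarrow> nat \<Rightarrow> real \<Rightarrow> real^'d"
  where
  "step_path T m \<tau> \<omega> n = (\<lambda>s\<in>{0..T}.
     (\<Sum>i<m n. indicator {\<tau> n i..<\<tau> n (Suc i)} s *\<^sub>R \<omega> (\<tau> n (Suc i)))
     + indicator {T} s *\<^sub>R \<omega> T)"

definition path_int_sum ::
    "real \<Rightarrow> (nat \<Rightarrow> nat) \<Rightarrow> (nat \<Rightarrow> nat \<Rightarrow> real) \<Rightarrow> (real \<Rightarrow> (real \<Rightarrow> real^'d) \<Rightarrow> real^'d) \<Rightarrow>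
     (real \<Rightarrow> real^'d) \<Rightarrow> real \<Rightarrow> nat \<Rightarrow> real" where
  "path_int_sum T m \<tau> G \<omega> t n =
     (\<Sum>i<m n. G (\<tau> n i) (stop_left T (\<tau> n i) (step_path T m \<tau> \<omega> n))
               \<bullet> (\<omega> (min (\<tau> n (Suc i)) t) - \<omega> (min (\<tau> n i) t)))"

definition path_int ::
    "real \<Rightarrow> (nat \<Rightarrow> nat) \<Rightarrow> (nat \<Rightarrow> nat \<Rightarrow> real) \<Rightarrow> (real \<Rightarrow> (real \<Rightarrow> real^'d) \<Rightarrow> real^'d) \<Rightarrow>
     (real \<Rightarrow> real^'d) \<Rightarrow> real \<Rightarrow> real" where
  "path_int T m \<tau> G \<omega> t = lim (path_int_sum T m \<tau> G \<omega> t)"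

text \<open>
  Lebesgue--Stieltjes integration on \<open>[0,T]\<close> against \<open>d[x]\<close> for continuous \<open>x\<close>. The integrator
  \<open>[x]\<close> is continuous and increasing on \<open>[0,T]\<close> and is extended by constants to the real line.
\<close>

definition qv_measure ::
    "real \<Rightarrow> (nat \<Rightarrow> nat) \<Rightarrow> (nat \<Rightarrow> nat \<Rightarrow> real) \<Rightarrow> (real \<Rightarrow> real) \<Rightarrow> real measure" where
  "qv_measure T m \<tau> x = interval_measure (\<lambda>s. qv m \<tau> x (max 0 (min T s)))"

text \<open>
  By definition \<open>[\<omega>]\<^sup>i\<^sup>j = ([\<omega>\<^sup>i + \<omega>\<^sup>j] - [\<omega>\<^sup>i] - [\<omega>\<^sup>j]) / 2\<close>; each term is increasing, so
  integration against \<open>d[\<omega>]\<^sup>i\<^sup>j\<close> is the corresponding combination of three integrals.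
\<close>

definition qcov_integrable ::
    "real \<Rightarrow> (nat \<Rightarrow> nat) \<Rightarrow> (nat \<Rightarrow> nat \<Rightarrow> real) \<Rightarrow> (real \<Rightarrow> real^'d) \<Rightarrow> 'd \<Rightarrow> 'd \<Rightarrow>
     (real \<Rightarrow> real) \<Rightarrow> bool" where
  "qcov_integrable T m \<tau> \<omega> i j f \<longleftrightarrow>
     set_integrable (qv_measure T m \<tau> (\<lambda>t. \<omega> t $ i + \<omega> t $ j)) {0..T} f \<and>
     set_integrable (qv_measure T m \<tau> (\<lambda>t. \<omega> t $ i)) {0..T} f \<and>
     set_integrable (qv_measure T m \<tau> (\<lambda>t. \<omega> t $ j)) {0..T} f"

definition qcov_integral ::
    "real \<Rightarrow> (nat \<Rightarrow> nat) \<Rightarrow> (nat \<Rightarrow> nat \<Rightarrow> real) \<Rightarrow> (real \<Rightarrow> real^'d) \<Rightarrow> 'd \<Rightarrow> 'd \<Rightarrow>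
     (real \<Rightarrow> real) \<Rightarrow> real" where
  "qcov_integral T m \<tau> \<omega> i j f =
     ((LINT s:{0..T}|qv_measure T m \<tau> (\<lambda>t. \<omega> t $ i + \<omega> t $ j). f s)
      - (LINT s:{0..T}|qv_measure T m \<tau> (\<lambda>t. \<omega> t $ i). f s)
      - (LINT s:{0..T}|qv_measure T m \<tau> (\<lambda>t. \<omega> t $ j). f s)) / 2"

text \<open>\<open>\<integral>\<^sub>0\<^sup>T \<langle>A, d[\<omega>]\<rangle>\<close> with \<open>\<langle>A, B\<rangle> = tr(AB) = \<Sum>\<^sub>i \<Sum>\<^sub>j A\<^sub>i\<^sub>j B\<^sub>j\<^sub>i\<close>.\<close>

definition trace_integrable ::
    "real \<Rightarrow> (nat \<Rightarrow> nat) \<Rightarrow> (nat \<Rightarrow> nat \<Rightarrow> real) \<Rightarrow> (real \<Rightarrow> real^'d::finite) \<Rightarrow>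
     (real \<Rightarrow> real^'d^'d) \<Rightarrow> bool" where
  "trace_integrable T m \<tau> \<omega> A \<longleftrightarrow> (\<forall>i j. qcov_integrable T m \<tau> \<omega> j i (\<lambda>s. A s $ i $ j))"

definition trace_integral ::
    "real \<Rightarrow> (nat \<Rightarrow> nat) \<Rightarrow> (nat \<Rightarrow> nat \<Rightarrow> real) \<Rightarrow> (real \<Rightarrow> real^'d::finite) \<Rightarrow>
     (real \<Rightarrow> real^'d^'d) \<Rightarrow> real" where
  "trace_integral T m \<tau> \<omega> A =
     (\<Sum>i\<in>UNIV. \<Sum>j\<in>UNIV. qcov_integral T m \<tau> \<omega> j i (\<lambda>s. A s $ i $ j))"

definition outer_square :: "real^'d \<Rightarrow> real^'d^'d" where
  "outer_square v = (\<chi> i j. v $ i * v $ j)"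

end

theory Submission
  imports Defs
begin

text \<open>
  Why the theorem holds. Write \<open>V\<close> for a continuous function of finite variation. A functional Ito
  formula gives \<open>F(t,\<omega>) = F(0,\<omega>) + I(t) + V(t)\<close> with the pathwise integral \<open>I\<close> of \<open>\<nabla>F\<close>. Along the
  partitions the increments of \<open>V\<close> have vanishing quadratic variation, so that \<open>F\<close> and \<open>I\<close> have the
  same one. A first order expansion \<open>F(t\<^sub>i\<^sub>+\<^sub>1,\<omega>) - F(t\<^sub>i,\<omega>) = \<nabla>F(t\<^sub>i,\<omega>) \<bullet> \<delta>\<^sub>i + R\<^sub>i\<close> with
  \<open>\<Sum> R\<^sub>i\<^sup>2 \<rightarrow> 0\<close> reduces it to the sums \<open>\<Sum> (\<nabla>F(t\<^sub>i,\<omega>) \<bullet> \<delta>\<^sub>i)\<^sup>2\<close>, and these converge to the integral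
  against \<open>d[\<omega>]\<close>.

  \<^item> Ito formula (\<open>path_int_sum_tendsto\<close>). The path is replaced by a step path that jumps at the grid
    points. At a grid point \<open>F\<close> has a second order Taylor expansion in the jump, and between two grid
    points it is the integral of its horizontal derivative. After summation the horizontal part
    converges by dominated convergence, the second order part by the statement on quadratic sums
    below, and the Lipschitz condition on \<open>F\<close> removes the step path.

  \<^item> Quadratic sums (\<open>weighted_sums_tendsto_Stieltjes\<close>). For weights \<open>H\<^sub>n(i)\<close> that approach \<open>h(s)\<close> when
    \<open>t\<^sub>i\<close> approaches \<open>s\<close> strictly from the left, \<open>\<Sum> H\<^sub>n(i) (\<Delta>x\<^sub>i)\<^sup>2\<close> converges to \<open>\<integral> h d[x]\<close>. Pointwise
    convergence of the weights would not suffice, as they could be correlated with the increments; the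
    approach from the left makes the weights nearly constant on cells that exhaust \<open>d[x]\<close> up to a small
    remainder.

  \<^item> Remainder (\<open>Hoelder_remainder_bound\<close>). On an interval of length \<open>\<Delta>\<close> one compares \<open>\<omega>\<close> with a step
    path with about \<open>\<Delta>\<^sup>-\<^sup>\<nu>\<close> steps. Summation by parts, where the regularity of \<open>\<nabla>F\<close> enters, gives a
    remainder of order \<open>\<Delta>\<close> to the power \<open>\<nu> + \<nu>\<^sup>2\<close> (or \<open>1\<close> if that is smaller). Twice this exponent
    exceeds \<open>1\<close> exactly for \<open>\<nu> > (\<surd>3 - 1) / 2\<close>.

  The mesh of the partitions may stay away from \<open>0\<close>, when \<open>\<omega>\<close> is nearly constant on long intervals.
  All estimates are therefore in terms of the oscillation of \<open>\<omega>\<close>, and the long intervals are treated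
  by the assumption on the increments of \<open>F\<close> (\<open>sums_of_squares_small\<close>, \<open>finite_variation_squares\<close>).
\<close>

section \<open>One-sided derivatives and sums of squares\<close>

text \<open>
  At the last point where \<open>g\<close> lies below the line of slope \<open>M\<close> through its starting point, its right
  difference quotients are at least \<open>M\<close>.
\<close>

lemma right_derivative_upper_bound:
  fixes g :: "real \<Rightarrow> real"
  assumes "a \<le> b" and cont: "continuous_on {a..b} g"
    and D: "\<And>u. u \<in> {a..<b} \<Longrightarrow> ((\<lambda>h. (g (u + h) - g u) / h) \<longlongrightarrow> D u) (at_right 0)"
    and M: "\<And>u. u \<in> {a..<b} \<Longrightarrow> D u < M"
  shows "g b - g a \<le> M * (b - a)"
proof (rule ccontr)
  assume neg: "\<not> ?thesis"
  define f where "f u = g u - g a - M * (u - a)" for u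
  have fc: "continuous_on {a..b} f" unfolding f_def by (intro continuous_intros cont)
  define S where "S = {u \<in> {a..b}. f u \<le> 0}"
  have "closed S" unfolding S_def
    using continuous_closed_preimage[OF fc, of "{..0}"] by (simp add: vimage_def Int_def)
  moreover have "bounded S" by (rule bounded_subset[of "{a..b}"]) (auto simp: S_def)
  ultimately have "compact S" by (simp add: compact_eq_bounded_closed)
  moreover have "a \<in> S" using \<open>a \<le> b\<close> by (simp add: S_def f_def)
  ultimately obtain c where c: "c \<in> S" "\<And>u. u \<in> S \<Longrightarrow> u \<le> c"
    using compact_attains_sup[of S] by blast
  have "f b > 0" using neg by (simp add: f_def)
  with c(1) have cb: "c \<in> {a..<b}" by (cases "c = b") (auto simp: S_def)
  have "\<forall>\<^sub>F h in at_right 0. h \<in> {0<..<b - c}"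
    using cb by (intro eventually_at_right_real) simp
  then have "\<forall>\<^sub>F h in at_right 0. M \<le> (g (c + h) - g c) / h"
  proof eventually_elim
    case (elim h)
    then have "c + h \<notin> S" using c(2)[of "c + h"] by auto
    then have "f (c + h) > 0" using elim cb by (auto simp: S_def)
    moreover have "f c \<le> 0" using c(1) by (simp add: S_def)
    ultimately have "M * h \<le> g (c + h) - g c" by (simp add: f_def algebra_simps)
    then show ?case using elim by (simp add: field_simps)
  qed
  then have "M \<le> D c"
    by (intro tendsto_lowerbound[OF D[OF cb]]) auto
  with M[OF cb] show False by simp
qed

lemma right_derivative_bound:
  fixes g :: "real \<Rightarrow> real"
  assumes "a \<le> b" and cont: "continuous_on {a..b} g"
    and D: "\<And>u. u \<in> {a..<b} \<Longrightarrow> ((\<lambda>h. (g (u + h) - g u) / h) \<longlongrightarrow> D u) (at_right 0)"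
    and M: "\<And>u. u \<in> {a..<b} \<Longrightarrow> \<bar>D u\<bar> < M"
  shows "\<bar>g b - g a\<bar> \<le> M * (b - a)"
proof -
  have "g b - g a \<le> M * (b - a)"
    using M by (intro right_derivative_upper_bound[OF \<open>a \<le> b\<close> cont D]) (auto simp: abs_less_iff)
  moreover have "(- g b) - (- g a) \<le> M * (b - a)"
  proof (rule right_derivative_upper_bound[where D = "\<lambda>u. - D u" and g = "\<lambda>u. - g u", OF \<open>a \<le> b\<close>])
    show "((\<lambda>h. (- g (u + h) - - g u) / h) \<longlongrightarrow> - D u) (at_right 0)" if "u \<in> {a..<b}" for u
      using tendsto_minus[OF D[OF that]] by (simp add: minus_divide_left)
  qed (use M in \<open>auto intro!: continuous_intros cont simp: abs_less_iff\<close>)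
  ultimately show ?thesis by (simp add: abs_le_iff)
qed

text \<open>
  Horizontal derivatives are one-sided, so the usual fundamental theorem of calculus does not apply.
  Instead, the difference quotients with increment \<open>1 / (n + 1)\<close> are bounded and converge to \<open>D\<close>, and
  their integrals are differences of two averages of \<open>g\<close>, one next to \<open>b\<close> and one next to \<open>a\<close>.
\<close>

lemma right_derivative_has_integral:
  fixes g :: "real \<Rightarrow> real"
  assumes "a \<le> b" and cont: "continuous_on {a..b} g"
    and D: "\<And>u. u \<in> {a..<b} \<Longrightarrow> ((\<lambda>h. (g (u + h) - g u) / h) \<longlongrightarrow> D u) (at_right 0)"
    and M: "\<And>u. u \<in> {a..<b} \<Longrightarrow> \<bar>D u\<bar> < M"
  shows "(D has_integral (g b - g a)) {a..b}"
proof (cases "a = b")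
  case True then show ?thesis by (simp add: has_integral_refl)
next
  case False
  then have "a < b" using \<open>a \<le> b\<close> by simp
  \<comment> \<open>Continuing \<open>g\<close> by constants makes difference quotients of all step sizes available on \<open>[a, b]\<close>.\<close>
  define k where "k x = g (max a (min b x))" for x
  have kc: "continuous_on UNIV k" unfolding k_def
    by (rule continuous_on_compose2[OF cont]) (auto intro!: continuous_intros simp: \<open>a \<le> b\<close>)
  then have kint: "k integrable_on {x..y}" for x y
    using continuous_on_subset integrable_continuous_real by blast
  define e where "e n = 1 / real (Suc n)" for n
  have e: "e n > 0" for n by (simp add: e_def)
  have e0: "e \<longlonglongrightarrow> 0" unfolding e_def using LIMSEQ_inverse_real_of_nat by (simp add: inverse_eq_divide)
  then have e_right: "filterlim e (at_right 0) sequentially"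
    using e by (auto simp: filterlim_at intro!: always_eventually less_imp_neq[symmetric])
  define q where "q n x = (k (x + e n) - k x) / e n" for n x
  define D' where "D' x = (if x = b then 0 else D x)" for x
  have M0: "0 < M" using M[of a] \<open>a < b\<close> by fastforce
  have kLip: "\<bar>k y - k x\<bar> \<le> M * (y - x)" if "x \<le> y" for x y
  proof -
    define x' y' where "x' = max a (min b x)" and "y' = max a (min b y)"
    have xy: "a \<le> x'" "x' \<le> y'" "y' \<le> b" using that \<open>a \<le> b\<close> by (auto simp: x'_def y'_def)
    have "\<bar>g y' - g x'\<bar> \<le> M * (y' - x')"
    proof (rule right_derivative_bound[where D = D])
      show "continuous_on {x'..y'} g" using xy by (intro continuous_on_subset[OF cont]) auto
    qed (use xy D M in auto)
    also have "\<dots> \<le> M * (y - x)" using M0 that by (intro mult_left_mono) (auto simp: x'_def y'_def)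
    finally show ?thesis by (simp add: k_def x'_def y'_def)
  qed
  have q_int: "q n integrable_on {a..b}" for n
  proof (rule integrable_continuous_real)
    have "continuous_on {a..b} (\<lambda>x. k (x + e n))"
      by (rule continuous_on_compose2[OF kc, of _ "\<lambda>x. x + e n"]) (auto intro!: continuous_intros)
    moreover have "continuous_on {a..b} k" using kc by (rule continuous_on_subset) simp
    ultimately have "continuous_on {a..b} (\<lambda>x. (k (x + e n) - k x) * inverse (e n))"
      by (intro continuous_on_mult continuous_on_diff continuous_on_const)
    then show "continuous_on {a..b} (q n)" by (simp add: q_def[abs_def] divide_inverse)
  qed
  have q_bd: "norm (q n x) \<le> M" for n x
  proof -
    have "\<bar>k (x + e n) - k x\<bar> \<le> M * e n" using kLip[of x "x + e n"] e[of n] by simp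
    then show ?thesis using e[of n] by (simp add: q_def abs_divide pos_divide_le_eq)
  qed
  have q_lim: "(\<lambda>n. q n x) \<longlonglongrightarrow> D' x" if x: "x \<in> {a..b}" for x
  proof (cases "x = b")
    case True
    then have "q n x = 0" for n using e[of n] \<open>a \<le> b\<close> by (simp add: q_def k_def min_def)
    then show ?thesis using True by (simp add: D'_def)
  next
    case False
    then have x': "x \<in> {a..<b}" using x by auto
    have "(\<lambda>n. (g (x + e n) - g x) / e n) \<longlonglongrightarrow> D x"
      using filterlim_compose[OF D[OF x'] e_right] .
    moreover have "\<forall>\<^sub>F n in sequentially. e n < b - x"
      using order_tendstoD(2)[OF e0, of "b - x"] x' by simp
    then have "\<forall>\<^sub>F n in sequentially. (g (x + e n) - g x) / e n = q n x"
      proof eventually_elim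
      case (elim n)
      then have "k (x + e n) = g (x + e n)" "k x = g x"
        using x' e[of n] by (simp_all add: k_def max_def min_def)
      then show ?case by (simp add: q_def)
    qed
    ultimately have "(\<lambda>n. q n x) \<longlonglongrightarrow> D x" by (rule Lim_transform_eventually)
    then show ?thesis using False by (simp add: D'_def)
  qed
  have dc: "D' integrable_on {a..b}" "(\<lambda>n. integral {a..b} (q n)) \<longlonglongrightarrow> integral {a..b} D'"
    using dominated_convergence[where h = "\<lambda>_. M", OF q_int integrable_const_ivl q_bd q_lim] by auto
  define K where "K x = integral {a - 1..x} k" for x
  have K_deriv: "(K has_real_derivative k x) (at x)" if "x \<in> {a..b + 1}" for x
  proof -
    have "(K has_vector_derivative k x) (at x within {a - 1..b + 2})"
      unfolding K_def using that
      by (intro integral_has_vector_derivative continuous_on_subset[OF kc]) auto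
    moreover have "at x within {a - 1..b + 2} = at x"
      using that by (intro at_within_interior) (auto simp: interior_atLeastAtMost_real)
    ultimately show ?thesis by (simp add: has_real_derivative_iff_has_vector_derivative)
  qed
  have "integral {a..b} (q n) = (K (b + e n) - K b) / e n - (K (a + e n) - K a) / e n" for n
  proof (rule integral_unique)
    have "e n \<le> 1" by (simp add: e_def)
    then have "((\<lambda>x. (K (x + e n) - K x) / e n) has_real_derivative q n x) (at x)"
      if "x \<in> {a..b}" for x
      unfolding q_def using that e[of n]
      by (intro DERIV_cdivide DERIV_diff K_deriv DERIV_shift[THEN iffD1]) auto
    then have "(q n has_integral (K (b + e n) - K b) / e n - (K (a + e n) - K a) / e n) {a..b}"
      using \<open>a \<le> b\<close> has_field_derivative_at_within[of _ _ _ "{a..b}"]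
      by (intro fundamental_theorem_of_calculus)
        (auto simp: has_real_derivative_iff_has_vector_derivative[symmetric])
    then show "(q n has_integral (K (b + e n) - K b) / e n - (K (a + e n) - K a) / e n) {a..b}" .
  qed
  moreover have K': "(\<lambda>n. (K (x + e n) - K x) / e n) \<longlonglongrightarrow> k x" if "x \<in> {a..b + 1}" for x
  proof -
    have "((\<lambda>h. (K (x + h) - K x) / h) \<longlongrightarrow> k x) (at 0)"
      using K_deriv[OF that] by (simp add: DERIV_def)
    moreover have "filterlim e (at 0) sequentially"
      using e_right by (rule filterlim_mono) (auto simp: at_le)
    ultimately show ?thesis by (rule filterlim_compose)
  qed
  ultimately have "(\<lambda>n. integral {a..b} (q n)) \<longlonglongrightarrow> k b - k a"
    using tendsto_diff[OF K'[of b] K'[of a]] \<open>a \<le> b\<close> by simp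
  with dc(2) have "integral {a..b} D' = k b - k a" by (rule LIMSEQ_unique)
  with dc(1) have "(D' has_integral k b - k a) {a..b}" by (simp add: has_integral_iff)
  moreover have "k a = g a" "k b = g b" using \<open>a \<le> b\<close> by (simp_all add: k_def)
  ultimately have "(D' has_integral g b - g a) {a..b}" by simp
  then show ?thesis
    by (rule has_integral_spike_finite[of "{b}", rotated 2]) (auto simp: D'_def)
qed

text \<open>
  Polya's theorem: between neighbouring points of a grid on which \<open>q\<close> varies little, monotonicity traps
  \<open>f n\<close> between its values at these points.
\<close>

lemma monotone_limit_uniform:
  fixes f :: "nat \<Rightarrow> real \<Rightarrow> real" and q :: "real \<Rightarrow> real"
  assumes "a \<le> b" and mono: "\<And>n. mono_on {a..b} (f n)"
    and cont: "continuous_on {a..b} q"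
    and lim: "\<And>t. t \<in> {a..b} \<Longrightarrow> (\<lambda>n. f n t) \<longlonglongrightarrow> q t"
  shows "uniform_limit {a..b} f q sequentially"
proof (rule uniform_limitI)
  fix \<epsilon> :: real assume "\<epsilon> > 0"
  have "uniformly_continuous_on {a..b} q" using cont by (rule compact_uniformly_continuous) simp
  then obtain d where d: "d > 0" "\<And>x y. x \<in> {a..b} \<Longrightarrow> y \<in> {a..b} \<Longrightarrow> dist y x < d \<Longrightarrow> dist (q y) (q x) < \<epsilon> / 2"
    using \<open>\<epsilon> > 0\<close> unfolding uniformly_continuous_on_def by (metis half_gt_zero)
  obtain N :: nat where N: "(b - a) / d < N" using reals_Archimedean2 by blast
  then have "N > 0" using \<open>a \<le> b\<close> \<open>d > 0\<close> by (cases "N = 0") (auto simp: divide_less_0_iff)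
  have step: "(b - a) / N < d" using N \<open>N > 0\<close> \<open>d > 0\<close> by (simp add: field_simps)
  define p where "p k = a + real k * ((b - a) / N)" for k
  have p_in: "p k \<in> {a..b}" if "k \<le> N" for k
  proof -
    have "real k * ((b - a) / N) \<le> real N * ((b - a) / N)"
      using that \<open>a \<le> b\<close> by (intro mult_right_mono) auto
    then show ?thesis using \<open>N > 0\<close> \<open>a \<le> b\<close> by (simp add: p_def)
  qed
  have "\<forall>\<^sub>F n in sequentially. \<forall>k\<in>{..N}. dist (f n (p k)) (q (p k)) < \<epsilon> / 2"
    using \<open>\<epsilon> > 0\<close> p_in by (intro eventually_ball_finite ballI tendstoD[OF lim]) auto
  then show "\<forall>\<^sub>F n in sequentially. \<forall>x\<in>{a..b}. dist (f n x) (q x) < \<epsilon>"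
  proof (eventually_elim, intro ballI)
    fix n x assume close: "\<forall>k\<in>{..N}. dist (f n (p k)) (q (p k)) < \<epsilon> / 2" and x: "x \<in> {a..b}"
    have "\<exists>k<N. x \<in> {p k..p (Suc k)}"
    proof (cases "x = b")
      case True
      have "p N = b" using \<open>N > 0\<close> by (simp add: p_def)
      then show ?thesis using True p_in[of "N - 1"] \<open>N > 0\<close> by (intro exI[of _ "N - 1"]) auto
    next
      case False
      then have ab: "b - a > 0" using x by auto
      define k where "k = nat \<lfloor>(x - a) / ((b - a) / N)\<rfloor>"
      have pos: "(b - a) / N > 0" using ab \<open>N > 0\<close> by simp
      have "0 \<le> (x - a) / ((b - a) / N)" using x pos by (intro divide_nonneg_nonneg) auto
      then have "real k \<le> (x - a) / ((b - a) / N)" "(x - a) / ((b - a) / N) < real k + 1"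
        unfolding k_def by linarith+
      then have "real k * ((b - a) / N) \<le> x - a" "x - a < (real k + 1) * ((b - a) / N)"
        using pos unfolding pos_le_divide_eq[OF pos] pos_divide_less_eq[OF pos] by blast+
      then have "x \<in> {p k..p (Suc k)}" by (simp add: p_def algebra_simps)
      moreover have "real k < N"
      proof -
        have "(x - a) / ((b - a) / N) < N" using x False ab \<open>N > 0\<close> by (simp add: field_simps)
        then show ?thesis using \<open>real k \<le> _\<close> by linarith
      qed
      ultimately show ?thesis by auto
    qed
    then obtain k where k: "k < N" "x \<in> {p k..p (Suc k)}" by blast
    have pk: "p k \<in> {a..b}" "p (Suc k) \<in> {a..b}" using k(1) p_in[of k] p_in[of "Suc k"] by (blast intro: less_imp_le Suc_leI)+
    have "dist x (p k) \<le> (b - a) / N" "dist x (p (Suc k)) \<le> (b - a) / N"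
      using k(2) by (auto simp: p_def dist_real_def algebra_simps add_divide_distrib diff_divide_distrib)
    then have "dist (q x) (q (p k)) < \<epsilon> / 2" "dist (q x) (q (p (Suc k))) < \<epsilon> / 2"
      using step d(2)[OF pk(1) x] d(2)[OF pk(2) x] by auto
    moreover have "f n (p k) \<le> f n x" "f n x \<le> f n (p (Suc k))"
      using mono[of n] k(2) pk x by (auto intro: mono_onD)
    moreover have "dist (f n (p k)) (q (p k)) < \<epsilon> / 2"
        "dist (f n (p (Suc k))) (q (p (Suc k))) < \<epsilon> / 2"
      using close k(1) by auto
    ultimately show "dist (f n x) (q x) < \<epsilon>"
      unfolding dist_real_def by linarith
  qed
qed

text \<open>
  The cross terms vanish by the Cauchy--Schwarz inequality.
\<close>

lemma sum_squares_perturb: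
  fixes a b :: "nat \<Rightarrow> nat \<Rightarrow> real"
  assumes a: "(\<lambda>n. \<Sum>i<m n. (a n i)\<^sup>2) \<longlonglongrightarrow> L" and b: "(\<lambda>n. \<Sum>i<m n. (b n i)\<^sup>2) \<longlonglongrightarrow> 0"
  shows "(\<lambda>n. \<Sum>i<m n. (a n i + b n i)\<^sup>2) \<longlonglongrightarrow> L"
proof -
  have "(\<lambda>n. sqrt (\<Sum>i<m n. (a n i)\<^sup>2) * sqrt (\<Sum>i<m n. (b n i)\<^sup>2)) \<longlonglongrightarrow> sqrt L * sqrt 0"
    by (intro tendsto_intros a b)
  then have bound0: "(\<lambda>n. sqrt (\<Sum>i<m n. (a n i)\<^sup>2) * sqrt (\<Sum>i<m n. (b n i)\<^sup>2)) \<longlonglongrightarrow> 0"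
    by simp
  have "(\<lambda>n. \<Sum>i<m n. a n i * b n i) \<longlonglongrightarrow> 0"
  proof (rule Lim_null_comparison[OF _ bound0])
    show "\<forall>\<^sub>F n in sequentially. norm (\<Sum>i<m n. a n i * b n i)
        \<le> sqrt (\<Sum>i<m n. (a n i)\<^sup>2) * sqrt (\<Sum>i<m n. (b n i)\<^sup>2)"
    proof (intro always_eventually allI)
      fix n
      have "norm (\<Sum>i<m n. a n i * b n i) \<le> (\<Sum>i<m n. \<bar>a n i\<bar> * \<bar>b n i\<bar>)"
        using sum_abs[of "\<lambda>i. a n i * b n i" "{..<m n}"] by (simp add: abs_mult)
      also have "\<dots> \<le> L2_set (a n) {..<m n} * L2_set (b n) {..<m n}"
        by (rule L2_set_mult_ineq)
      finally show "norm (\<Sum>i<m n. a n i * b n i)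
          \<le> sqrt (\<Sum>i<m n. (a n i)\<^sup>2) * sqrt (\<Sum>i<m n. (b n i)\<^sup>2)"
        by (simp add: L2_set_def)
    qed
  qed
  from tendsto_add[OF tendsto_add[OF a b] tendsto_mult_left[OF this, of 2]]
  show ?thesis by (simp add: power2_sum sum.distrib sum_distrib_left algebra_simps)
qed

text \<open>
  The intervals of length at most \<open>d\<close> contribute at most \<open>K\<^sup>2 T\<close> times \<open>d\<close> to the power \<open>2 q - 1 > 0\<close>. On
  a longer interval \<open>(r n)\<^sup>2 \<le> ((r n)\<^sup>2 / d) * l n i\<close>, so the uniform bound is enough there, and the
  lengths \<open>l n i\<close> need not become small.
\<close>

lemma sums_of_squares_small:
  fixes R l :: "nat \<Rightarrow> nat \<Rightarrow> real"
  assumes K: "0 \<le> K" and q: "1 / 2 < q"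
    and l: "\<And>n i. i < m n \<Longrightarrow> 0 < l n i" and total: "\<And>n. (\<Sum>i<m n. l n i) = T"
    and small: "\<And>n i. i < m n \<Longrightarrow> l n i \<le> 1 \<Longrightarrow> \<bar>R n i\<bar> \<le> K * l n i powr q"
    and unif: "\<And>n i. i < m n \<Longrightarrow> \<bar>R n i\<bar> \<le> r n" and r: "r \<longlonglongrightarrow> 0"
  shows "(\<lambda>n. \<Sum>i<m n. (R n i)\<^sup>2) \<longlonglongrightarrow> 0"
proof (rule LIMSEQ_I)
  fix \<epsilon> :: real assume "\<epsilon> > 0"
  have T0: "0 \<le> T" unfolding total[of 0, symmetric] using l by (intro sum_nonneg) (auto intro: less_imp_le)
  have "((\<lambda>d. K\<^sup>2 * d powr (2 * q - 1) * T) \<longlongrightarrow> K\<^sup>2 * 0 powr (2 * q - 1) * T) (at_right 0)"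
    using q by (intro tendsto_intros tendsto_powr2) (auto simp: eventually_at_right_field intro!: exI[of _ 1])
  then have "((\<lambda>d. K\<^sup>2 * d powr (2 * q - 1) * T) \<longlongrightarrow> 0) (at_right 0)" using q by simp
  then have "\<forall>\<^sub>F d in at_right 0. K\<^sup>2 * d powr (2 * q - 1) * T < \<epsilon> / 2"
    using \<open>\<epsilon> > 0\<close> by (intro order_tendstoD(2)[of _ 0]) auto
  moreover have "\<forall>\<^sub>F d in at_right (0::real). d \<in> {0<..<1}" by (intro eventually_at_right_real) simp
  ultimately have "\<forall>\<^sub>F d in at_right 0. K\<^sup>2 * d powr (2 * q - 1) * T < \<epsilon> / 2 \<and> d \<in> {0<..<1}"
    by (rule eventually_conj)
  then obtain d where d: "0 < d" "d < 1" "K\<^sup>2 * d powr (2 * q - 1) * T < \<epsilon> / 2"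
    using eventually_happens[of _ "at_right (0::real)"] by (auto simp: trivial_limit_at_right_real)
  have "(\<lambda>n. (r n)\<^sup>2 / d * T) \<longlonglongrightarrow> 0\<^sup>2 / d * T" using d(1) by (intro tendsto_intros r) auto
  then have "\<forall>\<^sub>F n in sequentially. (r n)\<^sup>2 / d * T < \<epsilon> / 2"
    using \<open>\<epsilon> > 0\<close> by (intro order_tendstoD(2)[of _ 0]) auto
  then have "\<forall>\<^sub>F n in sequentially. norm ((\<Sum>i<m n. (R n i)\<^sup>2) - 0) < \<epsilon>"
  proof eventually_elim
    case (elim n)
    have "(R n i)\<^sup>2 \<le> (K\<^sup>2 * d powr (2 * q - 1) + (r n)\<^sup>2 / d) * l n i" if i: "i < m n" for i
    proof (cases "l n i \<le> d")
      case True
      have "(R n i)\<^sup>2 \<le> (K * l n i powr q)\<^sup>2"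
        using small[OF i] True d(2) K by (intro power2_le_iff_abs_le[THEN iffD2]) auto
      also have "\<dots> = K\<^sup>2 * l n i powr (2 * q - 1) * l n i"
      proof -
        have "(l n i powr q)\<^sup>2 = l n i powr (q + q)" by (simp only: power2_eq_square powr_add)
        also have "q + q = (2 * q - 1) + 1" by simp
        also have "l n i powr \<dots> = l n i powr (2 * q - 1) * l n i"
          using l[OF i] by (subst powr_add) simp
        finally show ?thesis by (simp add: power_mult_distrib mult.assoc)
      qed
      also have "\<dots> \<le> K\<^sup>2 * d powr (2 * q - 1) * l n i"
        using True l[OF i] q by (intro mult_right_mono mult_left_mono powr_mono2) auto
      also have "\<dots> \<le> (K\<^sup>2 * d powr (2 * q - 1) + (r n)\<^sup>2 / d) * l n i"
        using l[OF i] d(1) by (intro mult_right_mono) auto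
      finally show ?thesis .
    next
      case False
      have "(R n i)\<^sup>2 \<le> (r n)\<^sup>2" using unif[OF i] by (intro power2_le_iff_abs_le[THEN iffD2]) auto
      also have "\<dots> = (r n)\<^sup>2 / d * d" using d(1) by simp
      also have "\<dots> \<le> (r n)\<^sup>2 / d * l n i" using False d(1) by (intro mult_left_mono) auto
      also have "\<dots> \<le> (K\<^sup>2 * d powr (2 * q - 1) + (r n)\<^sup>2 / d) * l n i"
        using l[OF i] d(1) by (intro mult_right_mono) auto
      finally show ?thesis .
    qed
    then have "(\<Sum>i<m n. (R n i)\<^sup>2) \<le> (\<Sum>i<m n. (K\<^sup>2 * d powr (2 * q - 1) + (r n)\<^sup>2 / d) * l n i)"
      by (intro sum_mono) simp
    also have "\<dots> = K\<^sup>2 * d powr (2 * q - 1) * T + (r n)\<^sup>2 / d * T"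
      unfolding sum_distrib_left[symmetric] total by (rule distrib_right)
    also have "\<dots> < \<epsilon>" using elim d(3) by linarith
    finally show ?case by (simp add: sum_nonneg)
  qed
  then show "\<exists>no. \<forall>n\<ge>no. norm ((\<Sum>i<m n. (R n i)\<^sup>2) - 0) < \<epsilon>" by (simp add: eventually_sequentially)
qed

section \<open>Quadratic sums and Stieltjes integrals\<close>

lemma grid_cell_unique:
  fixes T u :: real
  assumes "T > 0" "N > 0" "u \<in> {0<..T}"
  obtains j where "j < N" "u \<in> {real j * T / N<..real (Suc j) * T / N}"
    "\<And>k. k \<noteq> j \<Longrightarrow> u \<notin> {real k * T / N<..real (Suc k) * T / N}"
proof -
  define z where "z = u * N / T"
  have z: "0 < z" "z \<le> N" using assms by (auto simp: z_def field_simps)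
  have in_cell: "u \<in> {real k * T / N<..real (Suc k) * T / N} \<longleftrightarrow> real k < z \<and> z \<le> real k + 1" for k
    using assms by (auto simp: z_def field_simps)
  define j where "j = nat (\<lceil>z\<rceil> - 1)"
  have j: "real j < z" "z \<le> real j + 1" using z(1) unfolding j_def by linarith+
  show thesis
  proof (rule that[of j])
    show "j < N" using j(1) z(2) by linarith
    show "u \<in> {real j * T / N<..real (Suc j) * T / N}" using in_cell[of j] j by simp
    show "u \<notin> {real k * T / N<..real (Suc k) * T / N}" if "k \<noteq> j" for k
      unfolding in_cell using that j by linarith
  qed
qed

lemma Stieltjes_measure:
  fixes q :: "real \<Rightarrow> real"
  assumes "T > 0" and cont: "continuous_on {0..T} q" and mono: "mono_on {0..T} q"
  defines "M \<equiv> interval_measure (\<lambda>s. q (max 0 (min T s)))"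
  shows "0 \<le> a \<Longrightarrow> a \<le> b \<Longrightarrow> b \<le> T \<Longrightarrow> emeasure M {a<..b} = ennreal (q b - q a)"
    and "0 \<le> a \<Longrightarrow> a \<le> b \<Longrightarrow> b \<le> T \<Longrightarrow> emeasure M {a..b} = ennreal (q b - q a)"
proof -
  define f where "f s = q (max 0 (min T s))" for s
  have f_mono: "f x \<le> f y" if "x \<le> y" for x y
    unfolding f_def using that \<open>T > 0\<close> by (intro mono_onD[OF mono]) auto
  have f_cont: "continuous_on UNIV f" unfolding f_def
    by (rule continuous_on_compose2[OF cont]) (use \<open>T > 0\<close> in \<open>auto intro!: continuous_intros\<close>)
  then have f_isCont: "isCont f x" for x by (simp add: continuous_on_eq_continuous_at)
  then have f_right: "continuous (at_right x) f" for x by (simp add: continuous_at_imp_continuous_within)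
  have M: "M = interval_measure f" by (simp add: M_def f_def[abs_def])
  show "emeasure M {a<..b} = ennreal (q b - q a)" if "0 \<le> a" "a \<le> b" "b \<le> T"
    using emeasure_interval_measure_Ioc[of a b f] f_mono f_right that by (simp add: M f_def)
  show "emeasure M {a..b} = ennreal (q b - q a)" if "0 \<le> a" "a \<le> b" "b \<le> T"
    using emeasure_interval_measure_Icc[of a b f] f_mono f_cont that
    by (simp add: M f_def)
qed

text \<open>
  The sets \<open>X N\<close> stand for the graphs of \<open>h\<close> and of the weights with index at least \<open>N\<close>, whose values
  approach \<open>h s\<close> as the time increases to \<open>s\<close>. The conclusion is that, with cells of length \<open>T / N\<close>,
  these values are almost constant on an initial part of each cell, which ends at \<open>\<rho> j\<close>, and the final
  parts carry little \<open>dq\<close>-mass.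

  Reason: let \<open>A N\<close> be the set of times \<open>s\<close> at which the left limit is attained up to \<open>\<epsilon>\<close> at distance
  \<open>T / N\<close>. To the left of a point of \<open>A N\<close> a cell is good, so the bad part of a cell lies to the right of
  the supremum \<open>\<sigma>\<close> of its points in \<open>A N\<close> and is disjoint from \<open>A N\<close>. Every time belongs to \<open>A N\<close> for
  all large \<open>N\<close>; hence the indicators of the bad parts tend to \<open>0\<close> pointwise, and their \<open>dq\<close>-mass tends
  to \<open>0\<close> by dominated convergence.
\<close>

lemma left_limit_cell_approximation:
  fixes q h :: "real \<Rightarrow> real" and X :: "nat \<Rightarrow> (real \<times> real) set"
  assumes "T > 0" and cont: "continuous_on {0..T} q" and mono: "mono_on {0..T} q"
    and X_decr: "antimono X"
    and X_h: "\<And>N u. u \<in> {0..T} \<Longrightarrow> (u, h u) \<in> X N"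
    and X_lim: "\<And>s \<epsilon>. s \<in> {0<..T} \<Longrightarrow> \<epsilon> > 0 \<Longrightarrow>
        \<exists>\<eta>>0. \<exists>N. \<forall>(u, y)\<in>X N. s - \<eta> \<le> u \<and> u < s \<longrightarrow> \<bar>y - h s\<bar> \<le> \<epsilon>"
    and C: "\<And>u. u \<in> {0..T} \<Longrightarrow> \<bar>h u\<bar> \<le> C" and "\<epsilon> > 0"
  obtains N :: nat and \<rho> c :: "nat \<Rightarrow> real" where "N > 0"
    "\<And>j. j < N \<Longrightarrow> \<rho> j \<in> {real j * T / N..real (Suc j) * T / N}"
    "\<And>j. \<bar>c j\<bar> \<le> C"
    "\<And>j u y. j < N \<Longrightarrow> (u, y) \<in> X N \<Longrightarrow> u \<in> {real j * T / N<..\<rho> j} \<Longrightarrow> \<bar>y - c j\<bar> \<le> 2 * \<epsilon>"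
    "(\<Sum>j<N. q (real (Suc j) * T / N) - q (\<rho> j)) \<le> 2 * \<epsilon>"
proof -
  define M where "M = interval_measure (\<lambda>s. q (max 0 (min T s)))"
  have M_sets [measurable_cong, simp]: "sets M = sets borel" by (simp add: M_def)
  note M_Ioc = Stieltjes_measure(1)[OF \<open>T > 0\<close> cont mono, folded M_def]
  note M_Icc = Stieltjes_measure(2)[OF \<open>T > 0\<close> cont mono, folded M_def]
  define a where "a N j = real j * T / real N" for N j
  have a_in: "a N j \<in> {0..T}" if "j \<le> N" for N j
    using that \<open>T > 0\<close> by (cases "N = 0") (auto simp: a_def field_simps)
  have a_step: "a N (Suc j) - a N j = T / N" for N j
    by (simp add: a_def field_simps flip: diff_divide_distrib)
  have a_le: "a N j \<le> a N (Suc j)" for N j using a_step[of N j] \<open>T > 0\<close> by (smt (verit) divide_nonneg_nonneg of_nat_0_le_iff)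
  define A where "A N = {s \<in> {0<..T}. \<forall>(u, y)\<in>X N. s - T / N \<le> u \<and> u < s \<longrightarrow> \<bar>y - h s\<bar> \<le> \<epsilon>}" for N :: nat
  have A_exhaust: "\<forall>\<^sub>F N in sequentially. s \<in> A N" if s: "s \<in> {0<..T}" for s
  proof -
    obtain \<eta> N0 where \<eta>: "\<eta> > 0" "\<forall>(u, y)\<in>X N0. s - \<eta> \<le> u \<and> u < s \<longrightarrow> \<bar>y - h s\<bar> \<le> \<epsilon>"
      using X_lim[OF s \<open>\<epsilon> > 0\<close>] by blast
    have "(\<lambda>N. T / real N) \<longlonglongrightarrow> 0" by (rule lim_const_over_n)
    then have "\<forall>\<^sub>F N in sequentially. T / real N < \<eta>" by (rule order_tendstoD) (rule \<eta>)
    then show ?thesis using eventually_ge_at_top[of N0]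
    proof eventually_elim
      case (elim N)
      have "X N \<subseteq> X N0" using X_decr elim(2) by (auto dest: antimonoD)
      then show ?case using s \<eta>(2) elim(1) by (fastforce simp: A_def)
    qed
  qed
  define cell where "cell N j = A N \<inter> {a N j<..a N (Suc j)}" for N j
  define \<sigma> where "\<sigma> N j = (if cell N j = {} then a N j else Sup (cell N j))" for N j
  have cell_bdd: "bdd_above (cell N j)" for N j
    by (rule bdd_above_mono[of "{..a N (Suc j)}"]) (auto simp: cell_def)
  have \<sigma>_upper: "s \<le> \<sigma> N j" if "s \<in> cell N j" for s N j
    using that cSup_upper[OF that cell_bdd] by (auto simp: \<sigma>_def)
  have \<sigma>_in: "\<sigma> N j \<in> {a N j..a N (Suc j)}" for N j
  proof (cases "cell N j = {}")
    case True then show ?thesis using a_le by (simp add: \<sigma>_def)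
  next
    case False
    then obtain s where s: "s \<in> cell N j" by blast
    then have "a N j \<le> \<sigma> N j" using \<sigma>_upper[OF s] by (auto simp: cell_def)
    moreover have "Sup (cell N j) \<le> a N (Suc j)" using False by (intro cSup_least) (auto simp: cell_def)
    ultimately show ?thesis using False by (simp add: \<sigma>_def)
  qed
  define f where "f N s = (\<Sum>j<N. indicator {\<sigma> N j<..a N (Suc j)} s :: real)" for N s
  have f_A: "f N s = 0" if "s \<in> A N" for N s
  proof -
    have "s \<notin> {\<sigma> N j<..a N (Suc j)}" for j
      using \<sigma>_upper[of s N j] \<sigma>_in[of N j] that by (auto simp: cell_def)
    then show ?thesis by (simp add: f_def)
  qed
  have f_bd: "norm (f N s) \<le> indicator {0..T} s" for N s
  proof (cases "s \<in> {0<..T} \<and> N > 0")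
    case True
    then obtain j where j: "j < N" "\<And>k. k \<noteq> j \<Longrightarrow> s \<notin> {a N k<..a N (Suc k)}"
      using grid_cell_unique[OF \<open>T > 0\<close>, of N s] unfolding a_def by blast
    have "indicator {\<sigma> N k<..a N (Suc k)} s = (0::real)" if "k \<noteq> j" for k
      using j(2)[OF that] \<sigma>_in[of N k] by (auto simp: indicator_def)
    then have "f N s = (\<Sum>k\<in>{j}. indicator {\<sigma> N k<..a N (Suc k)} s)"
      unfolding f_def using j(1) by (intro sum.mono_neutral_right) auto
    then have "f N s = indicator {\<sigma> N j<..a N (Suc j)} s" by (simp only: sum.insert sum.empty finite.emptyI empty_iff not_False_eq_True add_0_right)
    then show ?thesis using True by (simp add: indicator_def)
  next
    case False
    have "indicator {\<sigma> N k<..a N (Suc k)} s = (0::real)" if "k < N" for k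
      using False \<sigma>_in[of N k] a_in[of k N] a_in[of "Suc k" N] that by (auto simp: indicator_def)
    then show ?thesis by (simp add: f_def)
  qed
  have "(\<lambda>N. LINT s|M. f N s) \<longlonglongrightarrow> (LINT s|M. 0)"
  proof (rule integral_dominated_convergence)
    show "integrable M (indicator {0..T} :: real \<Rightarrow> real)"
      using M_Icc[of 0 T] \<open>T > 0\<close> by (intro integrable_real_indicator) auto
    show "AE s in M. (\<lambda>N. f N s) \<longlonglongrightarrow> 0"
    proof (rule AE_I2)
      fix s
      have "\<forall>\<^sub>F N in sequentially. f N s = 0"
      proof (cases "s \<in> {0<..T}")
        case True
        show ?thesis using A_exhaust[OF True] by eventually_elim (rule f_A)
      next
        case False
        have "f N s = 0" for N
        proof (cases "s = 0")
          case True
          have "s \<notin> {\<sigma> N j<..a N (Suc j)}" if "j < N" for j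
            using \<sigma>_in[of N j] a_in[of j N] that True by auto
          then show ?thesis by (simp add: f_def)
        qed (use f_bd[of N s] False in auto)
        then show ?thesis by simp
      qed
      then show "(\<lambda>N. f N s) \<longlonglongrightarrow> 0" by (rule tendsto_eventually)
    qed
    show "AE s in M. norm (f N s) \<le> indicator {0..T} s" for N using f_bd by simp
    show "f N \<in> borel_measurable M" for N unfolding f_def by measurable
  qed simp
  moreover have "(LINT s|M. f N s) = (\<Sum>j<N. q (a N (Suc j)) - q (\<sigma> N j))" for N
  proof -
    have M1: "emeasure M {\<sigma> N j<..a N (Suc j)} = ennreal (q (a N (Suc j)) - q (\<sigma> N j))" if "j < N" for j
      using that \<sigma>_in[of N j] a_in[of j N] a_in[of "Suc j" N] by (intro M_Ioc) auto
    moreover have "q (\<sigma> N j) \<le> q (a N (Suc j))" if "j < N" for j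
      using that \<sigma>_in[of N j] a_in[of j N] a_in[of "Suc j" N] by (intro mono_onD[OF mono]) auto
    ultimately have "measure M {\<sigma> N j<..a N (Suc j)} = q (a N (Suc j)) - q (\<sigma> N j)" if "j < N" for j
      using that by (simp add: measure_def)
    then show ?thesis unfolding f_def
      by (subst Bochner_Integration.integral_sum)
        (auto simp: M1 intro!: integrable_real_indicator sum.cong)
  qed
  ultimately have "(\<lambda>N. \<Sum>j<N. q (a N (Suc j)) - q (\<sigma> N j)) \<longlonglongrightarrow> 0" by simp
  then have "\<forall>\<^sub>F N in sequentially. (\<Sum>j<N. q (a N (Suc j)) - q (\<sigma> N j)) < \<epsilon>"
    using \<open>\<epsilon> > 0\<close> by (rule order_tendstoD)
  then have "\<forall>\<^sub>F N in sequentially. N > 0 \<and> (\<Sum>j<N. q (a N (Suc j)) - q (\<sigma> N j)) < \<epsilon>"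
    using eventually_gt_at_top[of 0] by eventually_elim simp
  then obtain N where N: "N > 0" "(\<Sum>j<N. q (a N (Suc j)) - q (\<sigma> N j)) < \<epsilon>"
    by (auto simp: eventually_sequentially)
  have "\<exists>\<rho> c. \<rho> \<in> {a N j..a N (Suc j)} \<and> \<bar>c\<bar> \<le> C \<and> q (\<sigma> N j) - q \<rho> \<le> \<epsilon> / N \<and>
      (\<forall>(u, y)\<in>X N. u \<in> {a N j<..\<rho>} \<longrightarrow> \<bar>y - c\<bar> \<le> 2 * \<epsilon>)" if j: "j < N" for j
  proof (cases "cell N j = {}")
    case True
    have "\<bar>0\<bar> \<le> C" using C[of 0] \<open>T > 0\<close> by simp
    then show ?thesis using True \<sigma>_in[of N j] a_le[of N j] N(1) \<open>\<epsilon> > 0\<close>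
      by (intro exI[of _ "a N j"] exI[of _ 0]) (auto simp: \<sigma>_def)
  next
    case False
    then obtain s0 where s0: "s0 \<in> cell N j" by blast
    then have s0_in: "s0 \<in> {0..T}" by (auto simp: cell_def A_def)
    have \<sigma>_gt: "a N j < \<sigma> N j" using \<sigma>_upper[OF s0] s0 by (auto simp: cell_def)
    have \<sigma>T: "\<sigma> N j \<in> {0..T}" using \<sigma>_in[of N j] a_in[of j N] a_in[of "Suc j" N] j by auto
    obtain d where d: "d > 0" "\<And>x. x \<in> {0..T} \<Longrightarrow> dist x (\<sigma> N j) < d \<Longrightarrow> dist (q x) (q (\<sigma> N j)) < \<epsilon> / N"
      using cont \<sigma>T N(1) \<open>\<epsilon> > 0\<close> unfolding continuous_on_iff
      by (metis divide_pos_pos of_nat_0_less_iff)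
    \<comment> \<open>The point \<open>\<rho>\<close> stays strictly below the supremum, so that every time in \<open>(a N j, \<rho>]\<close> lies strictly
      to the left of some point of \<open>A N\<close>.\<close>
    define \<rho> where "\<rho> = max (a N j) (\<sigma> N j - d / 2)"
    have \<rho>: "\<rho> \<in> {a N j..a N (Suc j)}" "\<rho> < \<sigma> N j"
      using \<sigma>_gt d(1) \<sigma>_in[of N j] by (auto simp: \<rho>_def)
    have "dist \<rho> (\<sigma> N j) < d" using \<rho>(2) d(1) by (simp add: dist_real_def \<rho>_def)
    moreover have "\<rho> \<in> {0..T}" using \<rho> a_in[of j N] \<sigma>T j by auto
    ultimately have "q (\<sigma> N j) - q \<rho> \<le> \<epsilon> / N"
      using d(2)[of \<rho>] by (simp add: dist_real_def)
    moreover have "\<bar>y - h s0\<bar> \<le> 2 * \<epsilon>" if uy: "(u, y) \<in> X N" and u: "u \<in> {a N j<..\<rho>}" for u y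
    proof -
      have "u < Sup (cell N j)" using u \<rho>(2) False by (simp add: \<sigma>_def)
      then obtain s where s: "s \<in> cell N j" "u < s" using less_cSupD[OF False] by blast
      have close: "\<bar>z - h s'\<bar> \<le> \<epsilon>" if "s' \<in> cell N j" "(x, z) \<in> X N" "a N j < x" "x < s'" for s' x z
      proof -
        have "s' - T / N \<le> x" using that a_step[of N j] by (simp add: cell_def)
        then show ?thesis using that by (auto simp: cell_def A_def)
      qed
      have "(s, h s) \<in> X N" "(s0, h s0) \<in> X N"
        using s s0 by (intro X_h; force simp: cell_def A_def)+
      note on_graph = this
      have "\<bar>h s - h s0\<bar> \<le> \<epsilon>"
      proof (cases s s0 rule: linorder_cases)
        case less
        then show ?thesis using s s0 on_graph by (intro close) (auto simp: cell_def)
      next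
        case greater
        then have "\<bar>h s0 - h s\<bar> \<le> \<epsilon>" using s s0 on_graph by (intro close) (auto simp: cell_def)
        then show ?thesis by simp
      qed (use \<open>\<epsilon> > 0\<close> in simp)
      moreover have "\<bar>y - h s\<bar> \<le> \<epsilon>" using uy u s by (intro close) auto
      ultimately show ?thesis by linarith
    qed
    ultimately show ?thesis using \<rho>(1) C[OF s0_in] by blast
  qed
  then have "\<forall>j. \<exists>\<rho> c. j < N \<longrightarrow> (\<rho> \<in> {a N j..a N (Suc j)} \<and> \<bar>c\<bar> \<le> C \<and> q (\<sigma> N j) - q \<rho> \<le> \<epsilon> / N \<and>
      (\<forall>(u, y)\<in>X N. u \<in> {a N j<..\<rho>} \<longrightarrow> \<bar>y - c\<bar> \<le> 2 * \<epsilon>))" by blast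
  then obtain \<rho> c where \<rho>c: "\<And>j. j < N \<Longrightarrow> (\<rho> j \<in> {a N j..a N (Suc j)} \<and> \<bar>c j\<bar> \<le> C \<and>
      q (\<sigma> N j) - q (\<rho> j) \<le> \<epsilon> / N \<and> (\<forall>(u, y)\<in>X N. u \<in> {a N j<..\<rho> j} \<longrightarrow> \<bar>y - c j\<bar> \<le> 2 * \<epsilon>))"
    by metis
  show thesis
  proof (rule that[of N \<rho> "\<lambda>j. if j < N then c j else 0", OF N(1)])
    have "(\<Sum>j<N. q (a N (Suc j)) - q (\<rho> j)) \<le> (\<Sum>j<N. (q (a N (Suc j)) - q (\<sigma> N j)) + \<epsilon> / N)"
      using \<rho>c by (intro sum_mono) (smt (verit) lessThan_iff)
    also have "\<dots> \<le> 2 * \<epsilon>" using N by (simp add: sum.distrib)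
    finally show "(\<Sum>j<N. q (real (Suc j) * T / N) - q (\<rho> j)) \<le> 2 * \<epsilon>" by (simp add: a_def)
    have "0 \<le> C" using C[of 0] \<open>T > 0\<close> by simp
    then show "\<bar>if j < N then c j else 0\<bar> \<le> C" for j using \<rho>c[of j] by auto
  qed (use \<rho>c in \<open>fastforce simp: a_def\<close>)+
qed

lemma Stieltjes_integral_cells:
  fixes q :: "real \<Rightarrow> real"
  assumes "T > 0" and cont: "continuous_on {0..T} q" and mono: "mono_on {0..T} q"
    and ab: "\<And>j. j < N \<Longrightarrow> 0 \<le> a j \<and> a j \<le> b j \<and> b j \<le> T"
  defines "M \<equiv> interval_measure (\<lambda>s. q (max 0 (min T s)))"
  shows "has_bochner_integral M (\<lambda>s. \<Sum>j<N. (c j :: real) * indicator {a j<..b j} s) (\<Sum>j<N. c j * (q (b j) - q (a j)))"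
proof (intro has_bochner_integral_sum has_bochner_integral_mult_right)
  fix j assume "j \<in> {..<N}"
  then have j: "0 \<le> a j" "a j \<le> b j" "b j \<le> T" using ab[of j] by auto
  have em: "emeasure M {a j<..b j} = ennreal (q (b j) - q (a j))"
    unfolding M_def by (rule Stieltjes_measure(1)[OF \<open>T > 0\<close> cont mono j])
  moreover have "q (a j) \<le> q (b j)" using j by (intro mono_onD[OF mono]) auto
  ultimately have "measure M {a j<..b j} = q (b j) - q (a j)" by (simp add: measure_def)
  then show "has_bochner_integral M (indicator {a j<..b j}) (q (b j) - q (a j))"
    using has_bochner_integral_real_indicator[of "{a j<..b j}" M] em by (simp add: M_def)
qed

text \<open>
  Up to the value at \<open>0\<close>, \<open>h\<close> is the pointwise limit of its values at the next grid point strictly to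
  the left.
\<close>

lemma left_continuous_borel:
  fixes h :: "real \<Rightarrow> real"
  assumes "T > 0"
    and lim: "\<And>s \<epsilon>. s \<in> {0<..T} \<Longrightarrow> \<epsilon> > 0 \<Longrightarrow>
        \<exists>\<eta>>0. \<forall>u\<in>{0..T}. s - \<eta> \<le> u \<and> u < s \<longrightarrow> \<bar>h u - h s\<bar> \<le> \<epsilon>"
  shows "(\<lambda>s. indicator {0..T} s * h s) \<in> borel_measurable borel"
proof -
  define z :: "nat \<Rightarrow> int \<Rightarrow> real" where "z N k = h (real_of_int (k - 1) * T / real N)" for N k
  define g where "g N s = indicator {0<..T} s * z N \<lceil>s * real N / T\<rceil> + indicator {0} s * h 0" for N :: nat and s
  have "(\<lambda>s. z N \<lceil>s * real N / T\<rceil>) \<in> borel_measurable borel" for N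
    by (rule measurable_compose[where N = "count_space UNIV"]) measurable
  then have "g N \<in> borel_measurable borel" for N unfolding g_def by measurable
  moreover have "(\<lambda>N. g N s) \<longlonglongrightarrow> indicator {0..T} s * h s" for s
  proof (cases "s \<in> {0<..T}")
    case False
    then show ?thesis using \<open>T > 0\<close> by (auto simp: g_def indicator_def)
  next
    case True
    have "(\<lambda>N. z N \<lceil>s * real N / T\<rceil>) \<longlonglongrightarrow> h s"
    proof (rule LIMSEQ_I)
      fix r :: real assume "r > 0"
      then obtain \<eta> where \<eta>: "\<eta> > 0"
          "\<And>u. u \<in> {0..T} \<Longrightarrow> s - \<eta> \<le> u \<Longrightarrow> u < s \<Longrightarrow> \<bar>h u - h s\<bar> \<le> r / 2"
        using lim[OF True, of "r / 2"] by fastforce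
      obtain N0 :: nat where N0: "T / \<eta> < N0" using reals_Archimedean2 by blast
      have "norm (z N \<lceil>s * real N / T\<rceil> - h s) < r" if "N \<ge> Suc N0" for N
      proof -
        define u where "u = real_of_int (\<lceil>s * real N / T\<rceil> - 1) * T / N"
        have N: "N > 0" "T / \<eta> < N" using that N0 by auto
        have "0 < s * real N / T" using True N \<open>T > 0\<close> by simp
        then have "1 \<le> \<lceil>s * real N / T\<rceil>" by linarith
        then have "1 \<le> real_of_int \<lceil>s * real N / T\<rceil>" by (simp only: of_int_1_le_iff)
        then have c: "0 \<le> real_of_int (\<lceil>s * real N / T\<rceil> - 1)"
            "real_of_int (\<lceil>s * real N / T\<rceil> - 1) < s * real N / T"
            "s * real N / T - 1 \<le> real_of_int (\<lceil>s * real N / T\<rceil> - 1)"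
          unfolding of_int_diff of_int_1 by linarith+
        have "u < s"
          using mult_strict_right_mono[OF c(2), of "T / N"] N \<open>T > 0\<close> by (simp add: u_def field_simps)
        moreover have "0 \<le> u" using c(1) \<open>T > 0\<close> by (simp add: u_def)
        moreover have "s - T / N \<le> u"
          using mult_right_mono[OF c(3), of "T / N"] N \<open>T > 0\<close> by (simp add: u_def field_simps)
        moreover have "T / N < \<eta>" using N \<eta>(1) \<open>T > 0\<close> by (simp add: field_simps)
        ultimately have "\<bar>h u - h s\<bar> \<le> r / 2" using True by (intro \<eta>(2)) auto
        then show ?thesis using \<open>r > 0\<close> by (simp add: z_def u_def)
      qed
      then show "\<exists>no. \<forall>N\<ge>no. norm (z N \<lceil>s * real N / T\<rceil> - h s) < r" by blast
    qed
    then show ?thesis using True by (simp add: g_def indicator_def)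
  qed
  ultimately show ?thesis by (rule borel_measurable_LIMSEQ_real[rotated])
qed

text \<open>
  The weights \<open>H n i\<close>, attached to the times \<open>v n i\<close>, approach \<open>h s\<close> as the times increase to \<open>s\<close>, jointly
  in \<open>n\<close> and the time. This is what left continuity of a functional gives along paths that approach \<open>\<omega>\<close>;
  times equal to \<open>s\<close> are left out, as left continuity says nothing about them.
\<close>

definition left_limit_weights ::
    "real \<Rightarrow> real \<Rightarrow> (nat \<Rightarrow> nat) \<Rightarrow> (nat \<Rightarrow> nat \<Rightarrow> real) \<Rightarrow> (nat \<Rightarrow> nat \<Rightarrow> real) \<Rightarrow> (real \<Rightarrow> real) \<Rightarrow> bool"
  where
  "left_limit_weights T C m v H h \<longleftrightarrow>
    (\<forall>u\<in>{0..T}. \<bar>h u\<bar> \<le> C) \<and> (\<forall>n. \<forall>i<m n. \<bar>H n i\<bar> \<le> C) \<and>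
    (\<forall>s\<in>{0<..T}. \<forall>\<epsilon>>0. \<exists>\<eta>>0. \<forall>u\<in>{0..T}. s - \<eta> \<le> u \<and> u < s \<longrightarrow> \<bar>h u - h s\<bar> \<le> \<epsilon>) \<and>
    (\<forall>s\<in>{0<..T}. \<forall>\<epsilon>>0. \<exists>\<eta>>0. \<exists>N. \<forall>n\<ge>N. \<forall>i<m n.
       s - \<eta> \<le> v n i \<and> v n i < s \<longrightarrow> \<bar>H n i - h s\<bar> \<le> \<epsilon>)"

lemma left_limit_weightsI:
  assumes "\<And>u. u \<in> {0..T} \<Longrightarrow> \<bar>h u\<bar> \<le> C" and "\<And>n i. i < m n \<Longrightarrow> \<bar>H n i\<bar> \<le> C"
    and "\<And>s \<epsilon>. s \<in> {0<..T} \<Longrightarrow> \<epsilon> > 0 \<Longrightarrow>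
        \<exists>\<eta>>0. \<forall>u\<in>{0..T}. s - \<eta> \<le> u \<and> u < s \<longrightarrow> \<bar>h u - h s\<bar> \<le> \<epsilon>"
    and "\<And>s \<epsilon>. s \<in> {0<..T} \<Longrightarrow> \<epsilon> > 0 \<Longrightarrow>
        \<exists>\<eta>>0. \<exists>N. \<forall>n\<ge>N. \<forall>i<m n. s - \<eta> \<le> v n i \<and> v n i < s \<longrightarrow> \<bar>H n i - h s\<bar> \<le> \<epsilon>"
  shows "left_limit_weights T C m v H h"
  unfolding left_limit_weights_def using assms by blast

lemma left_limit_weightsD:
  assumes "left_limit_weights T C m v H h"
  shows "u \<in> {0..T} \<Longrightarrow> \<bar>h u\<bar> \<le> C" and "i < m n \<Longrightarrow> \<bar>H n i\<bar> \<le> C"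
    and "s \<in> {0<..T} \<Longrightarrow> \<epsilon> > 0 \<Longrightarrow>
        \<exists>\<eta>>0. \<forall>u\<in>{0..T}. s - \<eta> \<le> u \<and> u < s \<longrightarrow> \<bar>h u - h s\<bar> \<le> \<epsilon>"
    and "s \<in> {0<..T} \<Longrightarrow> \<epsilon> > 0 \<Longrightarrow>
        \<exists>\<eta>>0. \<exists>N. \<forall>n\<ge>N. \<forall>i<m n. s - \<eta> \<le> v n i \<and> v n i < s \<longrightarrow> \<bar>H n i - h s\<bar> \<le> \<epsilon>"
  using assms unfolding left_limit_weights_def by blast+

text \<open>
  The measures with atoms \<open>w n i\<close> at \<open>v n i\<close> converge weakly to \<open>dq\<close>. On the good parts of the cells from
  \<open>left_limit_cell_approximation\<close> both the weights \<open>H\<close> and the limit \<open>h\<close> are within \<open>2 \<epsilon>\<close> of the same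
  constants; the resulting step function \<open>g\<close> approximates both sides, with an error \<open>E\<close> whose sum and
  integral are small.
\<close>

lemma weighted_sums_tendsto_Stieltjes:
  fixes q h :: "real \<Rightarrow> real" and v w H :: "nat \<Rightarrow> nat \<Rightarrow> real"
  assumes "T > 0" and cont: "continuous_on {0..T} q" and q0: "q 0 = 0"
    and v: "\<And>n i. i < m n \<Longrightarrow> v n i \<in> {0..T}" and w: "\<And>n i. i < m n \<Longrightarrow> 0 \<le> w n i"
    and q: "\<And>t. t \<in> {0..T} \<Longrightarrow> (\<lambda>n. \<Sum>i | i < m n \<and> v n i \<le> t. w n i) \<longlonglongrightarrow> q t"
    and W: "left_limit_weights T C m v H h"
  defines "M \<equiv> interval_measure (\<lambda>s. q (max 0 (min T s)))"
  shows "set_integrable M {0..T} h"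
    and "(\<lambda>n. \<Sum>i<m n. H n i * w n i) \<longlonglongrightarrow> (LINT s:{0..T}|M. h s)"
proof -
  note hC = left_limit_weightsD(1)[OF W] and HC = left_limit_weightsD(2)[OF W]
    and h_lim = left_limit_weightsD(3)[OF W] and H_lim = left_limit_weightsD(4)[OF W]
  define p where "p n t = (\<Sum>i | i < m n \<and> v n i \<le> t. w n i)" for n t
  have p: "(\<lambda>n. p n t) \<longlonglongrightarrow> q t" if "t \<in> {0..T}" for t using q[OF that] by (simp add: p_def)
  have mono: "mono_on {0..T} q"
  proof (rule mono_onI)
    fix x y assume xy: "x \<in> {0..T}" "y \<in> {0..T}" "x \<le> y"
    have "p n x \<le> p n y" for n unfolding p_def using w xy(3) by (intro sum_mono2) auto
    then show "q x \<le> q y" by (intro LIMSEQ_le[OF p[OF xy(1)] p[OF xy(2)]]) auto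
  qed
  have "C \<ge> 0" using hC[of 0] \<open>T > 0\<close> by simp
  have q_nonneg: "0 \<le> q T" using mono_onD[OF mono, of 0 T] q0 \<open>T > 0\<close> by simp
  have M_sets [measurable_cong, simp]: "sets M = sets borel" by (simp add: M_def)
  note M_Icc = Stieltjes_measure(2)[OF \<open>T > 0\<close> cont mono, folded M_def]
  have ind_T: "has_bochner_integral M (indicator {0..T} :: real \<Rightarrow> real) (q T)"
    using has_bochner_integral_real_indicator[of "{0..T}" M] M_Icc[of 0 T] \<open>T > 0\<close> q0 q_nonneg
    by (simp add: measure_def)
  have ind_0: "has_bochner_integral M (indicator {0} :: real \<Rightarrow> real) 0"
    using has_bochner_integral_real_indicator[of "{0}" M] M_Icc[of 0 0] \<open>T > 0\<close>
    by (simp add: measure_def)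
  have h_meas: "(\<lambda>s. indicator {0..T} s * h s) \<in> borel_measurable M"
    using left_continuous_borel[OF \<open>T > 0\<close> h_lim] by (simp cong: measurable_cong_sets)
  have h_int: "integrable M (\<lambda>s. indicator {0..T} s * h s)"
  proof (rule Bochner_Integration.integrable_bound)
    show "integrable M (\<lambda>s. C * indicator {0..T} s)" using ind_T by (auto simp: has_bochner_integral_iff)
    show "AE s in M. norm (indicator {0..T} s * h s) \<le> norm (C * indicator {0..T} s :: real)"
      using hC \<open>C \<ge> 0\<close> by (auto simp: indicator_def)
  qed (rule h_meas)
  then show "set_integrable M {0..T} h" by (simp add: set_integrable_def)
  define L where "L = (LINT s|M. indicator {0..T} s * h s)"
  have "(\<lambda>n. \<Sum>i<m n. H n i * w n i) \<longlonglongrightarrow> L"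
  proof (rule LIMSEQ_I)
    fix r :: real assume "r > 0"
    define \<epsilon> where "\<epsilon> = r / (8 * (q T + C + 1))"
    have "\<epsilon> > 0" using \<open>r > 0\<close> q_nonneg \<open>C \<ge> 0\<close> by (simp add: \<epsilon>_def)
    define X where "X N = {(u, h u) | u. u \<in> {0..T}} \<union> {(v n i, H n i) | n i. N \<le> n \<and> i < m n}" for N
    have "antimono X" by (rule antimonoI) (auto simp: X_def)
    have X_lim: "\<exists>\<eta>>0. \<exists>N. \<forall>(u, y)\<in>X N. s - \<eta> \<le> u \<and> u < s \<longrightarrow> \<bar>y - h s\<bar> \<le> \<epsilon>"
      if s: "s \<in> {0<..T}" and "\<epsilon> > 0" for s \<epsilon>
    proof -
      obtain \<eta>1 where 1: "\<eta>1 > 0" "\<forall>u\<in>{0..T}. s - \<eta>1 \<le> u \<and> u < s \<longrightarrow> \<bar>h u - h s\<bar> \<le> \<epsilon>"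
        using h_lim[OF s \<open>\<epsilon> > 0\<close>] by blast
      obtain \<eta>2 N where 2: "\<eta>2 > 0"
          "\<forall>n\<ge>N. \<forall>i<m n. s - \<eta>2 \<le> v n i \<and> v n i < s \<longrightarrow> \<bar>H n i - h s\<bar> \<le> \<epsilon>"
        using H_lim[OF s \<open>\<epsilon> > 0\<close>] by blast
      show ?thesis using 1 2
        by (intro exI[of _ "min \<eta>1 \<eta>2"] conjI exI[of _ N]) (auto simp: X_def)
    qed
    obtain N \<rho> c where N: "N > 0"
      and \<rho>: "\<And>j. j < N \<Longrightarrow> \<rho> j \<in> {real j * T / N..real (Suc j) * T / N}"
      and c: "\<And>j. \<bar>c j\<bar> \<le> C"
      and good: "\<And>j u y. j < N \<Longrightarrow> (u, y) \<in> X N \<Longrightarrow> u \<in> {real j * T / N<..\<rho> j} \<Longrightarrow> \<bar>y - c j\<bar> \<le> 2 * \<epsilon>"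
      and bad: "(\<Sum>j<N. q (real (Suc j) * T / N) - q (\<rho> j)) \<le> 2 * \<epsilon>"
      using left_limit_cell_approximation[where X = X, OF \<open>T > 0\<close> cont mono \<open>antimono X\<close> _ X_lim hC \<open>\<epsilon> > 0\<close>]
      by (auto simp: X_def)
    define a where "a j = real j * T / real N" for j
    have \<rho>_in: "a j \<le> \<rho> j" "\<rho> j \<le> a (Suc j)" if "j < N" for j using \<rho>[OF that] by (auto simp: a_def)
    have a_nonneg: "0 \<le> a j" for j using \<open>T > 0\<close> by (simp add: a_def)
    have a_le: "a j \<le> T" if "j \<le> N" for j using that \<open>T > 0\<close> N by (simp add: a_def field_simps)
    have cells: "0 \<le> a j \<and> a j \<le> \<rho> j \<and> \<rho> j \<le> T" "0 \<le> \<rho> j \<and> \<rho> j \<le> a (Suc j) \<and> a (Suc j) \<le> T"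
      if "j < N" for j
      using \<rho>_in[OF that] a_nonneg[of j] a_le[of "Suc j"] that by auto
    define g where "g u = (\<Sum>j<N. c j * indicator {a j<..\<rho> j} u)" for u
    define E where "E u = 2 * \<epsilon> + C * (\<Sum>j<N. 1 * indicator {\<rho> j<..a (Suc j)} u) + C * indicator {0} u" for u :: real
    \<comment> \<open>Only one cell contributes at a given point.\<close>
    have pointwise: "\<bar>y - g u\<bar> \<le> E u" if u: "u \<in> {0..T}" and uy: "(u, y) \<in> X N" for u y
    proof (cases "u = 0")
      case True
      have "\<bar>y\<bar> \<le> C" using uy hC HC by (auto simp: X_def)
      moreover have "g u = 0" unfolding g_def using True a_nonneg by (auto simp: indicator_def leD)
      moreover have "0 \<le> C * (\<Sum>j<N. 1 * indicator {\<rho> j<..a (Suc j)} u)"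
        using \<open>C \<ge> 0\<close> by (intro mult_nonneg_nonneg sum_nonneg) auto
      ultimately show ?thesis unfolding E_def using \<open>\<epsilon> > 0\<close> True by simp
    next
      case False
      then have "u \<in> {0<..T}" using u by auto
      then obtain j where j: "j < N" "u \<in> {a j<..a (Suc j)}" "\<And>k. k \<noteq> j \<Longrightarrow> u \<notin> {a k<..a (Suc k)}"
        using grid_cell_unique[OF \<open>T > 0\<close> N] unfolding a_def by blast
      have other: "u \<notin> {a k<..\<rho> k}" "u \<notin> {\<rho> k<..a (Suc k)}" if "k \<noteq> j" "k < N" for k
        using j(3)[OF that(1)] \<rho>_in[OF that(2)] by auto
      have "g u = (\<Sum>k\<in>{j}. c k * indicator {a k<..\<rho> k} u)"
        unfolding g_def using j(1) other by (intro sum.mono_neutral_right) auto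
      then have g: "g u = c j * indicator {a j<..\<rho> j} u" by (simp only: sum.insert sum.empty finite.emptyI empty_iff not_False_eq_True add_0_right)
      have "(\<Sum>k<N. 1 * indicator {\<rho> k<..a (Suc k)} u :: real) = (\<Sum>k\<in>{j}. 1 * indicator {\<rho> k<..a (Suc k)} u)"
        using j(1) other by (intro sum.mono_neutral_right) auto
      then have E: "E u = 2 * \<epsilon> + C * indicator {\<rho> j<..a (Suc j)} u" using False
        by (simp only: E_def sum.insert sum.empty finite.emptyI empty_iff not_False_eq_True
          add_0_right mult_1 indicator_simps singleton_iff mult_zero_right)
      show ?thesis
      proof (cases "u \<le> \<rho> j")
        case True
        then have "\<bar>y - c j\<bar> \<le> 2 * \<epsilon>" using j uy by (intro good) (auto simp: a_def)
        then show ?thesis using True j(2) by (simp add: g E)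
      next
        case False
        have "\<bar>y\<bar> \<le> C" using uy hC HC by (auto simp: X_def)
        then show ?thesis using False j(2) \<open>\<epsilon> > 0\<close> by (simp add: g E)
      qed
    qed
    define G where "G = (\<Sum>j<N. c j * (q (\<rho> j) - q (a j)))"
    define B where "B = 2 * \<epsilon> * q T + C * (\<Sum>j<N. 1 * (q (a (Suc j)) - q (\<rho> j)))"
    have B: "B \<le> r / 4"
    proof -
      have "B \<le> 2 * \<epsilon> * q T + C * (2 * \<epsilon>)"
        unfolding B_def using bad \<open>C \<ge> 0\<close> by (intro add_left_mono mult_left_mono) (auto simp: a_def)
      also have "\<dots> = 2 * \<epsilon> * (q T + C)" by (simp add: algebra_simps)
      also have "\<dots> \<le> 2 * \<epsilon> * (q T + C + 1)" using \<open>\<epsilon> > 0\<close> by simp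
      also have "\<dots> = r / 4"
      proof -
        have "q T + C + 1 \<noteq> 0" using q_nonneg \<open>C \<ge> 0\<close> by linarith
        then show ?thesis unfolding \<epsilon>_def by (simp only: times_divide_eq_left times_divide_eq_right) (simp add: divide_simps)
      qed
      finally show ?thesis .
    qed
    have hb_g: "has_bochner_integral M g G"
      unfolding g_def G_def M_def
      using Stieltjes_integral_cells[OF \<open>T > 0\<close> cont mono, of N a \<rho> c] cells by blast
    have hb_E: "has_bochner_integral M (\<lambda>s. 2 * \<epsilon> * indicator {0..T} s +
        C * (\<Sum>j<N. 1 * indicator {\<rho> j<..a (Suc j)} s) + C * indicator {0} s) (B + C * 0)"
      unfolding B_def
      using Stieltjes_integral_cells[OF \<open>T > 0\<close> cont mono, of N \<rho> "\<lambda>j. a (Suc j)" "\<lambda>_. 1"] cells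
      by (intro has_bochner_integral_add has_bochner_integral_mult_right ind_T ind_0) (auto simp: M_def)
    have "\<bar>L - G\<bar> \<le> B"
    proof -
      have "L - G = (LINT s|M. indicator {0..T} s * h s - g s)"
        unfolding L_def using hb_g h_int by (simp add: has_bochner_integral_iff)
      also have "\<bar>\<dots>\<bar> \<le> (LINT s|M. 2 * \<epsilon> * indicator {0..T} s +
        C * (\<Sum>j<N. 1 * indicator {\<rho> j<..a (Suc j)} s) + C * indicator {0} s)"
      proof (rule Bochner_Integration.integral_abs_bound_integral)
        fix s
        show "\<bar>indicator {0..T} s * h s - g s\<bar> \<le> 2 * \<epsilon> * indicator {0..T} s +
          C * (\<Sum>j<N. 1 * indicator {\<rho> j<..a (Suc j)} s) + C * indicator {0} s"
        proof (cases "s \<in> {0..T}")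
          case True
          then have "\<bar>h s - g s\<bar> \<le> E s" by (intro pointwise) (auto simp: X_def)
          then show ?thesis using True by (simp add: E_def)
        next
          case False
          have "s \<notin> {a j<..\<rho> j}" if "j < N" for j using cells(1)[OF that] False by auto
          then have g0: "g s = 0" by (simp add: g_def)
          have i0: "indicator {0..T} s = (0 :: real)" using False by (rule indicator_simps)
          moreover have "0 \<le> C * (\<Sum>j<N. 1 * indicator {\<rho> j<..a (Suc j)} s)"
            using \<open>C \<ge> 0\<close> by (intro mult_nonneg_nonneg sum_nonneg) auto
          moreover have "0 \<le> C * indicator {0} s" using \<open>C \<ge> 0\<close> by simp
          ultimately show ?thesis unfolding i0 g0 by linarith
        qed
      qed (use hb_g hb_E h_int in \<open>auto simp: has_bochner_integral_iff\<close>)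
      also have "\<dots> = B" using hb_E by (simp add: has_bochner_integral_iff)
      finally show ?thesis .
    qed
    have indicator_sum: "(\<Sum>i<m n. indicator {x<..y} (v n i) * w n i) = p n y - p n x" if "x \<le> y" for n x y
    proof -
      have "(\<Sum>i<m n. indicator {x<..y} (v n i) * w n i) = sum (w n) {i. i < m n \<and> v n i \<in> {x<..y}}"
        by (simp add: indicator_def if_distrib[of "\<lambda>z. z * _"] sum.If_cases Int_def cong: if_cong)
      also have "{i. i < m n \<and> v n i \<in> {x<..y}} = {i. i < m n \<and> v n i \<le> y} - {i. i < m n \<and> v n i \<le> x}"
        by auto
      also have "sum (w n) \<dots> = p n y - p n x"
        unfolding p_def using that by (intro sum_diff) auto
      finally show ?thesis .
    qed
    have indicator_sum0: "(\<Sum>i<m n. indicator {0} (v n i) * w n i) = p n 0" for n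
    proof -
      have "(\<Sum>i<m n. indicator {0} (v n i) * w n i) = sum (w n) {i. i < m n \<and> v n i = 0}"
        by (simp add: indicator_def if_distrib[of "\<lambda>z. z * _"] sum.If_cases Int_def cong: if_cong)
      also have "{i. i < m n \<and> v n i = 0} = {i. i < m n \<and> v n i \<le> 0}" using v by force
      finally show ?thesis by (simp add: p_def)
    qed
    have total: "(\<Sum>i<m n. w n i) = p n T" for n
    proof -
      have "{i. i < m n \<and> v n i \<le> T} = {..<m n}" using v by auto
      then show ?thesis by (simp add: p_def)
    qed
    define G' where "G' n = (\<Sum>j<N. c j * (p n (\<rho> j) - p n (a j)))" for n
    define B' where "B' n = 2 * \<epsilon> * p n T + C * (\<Sum>j<N. 1 * (p n (a (Suc j)) - p n (\<rho> j))) + C * p n 0" for n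
    have discrete: "\<bar>(\<Sum>i<m n. H n i * w n i) - G' n\<bar> \<le> B' n" if "n \<ge> N" for n
    proof -
      have "G' n = (\<Sum>j<N. c j * (\<Sum>i<m n. indicator {a j<..\<rho> j} (v n i) * w n i))"
        unfolding G'_def using \<rho>_in by (intro sum.cong refl, subst indicator_sum) auto
      also have "\<dots> = (\<Sum>i<m n. g (v n i) * w n i)"
        unfolding g_def sum_distrib_left sum_distrib_right by (subst sum.swap) (simp add: mult.assoc)
      finally have "(\<Sum>i<m n. H n i * w n i) - G' n = (\<Sum>i<m n. (H n i - g (v n i)) * w n i)"
        by (simp add: sum_subtractf algebra_simps)
      also have "\<bar>\<dots>\<bar> \<le> (\<Sum>i<m n. \<bar>H n i - g (v n i)\<bar> * w n i)"
        using w by (intro order.trans[OF sum_abs] sum_mono) (auto simp: abs_mult)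
      also have "\<dots> \<le> (\<Sum>i<m n. E (v n i) * w n i)"
        using w v that by (intro sum_mono mult_right_mono pointwise) (auto simp: X_def)
      also have "\<dots> = 2 * \<epsilon> * (\<Sum>i<m n. w n i)
          + C * (\<Sum>j<N. 1 * (\<Sum>i<m n. indicator {\<rho> j<..a (Suc j)} (v n i) * w n i))
          + C * (\<Sum>i<m n. indicator {0} (v n i) * w n i)"
        unfolding E_def sum_distrib_left distrib_right sum.distrib sum_distrib_right
        by (subst (2) sum.swap) (simp add: mult.assoc)
      also have "\<dots> = B' n"
        unfolding B'_def indicator_sum0 total
        using \<rho>_in by (intro arg_cong2[of _ _ _ _ "(+)"] refl arg_cong2[of _ _ _ _ "(*)"] sum.cong,
          subst indicator_sum) auto
      finally show ?thesis .
    qed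
    have cell_mem: "a j \<in> {0..T}" "\<rho> j \<in> {0..T}" "a (Suc j) \<in> {0..T}" if "j \<in> {..<N}" for j
      using cells[of j] that by auto
    have G': "G' \<longlonglongrightarrow> G"
      unfolding G'_def G_def using cell_mem by (intro tendsto_intros p) auto
    have "B' \<longlonglongrightarrow> 2 * \<epsilon> * q T + C * (\<Sum>j<N. 1 * (q (a (Suc j)) - q (\<rho> j))) + C * q 0"
      unfolding B'_def using cell_mem \<open>T > 0\<close> by (intro tendsto_intros p) auto
    then have B': "B' \<longlonglongrightarrow> B" by (simp add: B_def q0)
    have "r / 4 > 0" using \<open>r > 0\<close> by simp
    then have "\<forall>\<^sub>F n in sequentially. dist (G' n) G < r / 4" "\<forall>\<^sub>F n in sequentially. dist (B' n) B < r / 4"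
      using tendstoD[OF G'] tendstoD[OF B'] by blast+
    then have "\<forall>\<^sub>F n in sequentially. norm ((\<Sum>i<m n. H n i * w n i) - L) < r"
      using eventually_ge_at_top[of N]
    proof eventually_elim
      case (elim n)
      then show ?case using discrete[of n] \<open>\<bar>L - G\<bar> \<le> B\<close> B unfolding dist_real_def real_norm_def by linarith
    qed
    then show "\<exists>no. \<forall>n\<ge>no. norm ((\<Sum>i<m n. H n i * w n i) - L) < r"
      by (simp add: eventually_sequentially)
  qed
  then show "(\<lambda>n. \<Sum>i<m n. H n i * w n i) \<longlonglongrightarrow> (LINT s:{0..T}|M. h s)"
    by (simp add: L_def set_lebesgue_integral_def)
qed

section \<open>Stopped and bumped paths\<close>

lemma stop_apply: "r \<in> {0..T} \<Longrightarrow> stop T t x r = x (min t r)"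
  by (simp add: stop_def)

lemma bump_apply: "r \<in> {0..T} \<Longrightarrow> bump T t x e r = x (min t r) + (if t \<le> r then e else 0)"
  by (simp add: bump_def stop_def)

lemma stop_stop: "t \<in> {0..T} \<Longrightarrow> stop T s (stop T t x) = stop T (min s t) x" if "0 \<le> s"
  using that by (auto simp: stop_def min_def fun_eq_iff)

lemma stop_bump: "t \<in> {0..T} \<Longrightarrow> stop T t (bump T t x e) = bump T t x e"
  by (auto simp: stop_def bump_def min_def fun_eq_iff)

lemma bump_bump: "t \<in> {0..T} \<Longrightarrow> bump T t (bump T t x e) e' = bump T t x (e + e')"
  by (auto simp: stop_def bump_def min_def fun_eq_iff)

lemma bump_0: "bump T t x 0 = stop T t x"
  by (auto simp: stop_def bump_def fun_eq_iff)

lemma bump_stop: "t \<in> {0..T} \<Longrightarrow> bump T t (stop T t x) e = bump T t x e"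
  by (auto simp: stop_def bump_def min_def fun_eq_iff)

lemma bump_Dpaths:
  assumes x: "x \<in> Dpaths T" and t: "t \<in> {0..T}"
  shows "bump T t x e \<in> Dpaths T"
proof -
  define y where "y = stop T t x"
  have y: "cadlag_on T y" using stop_Dpaths[OF x t] by (simp add: y_def Dpaths_def)
  have "(bump T t x e \<longlongrightarrow> bump T t x e u) (at_right u)" if u: "u \<in> {0..<T}" for u
  proof -
    have "(y \<longlongrightarrow> y u) (at_right u)" using y u by (auto simp: cadlag_on_def)
    then have "((\<lambda>s. y s + (if t \<le> u then e else 0)) \<longlongrightarrow> y u + (if t \<le> u then e else 0)) (at_right u)"
      by (intro tendsto_intros)
    moreover have "\<forall>\<^sub>F s in at_right u. s \<in> {u<..<(if t \<le> u then T else t)}"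
      using u t by (intro eventually_at_right_real) auto
    then have "\<forall>\<^sub>F s in at_right u. y s + (if t \<le> u then e else 0) = bump T t x e s"
      by eventually_elim (use u t in \<open>auto simp: bump_def y_def split: if_splits\<close>)
    ultimately have "(bump T t x e \<longlongrightarrow> y u + (if t \<le> u then e else 0)) (at_right u)"
      by (rule Lim_transform_eventually)
    then show ?thesis using u by (simp add: bump_def y_def)
  qed
  moreover have "\<exists>l. (bump T t x e \<longlongrightarrow> l) (at_left u)" if u: "u \<in> {0<..T}" for u
  proof -
    obtain l where "(y \<longlongrightarrow> l) (at_left u)" using y u unfolding cadlag_on_def by blast
    then have "((\<lambda>s. y s + (if t < u then e else 0)) \<longlongrightarrow> l + (if t < u then e else 0)) (at_left u)"
      by (intro tendsto_intros)
    moreover have "\<forall>\<^sub>F s in at_left u. s \<in> {(if t < u then t else 0)<..<u}"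
      using u t by (intro eventually_at_left_real) auto
    then have "\<forall>\<^sub>F s in at_left u. y s + (if t < u then e else 0) = bump T t x e s"
      by eventually_elim (use u t in \<open>auto simp: bump_def y_def split: if_splits\<close>)
    ultimately show ?thesis using Lim_transform_eventually by blast
  qed
  ultimately show ?thesis by (auto simp: Dpaths_def cadlag_on_def bump_def)
qed

lemma continuous_Dpaths:
  assumes "x \<in> extensional {0..T}" "continuous_on {0..T} x"
  shows "x \<in> Dpaths T"
  unfolding Dpaths_def cadlag_on_def
proof (intro CollectI conjI ballI assms(1))
  fix t assume t: "t \<in> {0..<T}"
  have "(x \<longlongrightarrow> x t) (at t within {0..T})" using assms(2) t by (auto simp: continuous_on_def)
  then have "(x \<longlongrightarrow> x t) (at t within {t..T})" by (rule tendsto_within_subset) (use t in auto)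
  then show "(x \<longlongrightarrow> x t) (at_right t)" using t at_within_Icc_at_right[of t T] by auto
next
  fix t assume t: "t \<in> {0<..T}"
  have "(x \<longlongrightarrow> x t) (at t within {0..T})" using assms(2) t by (auto simp: continuous_on_def)
  then have "(x \<longlongrightarrow> x t) (at t within {0..t})" by (rule tendsto_within_subset) (use t in auto)
  then show "\<exists>l. (x \<longlongrightarrow> l) (at_left t)" using t at_within_Icc_at_left[of 0 t] by auto
qed

lemma sup_dist_le:
  fixes x y :: "real \<Rightarrow> 'a::metric_space"
  assumes "0 \<le> T" "x \<in> Dpaths T" "y \<in> Dpaths T" "\<And>r. r \<in> {0..T} \<Longrightarrow> dist (x r) (y r) \<le> c"
  shows "sup_dist T x y \<le> c"
  unfolding sup_dist_eq_SUP[OF assms(1-3)] using assms(1,4) by (intro cSUP_least) auto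

text \<open>
  The form in which left continuity is applied: the nearby path \<open>y\<close> comes as a path that is already
  stopped, so that pairs and the set of stopped paths disappear.
\<close>

lemma left_continuousD:
  assumes F: "left_continuous T F" and x: "x \<in> Dpaths T" and t: "t \<in> {0..T}" and "\<epsilon> > 0"
  obtains \<eta> where "\<eta> > 0"
    "\<And>t' y. t' \<in> {0..T} \<Longrightarrow> y \<in> Dpaths T \<Longrightarrow> stop T t' y = y \<Longrightarrow> t' < t \<Longrightarrow>
      sup_dist T (stop T t x) y + (t - t') < \<eta> \<Longrightarrow> \<bar>F t x - F t' y\<bar> < \<epsilon>"
proof -
  have "(t, stop T t x) \<in> Stopped T" using x t by (auto simp: Stopped_def)
  then obtain \<eta> where \<eta>: "\<eta> > 0" "\<And>t' y. (t', y) \<in> Stopped T \<Longrightarrow> t' < t \<Longrightarrow>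
      d_inf T (t, stop T t x) (t', y) < \<eta> \<Longrightarrow> \<bar>F t (stop T t x) - F t' y\<bar> < \<epsilon>"
    using F \<open>\<epsilon> > 0\<close> unfolding left_continuous_def by fast
  have Fx: "F t (stop T t x) = F t x"
    using F x t by (simp add: left_continuous_def nonanticipative_def)
  show thesis
  proof (rule that[OF \<eta>(1)])
    fix t' y assume y: "t' \<in> {0..T}" "y \<in> Dpaths T" "stop T t' y = y" "t' < t"
      "sup_dist T (stop T t x) y + (t - t') < \<eta>"
    have "(t', y) \<in> Stopped T" unfolding Stopped_def using y(1-3) by (auto intro!: exI[of _ y])
    then show "\<bar>F t x - F t' y\<bar> < \<epsilon>" using \<eta>(2)[of t' y] y by (simp add: d_inf_def Fx)
  qed
qed

section \<open>Vertical derivatives\<close>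

text \<open>
  Bumps at the same time add up, so differentiability at \<open>0\<close> for all paths gives differentiability at
  every \<open>e0\<close>.
\<close>

lemma v_grad_GDERIV:
  assumes F: "v_differentiable T F" and t: "t \<in> {0..T}" and x: "x \<in> Dpaths T"
  shows "GDERIV (\<lambda>e. F t (bump T t x e)) e0 :> v_grad T F t (bump T t x e0)"
proof -
  define f where "f e = F t (bump T t x e)" for e
  have "\<exists>g. GDERIV (\<lambda>e. F t (bump T t (bump T t x e0) e)) 0 :> g"
    using F t bump_Dpaths[OF x t] by (auto simp: v_differentiable_def)
  then obtain g where g: "GDERIV (\<lambda>e. F t (bump T t (bump T t x e0) e)) 0 :> g" by blast
  moreover have "g' = g" if g': "GDERIV (\<lambda>e. F t (bump T t (bump T t x e0) e)) 0 :> g'" for g'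
  proof -
    have "(\<lambda>h. h \<bullet> g') = (\<lambda>h. h \<bullet> g)"
      using g g' unfolding gderiv_def by (rule has_derivative_unique[rotated])
    then have "(g' - g) \<bullet> g' = (g' - g) \<bullet> g" by (rule fun_cong)
    then have "(g' - g) \<bullet> (g' - g) = 0" by (simp add: inner_diff_right)
    then show ?thesis by simp
  qed
  ultimately have v: "v_grad T F t (bump T t x e0) = g"
    unfolding v_grad_def by (rule the_equality)
  have "((\<lambda>e. f (e0 + e)) has_derivative (\<lambda>h. h \<bullet> g)) (at 0)"
    using g by (simp add: gderiv_def bump_bump[OF t] f_def)
  then have "((\<lambda>e. f (e0 + e)) has_derivative (\<lambda>h. h \<bullet> g)) (at (e0 - e0))" by simp
  then have "((\<lambda>e. f (e0 + (e - e0))) has_derivative (\<lambda>h. h \<bullet> g)) (at e0)"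
    by (rule has_derivative_compose[rotated]) (auto intro!: derivative_eq_intros)
  then show ?thesis by (simp add: gderiv_def v f_def)
qed

lemma bump_has_real_derivative:
  assumes F: "v_differentiable T F" and t: "t \<in> {0..T}" and x: "x \<in> Dpaths T"
  shows "((\<lambda>r. F t (bump T t x (r *\<^sub>R \<delta>))) has_real_derivative
    v_grad T F t (bump T t x (r *\<^sub>R \<delta>)) \<bullet> \<delta>) (at r)"
proof -
  have "((\<lambda>e. F t (bump T t x e)) has_derivative (\<lambda>h. h \<bullet> v_grad T F t (bump T t x (r *\<^sub>R \<delta>)))) (at (r *\<^sub>R \<delta>))"
    using v_grad_GDERIV[OF F t x] by (simp add: gderiv_def)
  then have "((\<lambda>r. F t (bump T t x (r *\<^sub>R \<delta>))) has_derivative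
      (\<lambda>h. (h *\<^sub>R \<delta>) \<bullet> v_grad T F t (bump T t x (r *\<^sub>R \<delta>)))) (at r)"
    by (rule has_derivative_compose[rotated]) (auto intro!: derivative_eq_intros)
  then show ?thesis
    by (simp add: has_field_derivative_def inner_commute mult.commute[of _ "_ \<bullet> _"])
qed

lemma bump_increment_bound:
  assumes F: "v_differentiable T F" and t: "t \<in> {0..T}" and x: "x \<in> Dpaths T"
    and M: "\<And>r. r \<in> {0..1} \<Longrightarrow> norm (v_grad T F t (bump T t x (r *\<^sub>R \<delta>))) \<le> M"
  shows "\<bar>F t (bump T t x \<delta>) - F t (stop T t x)\<bar> \<le> M * norm \<delta>"
proof -
  define f where "f r = F t (bump T t x (r *\<^sub>R \<delta>))" for r
  obtain r where r: "0 < r" "r < 1" "f 1 - f 0 = (1 - 0) * (v_grad T F t (bump T t x (r *\<^sub>R \<delta>)) \<bullet> \<delta>)"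
    using MVT2[of 0 1 f "\<lambda>r. v_grad T F t (bump T t x (r *\<^sub>R \<delta>)) \<bullet> \<delta>"]
      bump_has_real_derivative[OF F t x, of \<delta>] by (auto simp: f_def[abs_def])
  have "\<bar>f 1 - f 0\<bar> \<le> norm (v_grad T F t (bump T t x (r *\<^sub>R \<delta>))) * norm \<delta>"
    using r(3) Cauchy_Schwarz_ineq2 by simp
  also have "\<dots> \<le> M * norm \<delta>" using r M by (intro mult_right_mono) auto
  finally show ?thesis by (simp add: f_def bump_0)
qed

text \<open>
  Along \<open>r \<mapsto> r \<delta>\<close> the first two derivatives exist everywhere, so the Lagrange form of the remainder
  applies.
\<close>

lemma bump_Taylor:
  assumes F: "v_differentiable T F" and F': "\<And>i. v_differentiable T (v_iter T F [i])"
    and t: "t \<in> {0..T}" and x: "x \<in> Dpaths T"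
  obtains \<theta> where "\<theta> \<in> {0<..<1}"
    "F t (bump T t x \<delta>) = F t (stop T t x) + v_grad T F t (stop T t x) \<bullet> \<delta> +
      (\<Sum>j\<in>UNIV. \<Sum>i\<in>UNIV. v_iter T F [i, j] t (bump T t x (\<theta> *\<^sub>R \<delta>)) * (\<delta> $ i * \<delta> $ j)) / 2"
proof -
  define f where "f r = F t (bump T t x (r *\<^sub>R \<delta>))" for r
  define f1 where "f1 r = v_grad T F t (bump T t x (r *\<^sub>R \<delta>)) \<bullet> \<delta>" for r
  define f2 where "f2 r = (\<Sum>j\<in>UNIV. \<Sum>i\<in>UNIV. v_iter T F [i, j] t (bump T t x (r *\<^sub>R \<delta>)) * (\<delta> $ i * \<delta> $ j))" for r
  have d1: "(f has_real_derivative f1 r) (at r)" for r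
    unfolding f_def[abs_def] f1_def by (rule bump_has_real_derivative[OF F t x])
  have d2: "(f1 has_real_derivative f2 r) (at r)" for r
  proof -
    have "((\<lambda>r. \<Sum>j\<in>UNIV. v_iter T F [j] t (bump T t x (r *\<^sub>R \<delta>)) * \<delta> $ j) has_real_derivative
        (\<Sum>j\<in>UNIV. (v_grad T (v_iter T F [j]) t (bump T t x (r *\<^sub>R \<delta>)) \<bullet> \<delta>) * \<delta> $ j)) (at r)"
      by (intro DERIV_sum DERIV_cmult_right bump_has_real_derivative[OF F' t x])
    then show ?thesis
      by (simp add: f1_def[abs_def] f2_def inner_vec_def sum_distrib_right mult.assoc)
  qed
  define diff where "diff n = (if n = 0 then f else if n = (1::nat) then f1 else f2)" for n
  have "\<exists>\<theta>>0. \<theta> < 1 \<and> f 1 = (\<Sum>k<2. (diff k 0 / fact k) * 1 ^ k) + (diff 2 \<theta> / fact 2) * 1 ^ 2"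
  proof (rule Maclaurin)
    show "\<forall>k r. k < 2 \<and> 0 \<le> r \<and> r \<le> 1 \<longrightarrow> (diff k has_real_derivative diff (Suc k) r) (at r)"
      using d1 d2 by (auto simp: diff_def less_2_cases_iff)
  qed (auto simp: diff_def)
  then obtain \<theta> where "0 < \<theta>" "\<theta> < 1" "f 1 = f 0 + f1 0 + f2 \<theta> / 2"
    by (auto simp: diff_def numeral_2_eq_2)
  then show thesis
    by (intro that[of \<theta>]) (simp_all add: f_def f1_def f2_def bump_0)
qed

section \<open>Horizontal derivatives\<close>

lemma h_deriv_tendsto:
  assumes F: "h_differentiable T F" and x: "x \<in> Dpaths T" and u: "u \<in> {0..<T}" and stop: "stop T u x = x"
  shows "((\<lambda>h. (F (u + h) x - F u x) / h) \<longlongrightarrow> h_deriv T F u x) (at_right 0)"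
proof -
  have "h_quotient T F u x = (\<lambda>h. (F (u + h) x - F u x) / h)"
    by (simp add: h_quotient_def[abs_def] stop)
  moreover obtain l where "(h_quotient T F u x \<longlongrightarrow> l) (at_right 0)"
    using F x u unfolding h_differentiable_def by blast
  moreover from this have "h_deriv T F u x = l"
    unfolding h_deriv_def by (intro tendsto_Lim) auto
  ultimately show ?thesis by simp
qed

lemma stop_later:
  assumes "stop T s x = x" "s \<in> {0..T}" "s \<le> u"
  shows "stop T u x = x"
proof -
  have "stop T u (stop T s x) = stop T s x" using assms(2,3) by (subst stop_stop) (auto simp: min_def)
  then show ?thesis by (simp add: assms(1))
qed

text \<open>
  For a path that is constant after \<open>s\<close>, left continuity of \<open>F\<close> bounds the variation from the left and
  the existence of the right derivative that from the right.
\<close>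

lemma continuous_on_time:
  assumes F: "h_differentiable T F" and Fl: "left_continuous T F"
    and x: "x \<in> Dpaths T" and s: "s \<in> {0..T}" and stop: "stop T s x = x"
  shows "continuous_on {s..T} (\<lambda>u. F u x)"
  unfolding continuous_on_iff
proof (intro ballI allI impI)
  fix u \<epsilon> :: real assume u: "u \<in> {s..T}" and "\<epsilon> > 0"
  have su: "stop T v x = x" if "v \<in> {s..T}" for v using stop_later[OF stop s] that by simp
  have "sup_dist T x x = 0" using sup_dist_le[of T x x 0] x s
    by (intro antisym) (auto simp: sup_dist_eq_SUP)
  obtain \<eta> where \<eta>: "\<eta> > 0"
    "\<And>t' y. t' \<in> {0..T} \<Longrightarrow> y \<in> Dpaths T \<Longrightarrow> stop T t' y = y \<Longrightarrow> t' < u \<Longrightarrow>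
      sup_dist T (stop T u x) y + (u - t') < \<eta> \<Longrightarrow> \<bar>F u x - F t' y\<bar> < \<epsilon>"
    using left_continuousD[OF Fl x _ \<open>\<epsilon> > 0\<close>, of u] u s by auto
  have left: "\<bar>F u x - F v x\<bar> < \<epsilon>" if "v \<in> {s..T}" "v < u" "u - v < \<eta>" for v
    using that s x by (intro \<eta>(2)) (auto simp: su su[OF u] \<open>sup_dist T x x = 0\<close>)
  have "\<exists>d>0. \<forall>v\<in>{s..T}. u < v \<and> v - u < d \<longrightarrow> \<bar>F v x - F u x\<bar> < \<epsilon>"
  proof (cases "u = T")
    case True
    then show ?thesis by (intro exI[of _ 1]) auto
  next
    case False
    then have "((\<lambda>h. (F (u + h) x - F u x) / h) \<longlongrightarrow> h_deriv T F u x) (at_right 0)"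
      using u s by (intro h_deriv_tendsto[OF F x]) (auto simp: su)
    moreover have "((\<lambda>h::real. h) \<longlongrightarrow> 0) (at_right 0)" by (rule tendsto_ident_at)
    ultimately have "((\<lambda>h. (F (u + h) x - F u x) / h * h) \<longlongrightarrow> h_deriv T F u x * 0) (at_right 0)"
      by (rule tendsto_mult)
    then have "\<forall>\<^sub>F h in at_right 0. dist ((F (u + h) x - F u x) / h * h) (h_deriv T F u x * 0) < \<epsilon>"
      using \<open>\<epsilon> > 0\<close> by (rule tendstoD)
    then obtain d where "d > 0" "\<And>h. 0 < h \<Longrightarrow> h < d \<Longrightarrow> \<bar>F (u + h) x - F u x\<bar> < \<epsilon>"
      by (auto simp: eventually_at_right_field dist_real_def)
    from this(1) this(2)[of "_ - u"] show ?thesis by (intro exI[of _ d]) auto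
  qed
  then obtain d where d: "d > 0" "\<And>v. v \<in> {s..T} \<Longrightarrow> u < v \<Longrightarrow> v - u < d \<Longrightarrow> \<bar>F v x - F u x\<bar> < \<epsilon>" by blast
  show "\<exists>d>0. \<forall>v\<in>{s..T}. dist v u < d \<longrightarrow> dist (F v x) (F u x) < \<epsilon>"
  proof (intro exI[of _ "min \<eta> d"] conjI ballI impI)
    fix v assume v: "v \<in> {s..T}" "dist v u < min \<eta> d"
    then show "dist (F v x) (F u x) < \<epsilon>"
      using left[of v] d(2)[of v] \<open>\<epsilon> > 0\<close>
      by (cases v u rule: linorder_cases) (auto simp: dist_real_def abs_minus_commute)
  qed (use \<eta>(1) d(1) in auto)
qed

lemma horizontal_FTC:
  assumes F: "h_differentiable T F" and Fl: "left_continuous T F"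
    and x: "x \<in> Dpaths T" and s: "s \<in> {0..T}" and stop: "stop T s x = x"
    and ab: "s \<le> a" "a \<le> b" "b \<le> T"
    and M: "\<And>u. u \<in> {a..<b} \<Longrightarrow> \<bar>h_deriv T F u x\<bar> < M"
  shows "\<bar>F b x - F a x\<bar> \<le> M * (b - a)"
    and "((\<lambda>u. h_deriv T F u x) has_integral (F b x - F a x)) {a..b}"
proof -
  have cont: "continuous_on {a..b} (\<lambda>u. F u x)"
    using ab by (intro continuous_on_subset[OF continuous_on_time[OF F Fl x s stop]]) auto
  have D: "((\<lambda>h. (F (u + h) x - F u x) / h) \<longlongrightarrow> h_deriv T F u x) (at_right 0)" if "u \<in> {a..<b}" for u
    using that ab s by (intro h_deriv_tendsto[OF F x] stop_later[OF stop s]) auto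
  show "\<bar>F b x - F a x\<bar> \<le> M * (b - a)"
    by (rule right_derivative_bound[OF ab(2) cont D M])
  show "((\<lambda>u. h_deriv T F u x) has_integral (F b x - F a x)) {a..b}"
    by (rule right_derivative_has_integral[OF ab(2) cont D M])
qed

section \<open>Step paths along a grid\<close>

text \<open>
  The path \<open>stepped T u x k\<close> follows \<open>x\<close> up to \<open>u 0\<close>, equals \<open>x (u (Suc j))\<close> on \<open>[u j, u (Suc j))\<close> for
  \<open>j < k\<close>, and equals \<open>x (u k)\<close> from \<open>u k\<close> on. The recursion exhibits each step as one vertical bump.
\<close>

primrec stepped :: "real \<Rightarrow> (nat \<Rightarrow> real) \<Rightarrow> (real \<Rightarrow> real^'d) \<Rightarrow> nat \<Rightarrow> real \<Rightarrow> real^'d" where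
  "stepped T u x 0 = stop T (u 0) x"
| "stepped T u x (Suc k) = bump T (u k) (stepped T u x k) (x (u (Suc k)) - x (u k))"

locale time_grid =
  fixes T :: real and u :: "nat \<Rightarrow> real" and N :: nat
  assumes grid_Suc: "\<And>k. k < N \<Longrightarrow> u k < u (Suc k)"
    and grid_first: "0 \<le> u 0" and grid_last: "u N \<le> T"
begin

lemma grid_mono: "j \<le> k \<Longrightarrow> k \<le> N \<Longrightarrow> u j \<le> u k"
proof (induction k rule: dec_induct)
  case (step k)
  then show ?case using grid_Suc[of k] by simp
qed simp

lemma grid_in: "k \<le> N \<Longrightarrow> u k \<in> {0..T}"
  using grid_mono[of 0 k] grid_mono[of k N] grid_first grid_last by simp

lemma stepped_Dpaths: "x \<in> Dpaths T \<Longrightarrow> k \<le> N \<Longrightarrow> stepped T u x k \<in> Dpaths T"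
  by (induction k) (auto intro!: bump_Dpaths stop_Dpaths grid_in)

lemma stepped_after: "k \<le> N \<Longrightarrow> r \<in> {u k..T} \<Longrightarrow> stepped T u x k r = x (u k)"
proof (induction k arbitrary: r)
  case 0
  then show ?case using grid_in[of 0] by (simp add: stop_apply min_def)
next
  case (Suc k)
  have "u k < u (Suc k)" "u k \<in> {0..T}" using Suc.prems grid_Suc[of k] grid_in[of k] by auto
  then show ?case using Suc.IH[of "u k"] Suc.prems by (simp add: bump_apply min_def)
qed

lemma stepped_before: "k \<le> N \<Longrightarrow> r \<in> {0..<u 0} \<Longrightarrow> stepped T u x k r = x r"
proof (induction k)
  case 0
  then show ?case using grid_in[of 0] by (simp add: stop_apply min_def)
next
  case (Suc k)
  then show ?case using grid_mono[of 0 k] grid_in[of 0] by (simp add: bump_apply min_def)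
qed

lemma stepped_between:
  "k \<le> N \<Longrightarrow> j < k \<Longrightarrow> r \<in> {u j..<u (Suc j)} \<Longrightarrow> stepped T u x k r = x (u (Suc j))"
proof (induction k)
  case (Suc k)
  have r: "r \<in> {0..T}" using Suc.prems grid_in[of j] grid_in[of "Suc j"] by auto
  show ?case
  proof (cases "j = k")
    case True
    then show ?thesis using Suc.prems r stepped_after[of k "u k"] grid_in[of k]
      by (simp add: bump_apply min_def)
  next
    case False
    then show ?thesis using Suc grid_mono[of "Suc j" k] r by (simp add: bump_apply min_def)
  qed
qed simp

lemma grid_position:
  assumes "k \<le> N" "r \<in> {0..T}"
  obtains "r < u 0" | "u k \<le> r" | j where "j < k" "r \<in> {u j..<u (Suc j)}"
proof (cases "r < u 0 \<or> u k \<le> r")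
  case True then show thesis using that(1,2) by blast
next
  case False
  then have outside: "\<not> r < u 0" "r < u k" by auto
  define j where "j = (LEAST i. r < u i)"
  have j: "r < u j" unfolding j_def by (rule LeastI[of _ k]) (use False in simp)
  then have "j \<noteq> 0" using outside(1) by (metis)
  then have "\<not> r < u (j - 1)" unfolding j_def by (intro not_less_Least) simp
  moreover have "j \<le> k" unfolding j_def by (rule Least_le) (use False in simp)
  ultimately have "j - 1 < k" "r \<in> {u (j - 1)..<u (Suc (j - 1))}" using j \<open>j \<noteq> 0\<close> by simp_all
  then show thesis by (rule that(3))
qed

lemma stepped_range:
  assumes "k \<le> N" "r \<in> {0..T}"
  shows "stepped T u x k r \<in> x ` {0..T}"
  using assms
proof (cases rule: grid_position)
  case 1
  then show ?thesis using stepped_before[OF assms(1), of r x] assms(2) by auto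
next
  case 2
  then show ?thesis using stepped_after[OF assms(1), of r x] grid_in[OF assms(1)] assms(2) by auto
next
  case (3 j)
  then show ?thesis using stepped_between[OF assms(1), of j r x] grid_in[of "Suc j"] assms by auto
qed

lemma stepped_close:
  assumes "k \<le> N" "r \<in> {0..T}" "0 \<le> \<epsilon>"
    and close: "\<And>j r. j < k \<Longrightarrow> r \<in> {u j..u (Suc j)} \<Longrightarrow> norm (x (u (Suc j)) - x r) \<le> \<epsilon>"
  shows "norm (stepped T u x k r - x (min (u k) r)) \<le> \<epsilon>"
  using assms(1,2)
proof (cases rule: grid_position)
  case 1
  then show ?thesis using stepped_before[OF assms(1), of r x] assms(2,3) grid_mono[of 0 k] assms(1)
    by (simp add: min_def)
next
  case 2
  then show ?thesis using stepped_after[OF assms(1), of r x] assms(2,3) by (simp add: min_def)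
next
  case (3 j)
  then have "r < u k" using grid_mono[of "Suc j" k] assms(1) by simp
  then show ?thesis using stepped_between[OF assms(1) 3, of x] close[of j r] 3 by (simp add: min_def)
qed

lemma stop_stepped: "k \<le> N \<Longrightarrow> x \<in> Dpaths T \<Longrightarrow> stop T (u k) (stepped T u x k) = stepped T u x k"
proof (rule extensionalityI)
  assume k: "k \<le> N" and x: "x \<in> Dpaths T"
  show "stop T (u k) (stepped T u x k) \<in> extensional {0..T}" by (simp add: stop_def)
  show "stepped T u x k \<in> extensional {0..T}" using stepped_Dpaths[OF x k] by (simp add: Dpaths_def)
  show "stop T (u k) (stepped T u x k) r = stepped T u x k r" if "r \<in> {0..T}" for r
    using that stepped_after[OF k, of r x] stepped_after[OF k, of "u k" x] grid_in[OF k]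
    by (simp add: stop_apply min_def)
qed

lemma stop_stepped_Suc: "k < N \<Longrightarrow> stop T (u k) (stepped T u x (Suc k)) = stepped T u x (Suc k)"
  using grid_in[of k] by (simp add: stop_bump)

end

section \<open>Bounds for the derivatives\<close>

definition paths_in :: "real \<Rightarrow> real \<Rightarrow> (real \<Rightarrow> real^'d) set" where
  "paths_in T R = {x \<in> Dpaths T. \<forall>r\<in>{0..T}. norm (x r) \<le> R}"

lemma paths_in_bump:
  assumes "x \<in> paths_in T R" "t \<in> {0..T}"
  shows "bump T t x e \<in> paths_in T (R + norm e)"
proof -
  have "norm (bump T t x e r) \<le> R + norm e" if "r \<in> {0..T}" for r
  proof -
    have "norm (x (min t r)) \<le> R" using assms that by (auto simp: paths_in_def)
    moreover have "norm (x (min t r) + e) \<le> norm (x (min t r)) + norm e" by (rule norm_triangle_ineq)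
    moreover have "0 \<le> norm e" by simp
    ultimately show ?thesis using that by (cases "t \<le> r") (auto simp: bump_apply simp del: norm_ge_zero)
  qed
  then show ?thesis using assms by (auto simp: paths_in_def intro!: bump_Dpaths)
qed

lemma paths_in_mono: "x \<in> paths_in T R \<Longrightarrow> R \<le> R' \<Longrightarrow> x \<in> paths_in T R'"
  by (force simp: paths_in_def)

lemma boundedness_preservingD:
  fixes G :: "'d::finite fnl"
  assumes "boundedness_preserving T I G" "I \<subseteq> {0..T}" "0 \<le> T"
  shows "\<exists>C. \<forall>(u, x)\<in>I \<times> paths_in T R. \<bar>G u x\<bar> \<le> C"
proof -
  obtain C where C: "\<And>u x. u \<in> I \<Longrightarrow> x \<in> Dpaths T \<Longrightarrow> u \<le> T \<Longrightarrow> x ` {0..u} \<subseteq> cball 0 R \<Longrightarrow> \<bar>G u x\<bar> < C"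
    using assms(1,3) unfolding boundedness_preserving_def
    by (metis atLeastAtMost_iff compact_cball order_refl)
  have "\<bar>G u x\<bar> \<le> C" if "u \<in> I" "x \<in> paths_in T R" for u x
  proof -
    have "x ` {0..u} \<subseteq> cball 0 R" using that assms(2) by (auto simp: paths_in_def)
    then show ?thesis using that assms(2) by (intro less_imp_le[OF C]) (auto simp: paths_in_def)
  qed
  then show ?thesis by auto
qed

lemma finite_common_bound:
  fixes f :: "'k::finite \<Rightarrow> 'x \<Rightarrow> real"
  assumes "\<And>k. \<exists>C. \<forall>x\<in>S. \<bar>f k x\<bar> \<le> C"
  shows "\<exists>C. \<forall>k. \<forall>x\<in>S. \<bar>f k x\<bar> \<le> C"
proof -
  obtain C where C: "\<And>k x. x \<in> S \<Longrightarrow> \<bar>f k x\<bar> \<le> C k" using assms by metis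
  have "\<bar>f k x\<bar> \<le> Max (range C)" if "x \<in> S" for k x
    using C[OF that, of k] Max_ge[of "range C" "C k"] by (auto intro: order.trans)
  then show ?thesis by blast
qed

lemma norm_vec_le_card:
  fixes v :: "real^'d::finite" and C :: real
  assumes "\<And>i. \<bar>v $ i\<bar> \<le> C"
  shows "norm v \<le> CARD('d) * C"
proof -
  have "norm v \<le> (\<Sum>i\<in>UNIV. \<bar>v $ i\<bar>)" by (rule norm_le_l1_cart)
  also have "\<dots> \<le> (\<Sum>i::'d\<in>UNIV. C)" by (intro sum_mono assms)
  finally show ?thesis by simp
qed

text \<open>
  Summation by parts with the differences \<open>X n - X (Suc k)\<close>, which vanish for the last index.
\<close>

lemma Abel_summation_inner:
  fixes g X :: "nat \<Rightarrow> 'a::real_inner"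
  shows "(\<Sum>k<n. g k \<bullet> (X (Suc k) - X k)) - g 0 \<bullet> (X n - X 0) =
    (\<Sum>k<n. (g (Suc k) - g k) \<bullet> (X n - X (Suc k)))"
proof (induction n)
  case (Suc n)
  have "(\<Sum>k<n. (g (Suc k) - g k) \<bullet> (X (Suc n) - X (Suc k))) =
      (\<Sum>k<n. (g (Suc k) - g k) \<bullet> (X n - X (Suc k))) + (\<Sum>k<n. g (Suc k) - g k) \<bullet> (X (Suc n) - X n)"
    unfolding inner_sum_left sum.distrib[symmetric] by (intro sum.cong) (simp_all add: inner_diff_right)
  also have "(\<Sum>k<n. g (Suc k) - g k) = g n - g 0" by (rule sum_lessThan_telescope)
  finally show ?case using Suc.IH by (simp add: inner_diff_left inner_diff_right)
qed simp

text \<open>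
  The condition on the gradient enters through the bounds for the horizontal derivatives of its
  components, when the gradient is frozen in \<open>grid_remainder_bound\<close>.
\<close>

locale smooth_functional =
  fixes T :: real and F :: "'d::finite fnl"
  assumes T: "0 < T" and F: "F \<in> C1b T 2" and F_Lip: "F \<in> Lip T"
    and F': "\<And>i. (\<lambda>t x. v_grad T F t x $ i) \<in> C1b T 1"
begin

lemma F_facts:
  "h_differentiable T F" "left_continuous T F" "v_differentiable T F"
  "v_differentiable T (v_iter T F [i])" "left_continuous T (v_iter T F [i])"
  "left_continuous T (v_iter T F [i, j])" "h_differentiable T (v_iter T F [i])"
  "boundedness_preserving T {0..<T} (h_deriv T F)"
  "boundedness_preserving T {0..<T} (h_deriv T (v_iter T F [i]))"
  "boundedness_preserving T {0..T} (v_iter T F [i])"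
  "boundedness_preserving T {0..T} (v_iter T F [i, j])"
  "continuous_fixed_times T {0..<T} (h_deriv T F)"
proof -
  have nil: "length ([]::'d list) < 2" "length ([]::'d list) \<le> 2" by simp_all
  have one: "length [i] < 2" "length [i] \<le> 2" "1 \<le> length [i]" for i :: 'd by simp_all
  have two: "length [i, j] \<le> 2" "1 \<le> length [i, j]" for i j :: 'd by simp_all
  note F1 = F[unfolded C1b_def mem_Collect_eq] and F2 = F'[unfolded C1b_def mem_Collect_eq]
  have *: "v_iter T F [i] = (\<lambda>t x. v_grad T F t x $ i)" for i by simp
  show "h_differentiable T F" "boundedness_preserving T {0..<T} (h_deriv T F)"
    "continuous_fixed_times T {0..<T} (h_deriv T F)" using F1 by blast+
  show "left_continuous T F" "v_differentiable T F" using F1 nil by (metis v_iter.simps(1))+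
  show "v_differentiable T (v_iter T F [i])" "left_continuous T (v_iter T F [i])"
    "boundedness_preserving T {0..T} (v_iter T F [i])" using F1 one by blast+
  show "left_continuous T (v_iter T F [i, j])"
    "boundedness_preserving T {0..T} (v_iter T F [i, j])" using F1 two by blast+
  show "h_differentiable T (v_iter T F [i])"
    "boundedness_preserving T {0..<T} (h_deriv T (v_iter T F [i]))"
    unfolding * using F2 by blast+
qed

lemma F_stop: "t \<in> {0..T} \<Longrightarrow> x \<in> Dpaths T \<Longrightarrow> F t (stop T t x) = F t x"
  using F_facts(2) by (simp add: left_continuous_def nonanticipative_def)

lemma grad_stop: "t \<in> {0..T} \<Longrightarrow> v_grad T G t (stop T t x) = v_grad T G t x"
  unfolding v_grad_def by (simp add: bump_stop)

text \<open>
  One constant for all first and second derivatives of \<open>F\<close> on paths in the ball of radius \<open>R\<close>. The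
  inequality is strict for horizontal derivatives because these are integrated by \<open>horizontal_FTC\<close>.
\<close>

definition derivative_bound :: "real \<Rightarrow> real \<Rightarrow> bool" where
  "derivative_bound R C \<longleftrightarrow> 0 < C \<and> (\<forall>x\<in>paths_in T R.
     (\<forall>u\<in>{0..<T}. \<bar>h_deriv T F u x\<bar> < C \<and> (\<forall>i. \<bar>h_deriv T (v_iter T F [i]) u x\<bar> < C)) \<and>
     (\<forall>u\<in>{0..T}. norm (v_grad T F u x) \<le> C \<and> (\<forall>i. norm (v_grad T (v_iter T F [i]) u x) \<le> C) \<and>
        (\<forall>i j. \<bar>v_iter T F [i, j] u x\<bar> \<le> C)))"

lemma derivative_bound_exists: "\<exists>C. derivative_bound R C"
proof -
  have sub: "{0..<T} \<subseteq> {0..T}" by auto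
  have T0: "0 \<le> T" using T by simp
  let ?P = "paths_in T R :: (real \<Rightarrow> real^'d) set"
  obtain C1 where C1: "\<forall>(u, x)\<in>{0..<T} \<times> ?P. \<bar>h_deriv T F u x\<bar> \<le> C1"
    using boundedness_preservingD[OF F_facts(8) sub T0] by blast
  have "\<exists>C. \<forall>i. \<forall>p\<in>{0..<T} \<times> ?P. \<bar>case p of (u, x) \<Rightarrow> h_deriv T (v_iter T F [i]) u x\<bar> \<le> C"
    using boundedness_preservingD[OF F_facts(9) sub T0] by (intro finite_common_bound) (simp add: case_prod_unfold)
  then obtain C2 where C2: "\<And>i u x. u \<in> {0..<T} \<Longrightarrow> x \<in> ?P \<Longrightarrow> \<bar>h_deriv T (v_iter T F [i]) u x\<bar> \<le> C2"
    by fastforce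
  have "\<exists>C. \<forall>i. \<forall>p\<in>{0..T} \<times> ?P. \<bar>case p of (u, x) \<Rightarrow> v_iter T F [i] u x\<bar> \<le> C"
    using boundedness_preservingD[OF F_facts(10) _ T0] by (intro finite_common_bound) (simp add: case_prod_unfold)
  then obtain C3 where C3: "\<And>i u x. u \<in> {0..T} \<Longrightarrow> x \<in> ?P \<Longrightarrow> \<bar>v_iter T F [i] u x\<bar> \<le> C3"
    by fastforce
  have "\<exists>C. \<forall>k. \<forall>p\<in>{0..T} \<times> ?P. \<bar>case p of (u, x) \<Rightarrow> v_iter T F [fst k, snd k] u x\<bar> \<le> C"
    using boundedness_preservingD[OF F_facts(11) _ T0] by (intro finite_common_bound) (simp add: case_prod_unfold)
  then obtain C4 where C4: "\<And>i j u x. u \<in> {0..T} \<Longrightarrow> x \<in> ?P \<Longrightarrow> \<bar>v_iter T F [i, j] u x\<bar> \<le> C4"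
    by fastforce
  have C3': "norm (v_grad T F u x) \<le> CARD('d) * C3" if "u \<in> {0..T}" "x \<in> ?P" for u x
    using C3[OF that] by (intro norm_vec_le_card) simp
  have C4': "norm (v_grad T (v_iter T F [i]) u x) \<le> CARD('d) * C4" if "u \<in> {0..T}" "x \<in> ?P" for u x i
    using C4[OF that] by (intro norm_vec_le_card) simp
  define C where "C = Max {0, C1, C2, CARD('d) * C3, CARD('d) * C4, C4} + 1"
  have *: "a < C" if "a \<in> {0, C1, C2, CARD('d) * C3, CARD('d) * C4, C4}" for a
    unfolding C_def using that by (intro less_add_one[THEN le_less_trans[rotated]] Max_ge) auto
  have C: "0 < C" "C1 < C" "C2 < C" "CARD('d) * C3 \<le> C" "CARD('d) * C4 \<le> C" "C4 \<le> C"
    by (intro * less_imp_le[OF *]; simp)+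
  have "derivative_bound R C"
    unfolding derivative_bound_def
  proof (intro conjI ballI allI)
    fix u and x :: "real \<Rightarrow> real^'d" assume x: "x \<in> ?P" and u: "u \<in> {0..<T}"
    show "\<bar>h_deriv T F u x\<bar> < C" using C1 x u C(2) by force
    show "\<bar>h_deriv T (v_iter T F [i]) u x\<bar> < C" for i
      using C2[OF u x, of i] C(3) by linarith
  next
    fix u and x :: "real \<Rightarrow> real^'d" assume x: "x \<in> ?P" and u: "u \<in> {0..T}"
    show "norm (v_grad T F u x) \<le> C" using C3'[OF u x] C(4) by linarith
    show "norm (v_grad T (v_iter T F [i]) u x) \<le> C" for i using C4'[OF u x, of i] C(5) by linarith
    show "\<bar>v_iter T F [i, j] u x\<bar> \<le> C" for i j using C4[OF u x, of i j] C(6) by linarith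
  qed (rule C(1))
  then show ?thesis ..
qed

lemma second_order_bound:
  assumes "derivative_bound R C" "t \<in> {0..T}" "x \<in> Dpaths T"
    and "\<And>r. r \<in> {0..1} \<Longrightarrow> bump T t x (r *\<^sub>R \<delta>) \<in> paths_in T R"
  shows "\<bar>F t (bump T t x \<delta>) - F t (stop T t x) - v_grad T F t (stop T t x) \<bullet> \<delta>\<bar>
    \<le> (real CARD('d))\<^sup>2 * C * (norm \<delta>)\<^sup>2"
proof -
  obtain \<theta> where \<theta>: "\<theta> \<in> {0<..<1}"
    "F t (bump T t x \<delta>) = F t (stop T t x) + v_grad T F t (stop T t x) \<bullet> \<delta> +
      (\<Sum>j\<in>UNIV. \<Sum>i\<in>UNIV. v_iter T F [i, j] t (bump T t x (\<theta> *\<^sub>R \<delta>)) * (\<delta> $ i * \<delta> $ j)) / 2"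
    by (rule bump_Taylor[OF F_facts(3,4) assms(2,3)])
  have C: "0 < C" using assms(1) by (simp add: derivative_bound_def)
  have "bump T t x (\<theta> *\<^sub>R \<delta>) \<in> paths_in T R" using assms(4) \<theta>(1) by simp
  then have v: "\<bar>v_iter T F [i, j] t (bump T t x (\<theta> *\<^sub>R \<delta>))\<bar> \<le> C" for i j
    using assms(1,2) by (simp add: derivative_bound_def del: v_iter.simps)
  have "\<bar>\<Sum>j\<in>UNIV. \<Sum>i\<in>UNIV. v_iter T F [i, j] t (bump T t x (\<theta> *\<^sub>R \<delta>)) * (\<delta> $ i * \<delta> $ j)\<bar>
      \<le> (\<Sum>j\<in>(UNIV::'d set). \<Sum>i\<in>(UNIV::'d set). C * (norm \<delta>)\<^sup>2)"
  proof (intro order.trans[OF sum_abs] sum_mono)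
    fix i j
    have "\<bar>\<delta> $ i * \<delta> $ j\<bar> \<le> norm \<delta> * norm \<delta>"
      unfolding abs_mult by (intro mult_mono component_le_norm_cart) auto
    then show "\<bar>v_iter T F [i, j] t (bump T t x (\<theta> *\<^sub>R \<delta>)) * (\<delta> $ i * \<delta> $ j)\<bar> \<le> C * (norm \<delta>)\<^sup>2"
      unfolding abs_mult[of "v_iter _ _ _ _ _"] power2_eq_square using v[of i j] C
      by (intro mult_mono) auto
  qed
  also have "\<dots> = (real CARD('d))\<^sup>2 * C * (norm \<delta>)\<^sup>2" by (simp add: power2_eq_square)
  finally show ?thesis using \<theta>(2) by linarith
qed

lemma Lip_bound:
  "\<exists>K>0. \<forall>t\<in>{0..T}. \<forall>x\<in>Dpaths T. \<forall>y\<in>Dpaths T. \<forall>\<epsilon>.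
    (\<forall>r\<in>{0..T}. norm (x (min t r) - y (min t r)) \<le> \<epsilon>) \<longrightarrow> \<bar>F t x - F t y\<bar> \<le> K * \<epsilon>"
proof -
  have "\<exists>K>0. \<forall>t\<in>{0..T}. \<forall>x\<in>Dpaths T. \<forall>y\<in>Dpaths T.
      \<bar>F t x - F t y\<bar> \<le> K * sup_dist T (stop T t x) (stop T t y)"
    using F_Lip by (simp add: Lip_def)
  then obtain K where K: "K > 0" "\<And>t x y. t \<in> {0..T} \<Longrightarrow> x \<in> Dpaths T \<Longrightarrow> y \<in> Dpaths T \<Longrightarrow>
    \<bar>F t x - F t y\<bar> \<le> K * sup_dist T (stop T t x) (stop T t y)" by blast
  have "\<bar>F t x - F t y\<bar> \<le> K * \<epsilon>"
    if "t \<in> {0..T}" "x \<in> Dpaths T" "y \<in> Dpaths T"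
      "\<forall>r\<in>{0..T}. norm (x (min t r) - y (min t r)) \<le> \<epsilon>" for t \<epsilon> and x y :: "real \<Rightarrow> real^'d"
  proof -
    have "sup_dist T (stop T t x) (stop T t y) \<le> \<epsilon>"
      using that T by (intro sup_dist_le) (auto simp: stop_apply dist_norm intro!: stop_Dpaths)
    then have "K * sup_dist T (stop T t x) (stop T t y) \<le> K * \<epsilon>" using K(1) by simp
    then show ?thesis using K(2)[OF that(1-3)] by linarith
  qed
  then show ?thesis using K(1) by blast
qed

text \<open>
  Here \<open>h\<close> bounds the oscillation of \<open>\<omega>\<close> in the cells and \<open>H\<close> its distance from the final value. The
  Lipschitz condition replaces \<open>\<omega>\<close> by the step path at the cost \<open>h\<close>. For the step path, \<open>F\<close> is expanded
  cell by cell with errors of the order of the cell length and of \<open>h\<^sup>2\<close>, which leaves the sum of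
  \<open>g k \<bullet> \<delta> k\<close> with the gradient \<open>g k\<close> at the current path. Freezing the gradient at its initial value is
  done by parts: the change of \<open>g\<close> over one cell is of the order of the cell length plus \<open>h\<close>, and it is
  paired with an increment of \<open>\<omega>\<close> up to the end, hence the factor \<open>H\<close>. A direct estimate would have
  the square of the sum of the increments instead.
\<close>

lemma grid_remainder_bound:
  assumes R: "\<omega> \<in> paths_in T R"
  obtains K where "K > 0" "\<And>u N h H. time_grid T u N \<Longrightarrow> 0 \<le> h \<Longrightarrow>
     (\<And>j r r'. j < N \<Longrightarrow> r \<in> {u j..u (Suc j)} \<Longrightarrow> r' \<in> {u j..u (Suc j)} \<Longrightarrow> norm (\<omega> r - \<omega> r') \<le> h) \<Longrightarrow>
     (\<And>r. r \<in> {u 0..u N} \<Longrightarrow> norm (\<omega> (u N) - \<omega> r) \<le> H) \<Longrightarrow>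
     \<bar>F (u N) \<omega> - F (u 0) \<omega> - v_grad T F (u 0) \<omega> \<bullet> (\<omega> (u N) - \<omega> (u 0))\<bar>
       \<le> K * (h + (u N - u 0) + real N * h\<^sup>2 + ((u N - u 0) + real N * h) * H)"
proof -
  obtain C where C: "derivative_bound (3 * R) C" using derivative_bound_exists by blast
  obtain L where L: "L > 0" "\<And>t x y \<epsilon>. t \<in> {0..T} \<Longrightarrow> x \<in> Dpaths T \<Longrightarrow> y \<in> Dpaths T \<Longrightarrow>
    (\<And>r. r \<in> {0..T} \<Longrightarrow> norm (x (min t r) - y (min t r)) \<le> \<epsilon>) \<Longrightarrow> \<bar>F t x - F t y\<bar> \<le> L * \<epsilon>"
    using Lip_bound by (metis (no_types, lifting))
  have C0: "0 < C" using C by (simp add: derivative_bound_def)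
  have \<omega>: "\<omega> \<in> Dpaths T" using R by (simp add: paths_in_def)
  have \<omega>R: "norm (\<omega> r) \<le> R" if "r \<in> {0..T}" for r using R that by (simp add: paths_in_def)
  have R0: "0 \<le> R" using order.trans[OF norm_ge_zero \<omega>R[of 0]] T by simp
  define D where "D = real CARD('d)"
  have D: "1 \<le> D" by (simp add: D_def Suc_le_eq)
  define K where "K = L + C + D\<^sup>2 * C + D * C"
  have "0 \<le> D\<^sup>2 * C" "0 \<le> D * C" using C0 D by simp_all
  then have K: "0 < K" "L \<le> K" "C \<le> K" "D\<^sup>2 * C \<le> K" "D * C \<le> K"
    unfolding K_def using L(1) C0 by linarith+
  show thesis
  proof (rule that[OF K(1)])
    fix u :: "nat \<Rightarrow> real" and N h H
    assume grid: "time_grid T u N" and h: "0 \<le> h"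
      and cell: "\<And>j r r'. j < N \<Longrightarrow> r \<in> {u j..u (Suc j)} \<Longrightarrow> r' \<in> {u j..u (Suc j)} \<Longrightarrow> norm (\<omega> r - \<omega> r') \<le> h"
      and H: "\<And>r. r \<in> {u 0..u N} \<Longrightarrow> norm (\<omega> (u N) - \<omega> r) \<le> H"
    interpret time_grid T u N by (rule grid)
    define y where "y k = stepped T u \<omega> k" for k
    define \<delta> where "\<delta> k = \<omega> (u (Suc k)) - \<omega> (u k)" for k
    define g where "g k = v_grad T F (u k) (y k)" for k
    have H0: "0 \<le> H" using H[of "u N"] grid_mono[of 0 N] by simp
    have y: "y k \<in> paths_in T R" if "k \<le> N" for k
    proof -
      have "norm (stepped T u \<omega> k r) \<le> R" if "r \<in> {0..T}" for r
        using stepped_range[OF \<open>k \<le> N\<close> that, of \<omega>] \<omega>R by (metis imageE)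
      then show ?thesis unfolding paths_in_def y_def using stepped_Dpaths[OF \<omega> that] by blast
    qed
    have yD: "y k \<in> Dpaths T" if "k \<le> N" for k using y[OF that] by (simp add: paths_in_def)
    have \<delta>h: "norm (\<delta> k) \<le> h" if "k < N" for k
      using cell[OF that, of "u (Suc k)" "u k"] grid_Suc[OF that] by (simp add: \<delta>_def)
    have \<delta>R: "norm (\<delta> k) \<le> 2 * R" if "k < N" for k
      using norm_triangle_ineq4[of "\<omega> (u (Suc k))" "\<omega> (u k)"] \<omega>R[OF grid_in, of k] \<omega>R[OF grid_in, of "Suc k"] that
      unfolding \<delta>_def by simp
    have seg: "bump T (u k) (y k) (r *\<^sub>R \<delta> k) \<in> paths_in T (3 * R)" if "k < N" "r \<in> {0..1}" for k r
    proof -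
      have "r * norm (\<delta> k) \<le> 1 * (2 * R)" using \<delta>R[OF that(1)] that(2) by (intro mult_mono) auto
      moreover have "norm (r *\<^sub>R \<delta> k) = r * norm (\<delta> k)" using that(2) by simp
      ultimately have "R + norm (r *\<^sub>R \<delta> k) \<le> 3 * R" by linarith
      moreover have "bump T (u k) (y k) (r *\<^sub>R \<delta> k) \<in> paths_in T (R + norm (r *\<^sub>R \<delta> k))"
        using that(1) by (intro paths_in_bump y grid_in) auto
      ultimately show ?thesis by (rule paths_in_mono[rotated])
    qed
    have y_Suc: "y (Suc k) = bump T (u k) (y k) (\<delta> k)" for k by (simp add: y_def \<delta>_def)
    have y_Suc_3R: "y (Suc k) \<in> paths_in T (3 * R)" if "k < N" for k
      using seg[OF that, of 1] by (simp add: y_Suc)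
    have stop_y: "stop T (u k) (y k) = y k" if "k \<le> N" for k
      using stop_stepped[OF that \<omega>] by (simp add: y_def)
    have stop_y_Suc: "stop T (u k) (y (Suc k)) = y (Suc k)" if "k < N" for k
      using stop_stepped_Suc[OF that] by (simp add: y_def)
    have horizontal: "\<bar>G (u (Suc k)) (y (Suc k)) - G (u k) (y (Suc k))\<bar> \<le> C * (u (Suc k) - u k)"
      if k: "k < N" and G: "h_differentiable T G" "left_continuous T G"
        and b: "\<And>v x. v \<in> {0..<T} \<Longrightarrow> x \<in> paths_in T (3 * R) \<Longrightarrow> \<bar>h_deriv T G v x\<bar> < C" for G k
    proof (rule horizontal_FTC(1)[OF G, of "y (Suc k)" "u k"])
      show "u k \<in> {0..T}" using k by (intro grid_in) simp
      show "y (Suc k) \<in> Dpaths T" using k by (intro yD) simp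
      show "u (Suc k) \<le> T" using grid_in[of "Suc k"] k by simp
      fix v assume "v \<in> {u k..<u (Suc k)}"
      then show "\<bar>h_deriv T G v (y (Suc k))\<bar> < C"
        using grid_in[of k] grid_in[of "Suc k"] k by (intro b y_Suc_3R) auto
    qed (use grid_Suc[OF k] stop_y_Suc[OF k] in auto)
    have step_F: "\<bar>F (u (Suc k)) (y (Suc k)) - F (u k) (y k) - g k \<bullet> \<delta> k\<bar>
        \<le> C * (u (Suc k) - u k) + D\<^sup>2 * C * h\<^sup>2" if k: "k < N" for k
    proof -
      have "\<bar>F (u (Suc k)) (y (Suc k)) - F (u k) (y (Suc k))\<bar> \<le> C * (u (Suc k) - u k)"
        using C by (intro horizontal[OF k F_facts(1,2)]) (auto simp: derivative_bound_def)
      moreover have "\<bar>F (u k) (y (Suc k)) - F (u k) (y k) - g k \<bullet> \<delta> k\<bar> \<le> D\<^sup>2 * C * (norm (\<delta> k))\<^sup>2"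
        using second_order_bound[OF C grid_in[of k] yD[of k] seg[OF k]] k stop_y[of k]
        by (simp add: y_Suc g_def D_def)
      moreover have "D\<^sup>2 * C * (norm (\<delta> k))\<^sup>2 \<le> D\<^sup>2 * C * h\<^sup>2"
        using \<delta>h[OF k] C0 D by (intro mult_left_mono power_mono) auto
      ultimately show ?thesis by linarith
    qed
    have step_g: "norm (g (Suc k) - g k) \<le> D * (C * (u (Suc k) - u k + h))" if k: "k < N" for k
      unfolding D_def
    proof (rule norm_vec_le_card)
      fix i
      have "\<bar>v_iter T F [i] (u (Suc k)) (y (Suc k)) - v_iter T F [i] (u k) (y (Suc k))\<bar> \<le> C * (u (Suc k) - u k)"
        using C by (intro horizontal[OF k F_facts(7,5)]) (auto simp: derivative_bound_def simp del: v_iter.simps)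
      moreover have "\<bar>v_iter T F [i] (u k) (y (Suc k)) - v_iter T F [i] (u k) (y k)\<bar> \<le> C * norm (\<delta> k)"
      proof -
        have "\<bar>v_iter T F [i] (u k) (bump T (u k) (y k) (\<delta> k)) - v_iter T F [i] (u k) (stop T (u k) (y k))\<bar> \<le> C * norm (\<delta> k)"
        proof (rule bump_increment_bound[OF F_facts(4)])
          show "u k \<in> {0..T}" using k by (intro grid_in) simp
          then show "norm (v_grad T (v_iter T F [i]) (u k) (bump T (u k) (y k) (r *\<^sub>R \<delta> k))) \<le> C"
            if "r \<in> {0..1}" for r
            using C seg[OF k that] by (simp add: derivative_bound_def del: v_iter.simps)
        qed (use k yD in simp)
        then show ?thesis using stop_y[of k] k by (simp add: y_Suc)
      qed
      moreover have "C * norm (\<delta> k) \<le> C * h" using \<delta>h[OF k] C0 by simp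
      ultimately show "\<bar>(g (Suc k) - g k) $ i\<bar> \<le> C * (u (Suc k) - u k + h)"
        by (simp add: g_def algebra_simps)
    qed
    have telescope: "(\<Sum>k<N. u (Suc k) - u k) = u N - u 0" by (rule sum_lessThan_telescope)
    have "\<bar>F (u N) (y N) - F (u 0) (y 0) - (\<Sum>k<N. g k \<bullet> \<delta> k)\<bar>
        \<le> C * (u N - u 0) + D\<^sup>2 * C * (real N * h\<^sup>2)"
    proof -
      have "F (u N) (y N) - F (u 0) (y 0) - (\<Sum>k<N. g k \<bullet> \<delta> k) =
          (\<Sum>k<N. F (u (Suc k)) (y (Suc k)) - F (u k) (y k) - g k \<bullet> \<delta> k)"
        using sum_lessThan_telescope[of "\<lambda>k. F (u k) (y k)" N] by (simp add: sum_subtractf)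
      also have "\<bar>\<dots>\<bar> \<le> (\<Sum>k<N. C * (u (Suc k) - u k) + D\<^sup>2 * C * h\<^sup>2)"
        by (intro order.trans[OF sum_abs] sum_mono step_F) simp
      also have "\<dots> = C * (u N - u 0) + D\<^sup>2 * C * (real N * h\<^sup>2)"
        by (simp add: sum.distrib sum_distrib_left[symmetric] telescope)
      finally show ?thesis .
    qed
    moreover have "\<bar>(\<Sum>k<N. g k \<bullet> \<delta> k) - g 0 \<bullet> (\<omega> (u N) - \<omega> (u 0))\<bar>
        \<le> D * C * (((u N - u 0) + real N * h) * H)"
    proof -
      have "(\<Sum>k<N. g k \<bullet> \<delta> k) - g 0 \<bullet> (\<omega> (u N) - \<omega> (u 0)) =
          (\<Sum>k<N. (g (Suc k) - g k) \<bullet> (\<omega> (u N) - \<omega> (u (Suc k))))"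
        unfolding \<delta>_def by (rule Abel_summation_inner)
      also have "\<bar>\<dots>\<bar> \<le> (\<Sum>k<N. D * (C * (u (Suc k) - u k + h)) * H)"
      proof (intro order.trans[OF sum_abs] sum_mono)
        fix k assume "k \<in> {..<N}"
        then have k: "k < N" by simp
        have "\<bar>(g (Suc k) - g k) \<bullet> (\<omega> (u N) - \<omega> (u (Suc k)))\<bar> \<le> norm (g (Suc k) - g k) * norm (\<omega> (u N) - \<omega> (u (Suc k)))"
          by (rule Cauchy_Schwarz_ineq2)
        also have "\<dots> \<le> D * (C * (u (Suc k) - u k + h)) * H"
          using step_g[OF k] H[of "u (Suc k)"] grid_mono[of 0 "Suc k"] grid_mono[of "Suc k" N] k D C0 h grid_Suc[OF k]
          by (intro mult_mono) auto
        finally show "\<bar>(g (Suc k) - g k) \<bullet> (\<omega> (u N) - \<omega> (u (Suc k)))\<bar> \<le> D * (C * (u (Suc k) - u k + h)) * H" .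
      qed
      also have "\<dots> = D * C * ((\<Sum>k<N. u (Suc k) - u k + h) * H)"
        by (simp add: sum_distrib_left sum_distrib_right mult.assoc)
      also have "(\<Sum>k<N. u (Suc k) - u k + h) = (u N - u 0) + real N * h"
        unfolding sum.distrib telescope by simp
      finally show ?thesis .
    qed
    moreover have "\<bar>F (u N) \<omega> - F (u N) (y N)\<bar> \<le> L * h"
    proof (rule L(2)[OF grid_in[OF order_refl] \<omega> yD[OF order_refl]])
      fix r assume r: "r \<in> {0..T}"
      have "min (u N) r \<in> {0..T}" using r grid_in[of N] by auto
      then have "norm (y N (min (u N) r) - \<omega> (min (u N) (min (u N) r))) \<le> h"
        unfolding y_def using h cell by (intro stepped_close) auto
      then show "norm (\<omega> (min (u N) r) - y N (min (u N) r)) \<le> h" by (simp add: norm_minus_commute)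
    qed
    moreover have start: "F (u 0) \<omega> = F (u 0) (y 0)" "v_grad T F (u 0) \<omega> = g 0"
      using grid_in[of 0] \<omega> by (simp_all add: y_def g_def F_stop grad_stop)
    ultimately have "\<bar>F (u N) \<omega> - F (u 0) \<omega> - v_grad T F (u 0) \<omega> \<bullet> (\<omega> (u N) - \<omega> (u 0))\<bar>
       \<le> L * h + C * (u N - u 0) + D\<^sup>2 * C * (real N * h\<^sup>2) + D * C * (((u N - u 0) + real N * h) * H)"
      unfolding start by linarith
    also have "\<dots> \<le> K * h + K * (u N - u 0) + K * (real N * h\<^sup>2) + K * (((u N - u 0) + real N * h) * H)"
      using K h H0 grid_mono[of 0 N] by (intro add_mono mult_right_mono) auto
    finally show "\<bar>F (u N) \<omega> - F (u 0) \<omega> - v_grad T F (u 0) \<omega> \<bullet> (\<omega> (u N) - \<omega> (u 0))\<bar>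
       \<le> K * (h + (u N - u 0) + real N * h\<^sup>2 + ((u N - u 0) + real N * h) * H)"
      by (simp add: algebra_simps)
  qed
qed

end

section \<open>The first order remainder along a Hoelder path\<close>

context smooth_functional begin

text \<open>
  The bound \<open>grid_remainder_bound\<close> for \<open>N\<close> equal cells of an interval of length \<open>\<Delta>\<close>, with \<open>h\<close> of order
  \<open>(\<Delta> / N)\<^sup>\<nu>\<close> and \<open>H\<close> of order \<open>\<Delta>\<^sup>\<nu>\<close>. With \<open>N\<close> of order \<open>\<Delta>\<^sup>-\<^sup>\<nu>\<close> the two leading terms \<open>h\<close> and
  \<open>N h H\<close> are both of order \<open>\<Delta>\<close> to the power \<open>\<nu> + \<nu>\<^sup>2\<close>.
\<close>

lemma Hoelder_remainder_bound:
  assumes \<omega>: "\<omega> \<in> Dpaths T" and \<nu>: "0 < \<nu>" and c: "0 \<le> c"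
    and Hoelder: "\<And>s t. s \<in> {0..T} \<Longrightarrow> t \<in> {0..T} \<Longrightarrow> norm (\<omega> t - \<omega> s) \<le> c * \<bar>t - s\<bar> powr \<nu>"
  obtains K where "K > 0" "\<And>s t. 0 \<le> s \<Longrightarrow> s < t \<Longrightarrow> t \<le> T \<Longrightarrow> t - s \<le> 1 \<Longrightarrow>
    \<bar>F t \<omega> - F s \<omega> - v_grad T F s \<omega> \<bullet> (\<omega> t - \<omega> s)\<bar> \<le> K * (t - s) powr min 1 (\<nu> + \<nu>\<^sup>2)"
proof -
  define R where "R = norm (\<omega> 0) + c * T powr \<nu>"
  have "norm (\<omega> r) \<le> R" if r: "r \<in> {0..T}" for r
  proof -
    have "c * \<bar>r - 0\<bar> powr \<nu> \<le> c * T powr \<nu>" using r c \<nu> by (intro mult_left_mono powr_mono2) auto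
    then have "norm (\<omega> r - \<omega> 0) \<le> c * T powr \<nu>" using Hoelder[of 0 r] r by simp
    then show ?thesis using norm_triangle_sub[of "\<omega> r" "\<omega> 0"] by (simp add: R_def)
  qed
  then have "\<omega> \<in> paths_in T R" using \<omega> by (simp add: paths_in_def)
  then obtain K where K: "K > 0" "\<And>u N h H. time_grid T u N \<Longrightarrow> 0 \<le> h \<Longrightarrow>
     (\<And>j r r'. j < N \<Longrightarrow> r \<in> {u j..u (Suc j)} \<Longrightarrow> r' \<in> {u j..u (Suc j)} \<Longrightarrow> norm (\<omega> r - \<omega> r') \<le> h) \<Longrightarrow>
     (\<And>r. r \<in> {u 0..u N} \<Longrightarrow> norm (\<omega> (u N) - \<omega> r) \<le> H) \<Longrightarrow>
     \<bar>F (u N) \<omega> - F (u 0) \<omega> - v_grad T F (u 0) \<omega> \<bullet> (\<omega> (u N) - \<omega> (u 0))\<bar>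
       \<le> K * (h + (u N - u 0) + real N * h\<^sup>2 + ((u N - u 0) + real N * h) * H)"
    using grid_remainder_bound by metis
  define p where "p = \<nu> + \<nu>\<^sup>2"
  define A where "A = c + 1 + 2 * c\<^sup>2 + c + 2 * c\<^sup>2"
  have "0 < A" using c by (simp add: A_def add_nonneg_pos add_pos_nonneg)
  show thesis
  proof (rule that[of "K * A"])
    show "0 < K * A" using K(1) \<open>0 < A\<close> by simp
    fix s t assume st: "0 \<le> s" "s < t" "t \<le> T" "t - s \<le> 1"
    define \<Delta> where "\<Delta> = t - s"
    have \<Delta>: "0 < \<Delta>" "\<Delta> \<le> 1" using st by (simp_all add: \<Delta>_def)
    define N where "N = nat \<lceil>\<Delta> powr (- \<nu>)\<rceil>"
    have one: "1 \<le> \<Delta> powr (- \<nu>)" using \<Delta> \<nu> powr_mono'[of "-\<nu>" 0 \<Delta>] by simp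
    have N: "\<Delta> powr (- \<nu>) \<le> N" "real N \<le> 2 * \<Delta> powr (- \<nu>)" unfolding N_def using one by linarith+
    then have N0: "0 < real N" "N \<noteq> 0" using one by auto
    define h where "h = c * (\<Delta> / N) powr \<nu>"
    define u where "u k = s + real k * (\<Delta> / N)" for k
    have u_ends: "u 0 = s" "u N = t" using N0 by (simp_all add: u_def \<Delta>_def)
    have grid: "time_grid T u N"
    proof
      have "0 < \<Delta> / N" using \<Delta> N0 by simp
      then show "u k < u (Suc k)" for k unfolding u_def of_nat_Suc distrib_right by linarith
    qed (use st in \<open>simp_all add: u_ends\<close>)
    interpret time_grid T u N by (rule grid)
    have "\<bar>F (u N) \<omega> - F (u 0) \<omega> - v_grad T F (u 0) \<omega> \<bullet> (\<omega> (u N) - \<omega> (u 0))\<bar>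
       \<le> K * (h + (u N - u 0) + real N * h\<^sup>2 + ((u N - u 0) + real N * h) * (c * \<Delta> powr \<nu>))"
    proof (rule K(2)[OF grid])
      show "0 \<le> h" using c by (simp add: h_def)
      fix j r r' assume j: "j < N" and r: "r \<in> {u j..u (Suc j)}" "r' \<in> {u j..u (Suc j)}"
      have "r \<in> {0..T}" "r' \<in> {0..T}" using r grid_in[of j] grid_in[of "Suc j"] j by auto
      moreover have "u (Suc j) - u j = \<Delta> / N" by (simp add: u_def algebra_simps add_divide_distrib)
      then have "\<bar>r - r'\<bar> \<le> \<Delta> / N" using r by auto
      then have "c * \<bar>r - r'\<bar> powr \<nu> \<le> h"
        unfolding h_def using c \<nu> by (intro mult_left_mono powr_mono2) auto
      ultimately show "norm (\<omega> r - \<omega> r') \<le> h" using Hoelder[of r' r] by simp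
    next
      fix r assume r: "r \<in> {u 0..u N}"
      then have "c * \<bar>t - r\<bar> powr \<nu> \<le> c * \<Delta> powr \<nu>"
        using c \<nu> by (intro mult_left_mono powr_mono2) (auto simp: u_ends \<Delta>_def)
      moreover have "r \<in> {0..T}" "t \<in> {0..T}" using r st by (auto simp: u_ends)
      ultimately show "norm (\<omega> (u N) - \<omega> r) \<le> c * \<Delta> powr \<nu>"
        using Hoelder[of r t] by (simp add: u_ends)
    qed
    then have main: "\<bar>F t \<omega> - F s \<omega> - v_grad T F s \<omega> \<bullet> (\<omega> t - \<omega> s)\<bar>
       \<le> K * (h + \<Delta> + real N * h\<^sup>2 + (\<Delta> + real N * h) * (c * \<Delta> powr \<nu>))"
      by (simp add: u_ends \<Delta>_def)
    define a where "a = \<Delta> powr p"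
    have h: "h \<le> c * a"
    proof -
      have "\<Delta> / N \<le> \<Delta> / \<Delta> powr (- \<nu>)" using N(1) \<Delta> N0 by (intro divide_left_mono mult_pos_pos) auto
      also have "\<dots> = \<Delta> powr (1 + \<nu>)" using \<Delta> by (simp add: powr_minus powr_add divide_inverse)
      finally have "(\<Delta> / N) powr \<nu> \<le> (\<Delta> powr (1 + \<nu>)) powr \<nu>"
        using \<Delta> \<nu> by (intro powr_mono2) auto
      also have "\<dots> = a" by (simp add: powr_powr a_def p_def power2_eq_square algebra_simps)
      finally show ?thesis unfolding h_def using c by (rule mult_left_mono)
    qed
    have h0: "0 \<le> h" using c by (simp add: h_def)
    have \<Delta>\<nu>: "\<Delta> powr \<nu> \<le> 1" "\<Delta> powr \<nu>\<^sup>2 \<le> 1"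
      using \<Delta> \<nu> powr_le1[of \<nu> \<Delta>] powr_le1[of "\<nu>\<^sup>2" \<Delta>] by auto
    have Nh: "real N * h \<le> 2 * c * \<Delta> powr \<nu>\<^sup>2"
    proof -
      have "real N * h \<le> (2 * \<Delta> powr (- \<nu>)) * (c * a)" using N h h0 c by (intro mult_mono) auto
      also have "\<dots> = 2 * c * (\<Delta> powr (- \<nu>) * \<Delta> powr p)" by (simp add: a_def)
      also have "\<Delta> powr (- \<nu>) * \<Delta> powr p = \<Delta> powr \<nu>\<^sup>2" by (simp add: p_def flip: powr_add)
      finally show ?thesis .
    qed
    have "real N * h * (c * \<Delta> powr \<nu>) \<le> (2 * c * \<Delta> powr \<nu>\<^sup>2) * (c * \<Delta> powr \<nu>)"
      using Nh c by (intro mult_right_mono) auto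
    also have "\<dots> = 2 * c\<^sup>2 * a" by (simp add: a_def p_def powr_add power2_eq_square)
    finally have Nh1: "real N * h * (c * \<Delta> powr \<nu>) \<le> 2 * c\<^sup>2 * a" .
    have "real N * h\<^sup>2 = (real N * h) * h" by (simp add: power2_eq_square)
    also have "\<dots> \<le> (2 * c * 1) * (c * a)"
    proof (rule mult_mono)
      have "2 * c * \<Delta> powr \<nu>\<^sup>2 \<le> 2 * c * 1" using \<Delta>\<nu>(2) c by (intro mult_left_mono) auto
      then show "real N * h \<le> 2 * c * 1" using Nh by linarith
    qed (use h h0 c in auto)
    also have "\<dots> = 2 * c\<^sup>2 * a" by (simp add: power2_eq_square)
    finally have Nh2: "real N * h\<^sup>2 \<le> 2 * c\<^sup>2 * a" .
    have "\<Delta> * (c * \<Delta> powr \<nu>) \<le> \<Delta> * (c * 1)"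
      using \<Delta>\<nu>(1) \<Delta> c by (intro mult_left_mono) auto
    then have "h + \<Delta> + real N * h\<^sup>2 + (\<Delta> + real N * h) * (c * \<Delta> powr \<nu>) \<le>
        c * a + \<Delta> + 2 * c\<^sup>2 * a + c * \<Delta> + 2 * c\<^sup>2 * a"
      using h Nh1 Nh2 unfolding distrib_right mult_1_right mult.commute[of c \<Delta>] by linarith
    also have "\<dots> \<le> A * \<Delta> powr min 1 p"
    proof -
      have "a \<le> \<Delta> powr min 1 p" "\<Delta> \<le> \<Delta> powr min 1 p"
        using powr_mono'[of "min 1 p" p \<Delta>] powr_mono'[of "min 1 p" 1 \<Delta>] \<Delta> by (simp_all add: a_def)
      then have "c * a + \<Delta> + 2 * c\<^sup>2 * a + c * \<Delta> + 2 * c\<^sup>2 * a \<le> c * \<Delta> powr min 1 p + \<Delta> powr min 1 p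
          + 2 * c\<^sup>2 * \<Delta> powr min 1 p + c * \<Delta> powr min 1 p + 2 * c\<^sup>2 * \<Delta> powr min 1 p"
        using c by (intro add_mono mult_left_mono) auto
      then show ?thesis by (simp add: A_def distrib_right)
    qed
    finally have "h + \<Delta> + real N * h\<^sup>2 + (\<Delta> + real N * h) * (c * \<Delta> powr \<nu>) \<le> A * \<Delta> powr min 1 p" .
    then have "K * (h + \<Delta> + real N * h\<^sup>2 + (\<Delta> + real N * h) * (c * \<Delta> powr \<nu>)) \<le> K * (A * \<Delta> powr min 1 p)"
      using K(1) by simp
    with main show "\<bar>F t \<omega> - F s \<omega> - v_grad T F s \<omega> \<bullet> (\<omega> t - \<omega> s)\<bar> \<le> K * A * (t - s) powr min 1 (\<nu> + \<nu>\<^sup>2)"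
      by (simp add: \<Delta>_def p_def mult.assoc)
  qed
qed

end

section \<open>Quadratic sums along the partitions\<close>

context time_grid begin

text \<open>
  At most one cell contains \<open>t\<close> in its interior or at its left end, so counting the cells up to \<open>t\<close> by
  their left or by their right ends makes a difference of at most one summand.
\<close>

lemma straddling_cell_sum:
  fixes f :: "nat \<Rightarrow> real"
  assumes E: "0 \<le> E" and f: "\<And>i. i < N \<Longrightarrow> \<bar>f i\<bar> \<le> E"
    and A: "{i. i < N \<and> u (Suc i) \<le> t} \<subseteq> A" "A \<subseteq> {i. i < N \<and> u i \<le> t}"
  shows "\<bar>sum f A - (\<Sum>i | i < N \<and> u (Suc i) \<le> t. f i)\<bar> \<le> E"
proof -
  define B where "B = {i. i < N \<and> u (Suc i) \<le> t}"
  have "finite A" by (rule finite_subset[OF A(2)]) simp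
  then have "sum f A - sum f B = sum f (A - B)" using A(1) by (simp add: sum_diff B_def)
  moreover have "\<bar>sum f (A - B)\<bar> \<le> E"
  proof (cases "A - B = {}")
    case False
    then obtain i where i: "i \<in> A - B" by blast
    have "j = i" if j: "j \<in> A - B" for j
    proof (rule ccontr)
      assume "j \<noteq> i"
      then consider "Suc i \<le> j" | "Suc j \<le> i" by linarith
      then show False using i j A(2) grid_mono[of "Suc i" j] grid_mono[of "Suc j" i]
        by cases (auto simp: B_def)
    qed
    then have "A - B = {i}" using i by blast
    then show ?thesis using f[of i] i A(2) by auto
  next
    case True
    show ?thesis using E by (simp only: True sum.empty abs_zero)
  qed
  ultimately show ?thesis by (simp add: B_def)
qed

end

text \<open>
  A continuous path has no jumps, so its quadratic variation coincides with the continuous part.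
\<close>

lemma Q1_continuous_facts:
  assumes T: "0 < T" and part: "partitions T m \<tau>" and x: "x \<in> Q1 T m \<tau>" and cont: "continuous_on {0..T} x"
  shows "continuous_on {0..T} (qv m \<tau> x)" "qv m \<tau> x 0 = 0"
    "\<And>t. t \<in> {0..T} \<Longrightarrow> qv_sum m \<tau> x t \<longlonglongrightarrow> qv m \<tau> x t"
proof -
  show lim: "qv_sum m \<tau> x t \<longlonglongrightarrow> qv m \<tau> x t" if "t \<in> {0..T}" for t
    using x that by (auto simp: Q1_def qv_def convergent_LIMSEQ_iff)
  obtain c where c: "continuous_on {0..T} c"
    "\<And>t. t \<in> {0..T} \<Longrightarrow> ((\<lambda>s. (x s - left_value x s)\<^sup>2) has_sum (qv m \<tau> x t - c t)) {0<..t}"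
    using x unfolding Q1_def by blast
  have left: "left_value x s = x s" if s: "s \<in> {0<..T}" for s
  proof -
    have "(x \<longlongrightarrow> x s) (at s within {0..T})" using cont s by (auto simp: continuous_on_def)
    then have "(x \<longlongrightarrow> x s) (at s within {0..s})" by (rule tendsto_within_subset) (use s in auto)
    then have "(x \<longlongrightarrow> x s) (at_left s)" using s at_within_Icc_at_left[of 0 s] by auto
    then show ?thesis using s by (simp add: left_value_def tendsto_Lim)
  qed
  have "qv m \<tau> x t = c t" if t: "t \<in> {0..T}" for t
  proof -
    have "((\<lambda>s. (x s - left_value x s)\<^sup>2) has_sum 0) {0<..t}"
      using t left by (intro has_sum_0) auto
    then have "0 = qv m \<tau> x t - c t" using c(2)[OF t] by (rule has_sum_unique)
    then show ?thesis by simp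
  qed
  then show "continuous_on {0..T} (qv m \<tau> x)" using c(1) by (subst continuous_on_cong[OF refl]) auto
  have "qv_sum m \<tau> x 0 n = 0" for n
  proof -
    have *: "time_grid T (\<tau> n) (m n)" using part T by (unfold_locales) (auto simp: partitions_def)
    have "0 < \<tau> n (Suc i)" if "i < m n" for i
      using time_grid.grid_in[OF *, of i] time_grid.grid_Suc[OF * that] that by auto
    then have "{i. i < m n \<and> \<tau> n (Suc i) \<le> 0} = {}" by force
    then show ?thesis by (simp only: qv_sum_def sum.empty)
  qed
  then have "qv_sum m \<tau> x 0 = (\<lambda>n. 0)" by (rule ext)
  then have "qv_sum m \<tau> x 0 \<longlonglongrightarrow> 0" by simp
  then show "qv m \<tau> x 0 = 0" using lim[of 0] T by (auto intro: LIMSEQ_unique)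
qed

text \<open>
  The setting of the Ito formula. The Hoelder condition enters separately, in the remainder estimate.
\<close>

locale partitioned_path = smooth_functional T F for T and F :: "'d::finite fnl" +
  fixes m :: "nat \<Rightarrow> nat" and \<tau> :: "nat \<Rightarrow> nat \<Rightarrow> real" and \<omega> :: "real \<Rightarrow> real^'d"
  assumes part: "partitions T m \<tau>" and \<omega>_Q: "\<omega> \<in> Q T m \<tau>"
    and \<omega>_cont: "continuous_on {0..T} \<omega>" and osc: "osc m \<tau> \<omega> \<longlonglongrightarrow> 0"
begin

sublocale grid: time_grid T "\<tau> n" "m n" for n
  using part by unfold_locales (auto simp: partitions_def)

lemma cell_ends: "k < m n \<Longrightarrow> \<tau> n k \<in> {0..T}" "k < m n \<Longrightarrow> \<tau> n (Suc k) \<in> {0..T}"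
  using grid.grid_in[of k n] grid.grid_in[of "Suc k" n] by simp_all

lemma \<tau>_ends: "\<tau> n 0 = 0" "\<tau> n (m n) = T" using part by (auto simp: partitions_def)

lemma m_pos: "0 < m n" using \<tau>_ends[of n] T by (cases "m n") auto

lemma \<omega>_D: "\<omega> \<in> Dpaths T"
  using \<omega>_Q \<omega>_cont by (intro continuous_Dpaths) (auto simp: Q_def)

lemma \<omega>_bounded: "\<exists>R. \<omega> \<in> paths_in T R"
proof -
  have "bounded (\<omega> ` {0..T})" by (intro compact_imp_bounded compact_continuous_image \<omega>_cont) simp
  then obtain R where "\<forall>r\<in>{0..T}. norm (\<omega> r) \<le> R" unfolding bounded_iff by blast
  then show ?thesis using \<omega>_D by (auto simp: paths_in_def)
qed

text \<open>
  Twice the oscillation bounds the distance of any two values of \<open>\<omega>\<close> within one cell. It is the small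
  parameter of all estimates below.
\<close>

definition cell_osc :: "nat \<Rightarrow> real" where "cell_osc n = 2 * osc m \<tau> \<omega> n"

lemma cell_osc_tendsto_0: "cell_osc \<longlonglongrightarrow> 0"
  unfolding cell_osc_def using tendsto_mult_left[OF osc, of 2] by simp

lemma cell_close_left: "k < m n \<Longrightarrow> r \<in> {\<tau> n k..\<tau> n (Suc k)} \<Longrightarrow> norm (\<omega> r - \<omega> (\<tau> n k)) \<le> osc m \<tau> \<omega> n"
proof -
  assume k: "k < m n" and r: "r \<in> {\<tau> n k..\<tau> n (Suc k)}"
  define f where "f j = (SUP t\<in>{\<tau> n j<..\<tau> n (Suc j)}. norm (\<omega> t - \<omega> (\<tau> n j)))" for j
  have f: "norm (\<omega> s - \<omega> (\<tau> n k)) \<le> f k" if s: "s \<in> {\<tau> n k<..\<tau> n (Suc k)}" for s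
    unfolding f_def
  proof (rule cSUP_upper[OF s])
    have "continuous_on {\<tau> n k..\<tau> n (Suc k)} \<omega>"
      using grid.grid_in[of k n] grid.grid_in[of "Suc k" n] k by (intro continuous_on_subset[OF \<omega>_cont]) auto
    then have "bounded ((\<lambda>t. norm (\<omega> t - \<omega> (\<tau> n k))) ` {\<tau> n k..\<tau> n (Suc k)})"
      by (intro compact_imp_bounded compact_continuous_image continuous_intros) auto
    then show "bdd_above ((\<lambda>t. norm (\<omega> t - \<omega> (\<tau> n k))) ` {\<tau> n k<..\<tau> n (Suc k)})"
      by (intro bounded_imp_bdd_above) (auto elim: bounded_subset)
  qed
  have "f k \<le> osc m \<tau> \<omega> n" unfolding osc_def f_def[symmetric] using k by (intro Max_ge) auto
  moreover have "0 \<le> f k" using f[of "\<tau> n (Suc k)"] grid.grid_Suc[OF k] order.trans[OF norm_ge_zero] by auto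
  ultimately show ?thesis using f[of r] r by (cases "r = \<tau> n k") auto
qed

lemma cell_osc_nonneg: "0 \<le> cell_osc n"
proof -
  have "\<tau> n 0 \<in> {\<tau> n 0..\<tau> n (Suc 0)}" using grid.grid_Suc[OF m_pos[of n]] by simp
  from cell_close_left[OF m_pos this] show ?thesis by (simp add: cell_osc_def)
qed

lemma cell_close:
  assumes "k < m n" "r \<in> {\<tau> n k..\<tau> n (Suc k)}" "r' \<in> {\<tau> n k..\<tau> n (Suc k)}"
  shows "norm (\<omega> r - \<omega> r') \<le> cell_osc n"
  using norm_triangle_ineq4[of "\<omega> r - \<omega> (\<tau> n k)" "\<omega> r' - \<omega> (\<tau> n k)"]
    cell_close_left[OF assms(1,2)] cell_close_left[OF assms(1,3)] by (simp add: cell_osc_def)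

definition \<delta> :: "nat \<Rightarrow> nat \<Rightarrow> real^'d" where "\<delta> n k = \<omega> (\<tau> n (Suc k)) - \<omega> (\<tau> n k)"

lemma \<delta>_le: "k < m n \<Longrightarrow> norm (\<delta> n k) \<le> cell_osc n"
  unfolding \<delta>_def using grid.grid_Suc[of k n] by (intro cell_close) auto

lemma \<delta>_comp_le: "k < m n \<Longrightarrow> \<bar>\<delta> n k $ i\<bar> \<le> cell_osc n"
  using order.trans[OF component_le_norm_cart \<delta>_le] .

text \<open>
  The sums \<open>qv_sum\<close> attach a squared increment to the right end of its cell, whereas the weights are
  controlled at the left end. Moving the atoms changes the distribution functions by at most one
  summand.
\<close>

lemma quadratic_sums:
  fixes x h :: "real \<Rightarrow> real" and H :: "nat \<Rightarrow> nat \<Rightarrow> real"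
  assumes x: "x \<in> Q1 T m \<tau>" and x_cont: "continuous_on {0..T} x" and a: "0 \<le> a"
    and x_inc: "\<And>n k. k < m n \<Longrightarrow> \<bar>x (\<tau> n (Suc k)) - x (\<tau> n k)\<bar> \<le> a * cell_osc n"
    and W: "left_limit_weights T C m \<tau> H h"
  shows "set_integrable (qv_measure T m \<tau> x) {0..T} h"
    and "(\<lambda>n. \<Sum>k<m n. H n k * (x (\<tau> n (Suc k)) - x (\<tau> n k))\<^sup>2) \<longlonglongrightarrow> (LINT s:{0..T}|qv_measure T m \<tau> x. h s)"
proof -
  define w where "w n k = (x (\<tau> n (Suc k)) - x (\<tau> n k))\<^sup>2" for n k
  have w_le: "\<bar>w n k\<bar> \<le> (a * cell_osc n)\<^sup>2" if "k < m n" for n k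
    using power_mono[OF x_inc[OF that] abs_ge_zero, of 2] by (simp add: w_def)
  note facts = Q1_continuous_facts[OF T part x x_cont]
  have "(\<lambda>n. \<Sum>i | i < m n \<and> \<tau> n i \<le> t. w n i) \<longlonglongrightarrow> qv m \<tau> x t" if t: "t \<in> {0..T}" for t
  proof -
    have "(\<lambda>n. (a * cell_osc n)\<^sup>2) \<longlonglongrightarrow> (a * 0)\<^sup>2" by (intro tendsto_intros cell_osc_tendsto_0)
    then have "(\<lambda>n. (a * cell_osc n)\<^sup>2) \<longlonglongrightarrow> 0" by simp
    then have "(\<lambda>n. (\<Sum>i | i < m n \<and> \<tau> n i \<le> t. w n i) - qv_sum m \<tau> x t n) \<longlonglongrightarrow> 0"
    proof (rule Lim_null_comparison[rotated], intro always_eventually allI)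
      fix n
      show "norm ((\<Sum>i | i < m n \<and> \<tau> n i \<le> t. w n i) - qv_sum m \<tau> x t n) \<le> (a * cell_osc n)\<^sup>2"
        using grid.straddling_cell_sum[of "(a * cell_osc n)\<^sup>2" n "w n" t "{i. i < m n \<and> \<tau> n i \<le> t}"] w_le[of _ n]
          grid.grid_Suc[of _ n] by (force simp: qv_sum_def w_def)
    qed
    from tendsto_add[OF this facts(3)[OF t]] show ?thesis by simp
  qed
  note * = weighted_sums_tendsto_Stieltjes[where v = \<tau> and w = w, OF T facts(1,2) _ _ this W]
  show "set_integrable (qv_measure T m \<tau> x) {0..T} h"
    unfolding qv_measure_def using grid.grid_in by (intro *(1)) (auto simp: w_def)
  show "(\<lambda>n. \<Sum>k<m n. H n k * (x (\<tau> n (Suc k)) - x (\<tau> n k))\<^sup>2) \<longlonglongrightarrow> (LINT s:{0..T}|qv_measure T m \<tau> x. h s)"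
    unfolding qv_measure_def w_def[symmetric] using grid.grid_in by (intro *(2)) (auto simp: w_def)
qed

lemma \<omega>_components:
  "(\<lambda>t. \<omega> t $ i) \<in> Q1 T m \<tau>" "(\<lambda>t. \<omega> t $ i + \<omega> t $ j) \<in> Q1 T m \<tau>"
  "continuous_on {0..T} (\<lambda>t. \<omega> t $ i)" "continuous_on {0..T} (\<lambda>t. \<omega> t $ i + \<omega> t $ j)"
  using \<omega>_Q by (auto simp: Q_def intro!: continuous_intros \<omega>_cont)

text \<open>
  Polarization of \<open>quadratic_sums\<close>, matching the definition of \<open>qcov_integral\<close>.
\<close>

lemma covariation_sums:
  fixes h :: "real \<Rightarrow> real" and H :: "nat \<Rightarrow> nat \<Rightarrow> real"
  assumes W: "left_limit_weights T C m \<tau> H h"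
  shows "qcov_integrable T m \<tau> \<omega> i j h"
    and "(\<lambda>n. \<Sum>k<m n. H n k * (\<delta> n k $ i * \<delta> n k $ j)) \<longlonglongrightarrow> qcov_integral T m \<tau> \<omega> i j h"
proof -
  have inc1: "\<bar>\<omega> (\<tau> n (Suc k)) $ l - \<omega> (\<tau> n k) $ l\<bar> \<le> 1 * cell_osc n" if "k < m n" for n k l
    using \<delta>_comp_le[OF that, of l] by (simp add: \<delta>_def)
  have inc2: "\<bar>(\<omega> (\<tau> n (Suc k)) $ i + \<omega> (\<tau> n (Suc k)) $ j) - (\<omega> (\<tau> n k) $ i + \<omega> (\<tau> n k) $ j)\<bar> \<le> 2 * cell_osc n"
    if "k < m n" for n k
    using inc1[OF that, of i] inc1[OF that, of j] by linarith
  note 1 = quadratic_sums[OF \<omega>_components(1) \<omega>_components(3) zero_le_one inc1 W]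
  note 2 = quadratic_sums[OF \<omega>_components(2) \<omega>_components(4) zero_le_numeral inc2 W]
  show "qcov_integrable T m \<tau> \<omega> i j h"
    unfolding qcov_integrable_def using 1(1) 2(1) by blast
  have "(\<lambda>n. ((\<Sum>k<m n. H n k * ((\<omega> (\<tau> n (Suc k)) $ i + \<omega> (\<tau> n (Suc k)) $ j) - (\<omega> (\<tau> n k) $ i + \<omega> (\<tau> n k) $ j))\<^sup>2)
      - (\<Sum>k<m n. H n k * (\<omega> (\<tau> n (Suc k)) $ i - \<omega> (\<tau> n k) $ i)\<^sup>2)
      - (\<Sum>k<m n. H n k * (\<omega> (\<tau> n (Suc k)) $ j - \<omega> (\<tau> n k) $ j)\<^sup>2)) / 2)
    \<longlonglongrightarrow> qcov_integral T m \<tau> \<omega> i j h"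
    unfolding qcov_integral_def by (intro tendsto_intros 1(2) 2(2)) auto
  moreover have "((\<Sum>k<m n. H n k * ((\<omega> (\<tau> n (Suc k)) $ i + \<omega> (\<tau> n (Suc k)) $ j) - (\<omega> (\<tau> n k) $ i + \<omega> (\<tau> n k) $ j))\<^sup>2)
      - (\<Sum>k<m n. H n k * (\<omega> (\<tau> n (Suc k)) $ i - \<omega> (\<tau> n k) $ i)\<^sup>2)
      - (\<Sum>k<m n. H n k * (\<omega> (\<tau> n (Suc k)) $ j - \<omega> (\<tau> n k) $ j)\<^sup>2)) / 2
      = (\<Sum>k<m n. H n k * (\<delta> n k $ i * \<delta> n k $ j))" for n
    unfolding sum_subtractf[symmetric] sum_divide_distrib
    by (intro sum.cong refl) (simp add: \<delta>_def power2_eq_square field_simps)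
  ultimately show "(\<lambda>n. \<Sum>k<m n. H n k * (\<delta> n k $ i * \<delta> n k $ j)) \<longlonglongrightarrow> qcov_integral T m \<tau> \<omega> i j h"
    by simp
qed

text \<open>
  The version for an earlier terminal time \<open>t\<close>. Weights and limit are cut off at \<open>t\<close>, the weights by
  \<open>\<tau> n k < t\<close>, which keeps the left limits intact also at \<open>s = t\<close>; the sum up to \<open>t\<close> differs in at most
  one summand.
\<close>

lemma covariation_sums_upto:
  fixes h :: "real \<Rightarrow> real" and H :: "nat \<Rightarrow> nat \<Rightarrow> real"
  assumes W: "left_limit_weights T C m \<tau> H h"
  shows "convergent (\<lambda>n. \<Sum>k | k < m n \<and> \<tau> n (Suc k) \<le> t. H n k * (\<delta> n k $ i * \<delta> n k $ j))"
proof -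
  note hC = left_limit_weightsD(1)[OF W] and HC = left_limit_weightsD(2)[OF W]
    and h_lim = left_limit_weightsD(3)[OF W] and H_lim = left_limit_weightsD(4)[OF W]
  have C: "0 \<le> C" using hC[of 0] T by simp
  define h' where "h' s = (if s \<le> t then h s else 0)" for s
  define H' where "H' n k = (if \<tau> n k < t then H n k else 0)" for n k
  have "(\<lambda>n. \<Sum>k<m n. H' n k * (\<delta> n k $ i * \<delta> n k $ j)) \<longlonglongrightarrow> qcov_integral T m \<tau> \<omega> i j h'"
  proof (rule covariation_sums(2)[OF left_limit_weightsI])
    show "\<bar>h' u\<bar> \<le> C" if "u \<in> {0..T}" for u using hC[OF that] C by (simp add: h'_def)
    show "\<bar>H' n i\<bar> \<le> C" if "i < m n" for n i using HC[OF that] C by (simp add: H'_def)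
    fix s \<epsilon> :: real assume s: "s \<in> {0<..T}" and "\<epsilon> > 0"
    show "\<exists>\<eta>>0. \<forall>u\<in>{0..T}. s - \<eta> \<le> u \<and> u < s \<longrightarrow> \<bar>h' u - h' s\<bar> \<le> \<epsilon>"
    proof (cases "s \<le> t")
      case True
      then show ?thesis using h_lim[OF s \<open>\<epsilon> > 0\<close>] by (simp add: h'_def)
    next
      case False
      then show ?thesis using \<open>\<epsilon> > 0\<close> by (intro exI[of _ "(s - t) / 2"]) (auto simp: h'_def field_simps)
    qed
    show "\<exists>\<eta>>0. \<exists>N. \<forall>n\<ge>N. \<forall>i<m n. s - \<eta> \<le> \<tau> n i \<and> \<tau> n i < s \<longrightarrow> \<bar>H' n i - h' s\<bar> \<le> \<epsilon>"
    proof (cases "s \<le> t")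
      case True
      then have "\<tau> n i < t" if "\<tau> n i < s" for n i using that by simp
      then show ?thesis using H_lim[OF s \<open>\<epsilon> > 0\<close>] True by (simp add: h'_def H'_def cong: conj_cong)
    next
      case False
      then show ?thesis using \<open>\<epsilon> > 0\<close>
        by (intro exI[of _ "(s - t) / 2"]) (auto simp: h'_def H'_def field_simps)
    qed
  qed
  moreover have "(\<lambda>n. (\<Sum>k<m n. H' n k * (\<delta> n k $ i * \<delta> n k $ j)) -
      (\<Sum>k | k < m n \<and> \<tau> n (Suc k) \<le> t. H n k * (\<delta> n k $ i * \<delta> n k $ j))) \<longlonglongrightarrow> 0"
  proof (rule Lim_null_comparison, intro always_eventually allI)
    fix n
    define f where "f k = H n k * (\<delta> n k $ i * \<delta> n k $ j)" for k
    have f: "\<bar>f k\<bar> \<le> C * (cell_osc n * cell_osc n)" if "k < m n" for k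
      unfolding f_def abs_mult using HC[OF that] \<delta>_comp_le[OF that] cell_osc_nonneg[of n] C
      by (intro mult_mono) auto
    have "(\<Sum>k<m n. H' n k * (\<delta> n k $ i * \<delta> n k $ j)) = (\<Sum>k<m n. if \<tau> n k < t then f k else 0)"
      by (intro sum.cong) (auto simp: H'_def f_def)
    also have "\<dots> = sum f {k. k < m n \<and> \<tau> n k < t}"
      by (simp add: sum.If_cases Int_def)
    finally have eq: "(\<Sum>k<m n. H' n k * (\<delta> n k $ i * \<delta> n k $ j)) = sum f {k. k < m n \<and> \<tau> n k < t}" .
    have "\<bar>sum f {k. k < m n \<and> \<tau> n k < t} - (\<Sum>k | k < m n \<and> \<tau> n (Suc k) \<le> t. f k)\<bar> \<le> C * (cell_osc n * cell_osc n)"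
      using f C cell_osc_nonneg[of n] grid.grid_Suc[of _ n] by (intro grid.straddling_cell_sum) (auto intro: less_le_trans)
    then show "norm ((\<Sum>k<m n. H' n k * (\<delta> n k $ i * \<delta> n k $ j)) -
        (\<Sum>k | k < m n \<and> \<tau> n (Suc k) \<le> t. H n k * (\<delta> n k $ i * \<delta> n k $ j))) \<le> C * (cell_osc n * cell_osc n)"
      unfolding eq f_def by simp
  next
    have "(\<lambda>n. C * (cell_osc n * cell_osc n)) \<longlonglongrightarrow> C * (0 * 0)" by (intro tendsto_intros cell_osc_tendsto_0)
    then show "(\<lambda>n. C * (cell_osc n * cell_osc n)) \<longlonglongrightarrow> 0" by simp
  qed
  ultimately have "(\<lambda>n. (\<Sum>k<m n. H' n k * (\<delta> n k $ i * \<delta> n k $ j)) - ((\<Sum>k<m n. H' n k * (\<delta> n k $ i * \<delta> n k $ j)) -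
      (\<Sum>k | k < m n \<and> \<tau> n (Suc k) \<le> t. H n k * (\<delta> n k $ i * \<delta> n k $ j)))) \<longlonglongrightarrow> qcov_integral T m \<tau> \<omega> i j h' - 0"
    by (rule tendsto_diff)
  then show ?thesis by (auto simp: convergent_def)
qed

text \<open>
  Left continuity in a form in which the perturbed path is compared with \<open>\<omega>\<close> stopped at the same
  earlier time \<open>t\<close>; the rest of the distance is controlled by the uniform continuity of \<open>\<omega>\<close>.
\<close>

lemma left_limit:
  assumes G: "left_continuous T G" and s: "s \<in> {0<..T}" and "\<epsilon> > 0"
  obtains \<eta> where "\<eta> > 0" "\<And>t y. t \<in> {0..T} \<Longrightarrow> s - \<eta> \<le> t \<Longrightarrow> t < s \<Longrightarrow> y \<in> Dpaths T \<Longrightarrow> stop T t y = y \<Longrightarrow>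
    (\<And>r. r \<in> {0..T} \<Longrightarrow> norm (y r - \<omega> (min t r)) \<le> \<eta>) \<Longrightarrow> \<bar>G t y - G s \<omega>\<bar> \<le> \<epsilon>"
proof -
  have s': "s \<in> {0..T}" using s by auto
  obtain \<eta> where \<eta>: "\<eta> > 0"
    "\<And>t' y. t' \<in> {0..T} \<Longrightarrow> y \<in> Dpaths T \<Longrightarrow> stop T t' y = y \<Longrightarrow> t' < s \<Longrightarrow>
      sup_dist T (stop T s \<omega>) y + (s - t') < \<eta> \<Longrightarrow> \<bar>G s \<omega> - G t' y\<bar> < \<epsilon>"
    using left_continuousD[OF G \<omega>_D s' \<open>\<epsilon> > 0\<close>] by blast
  have "uniformly_continuous_on {0..T} \<omega>" by (rule compact_uniformly_continuous[OF \<omega>_cont]) simp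
  then obtain d where d: "d > 0" "\<And>x x'. x \<in> {0..T} \<Longrightarrow> x' \<in> {0..T} \<Longrightarrow> dist x' x < d \<Longrightarrow> dist (\<omega> x') (\<omega> x) < \<eta> / 4"
    using \<eta>(1) unfolding uniformly_continuous_on_def by (metis zero_less_divide_iff zero_less_numeral)
  define \<eta>' where "\<eta>' = min (d / 2) (\<eta> / 4)"
  show thesis
  proof (rule that[of \<eta>'])
    show "\<eta>' > 0" using d(1) \<eta>(1) by (simp add: \<eta>'_def)
    fix t y assume t: "t \<in> {0..T}" "s - \<eta>' \<le> t" "t < s" and y: "y \<in> Dpaths T" "stop T t y = y"
      "\<And>r. r \<in> {0..T} \<Longrightarrow> norm (y r - \<omega> (min t r)) \<le> \<eta>'"
    have "sup_dist T (stop T s \<omega>) y \<le> \<eta> / 2"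
    proof (rule sup_dist_le)
      fix r assume r: "r \<in> {0..T}"
      have "dist (min s r) (min t r) < d" using t d(1) by (auto simp: dist_real_def \<eta>'_def)
      then have "dist (\<omega> (min s r)) (\<omega> (min t r)) < \<eta> / 4" using r t s' by (intro d(2)) auto
      moreover have "dist (\<omega> (min t r)) (y r) \<le> \<eta> / 4"
        using y(3)[OF r] by (simp add: dist_norm norm_minus_commute \<eta>'_def)
      ultimately show "dist (stop T s \<omega> r) (y r) \<le> \<eta> / 2"
        using dist_triangle[of "\<omega> (min s r)" "y r" "\<omega> (min t r)"] r by (simp add: stop_apply)
    qed (use T y \<omega>_D s' stop_Dpaths in auto)
    moreover have "s - t \<le> \<eta> / 4" using t(2) by (simp add: \<eta>'_def)
    ultimately have "\<bar>G s \<omega> - G t y\<bar> < \<epsilon>" using t y \<eta>(1) by (intro \<eta>(2)) auto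
    then show "\<bar>G t y - G s \<omega>\<bar> \<le> \<epsilon>" by (simp add: abs_minus_commute)
  qed
qed

lemma left_limit_along_path:
  assumes G: "left_continuous T G" and s: "s \<in> {0<..T}" and "\<epsilon> > 0"
  shows "\<exists>\<eta>>0. \<forall>u\<in>{0..T}. s - \<eta> \<le> u \<and> u < s \<longrightarrow> \<bar>G u \<omega> - G s \<omega>\<bar> \<le> \<epsilon>"
proof -
  obtain \<eta> where \<eta>: "\<eta> > 0" "\<And>t y. t \<in> {0..T} \<Longrightarrow> s - \<eta> \<le> t \<Longrightarrow> t < s \<Longrightarrow> y \<in> Dpaths T \<Longrightarrow> stop T t y = y \<Longrightarrow>
    (\<And>r. r \<in> {0..T} \<Longrightarrow> norm (y r - \<omega> (min t r)) \<le> \<eta>) \<Longrightarrow> \<bar>G t y - G s \<omega>\<bar> \<le> \<epsilon>"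
    using left_limit[OF assms] by blast
  have "\<bar>G u \<omega> - G s \<omega>\<bar> \<le> \<epsilon>" if u: "u \<in> {0..T}" "s - \<eta> \<le> u" "u < s" for u
  proof -
    have "\<bar>G u (stop T u \<omega>) - G s \<omega>\<bar> \<le> \<epsilon>"
      using u \<eta>(1) \<omega>_D by (intro \<eta>(2) stop_Dpaths) (auto simp: stop_apply stop_stop)
    then show ?thesis using G u(1) \<omega>_D by (simp add: left_continuous_def nonanticipative_def)
  qed
  then show ?thesis using \<eta>(1) by blast
qed

lemma left_limit_along_grid:
  assumes G: "left_continuous T G" and s: "s \<in> {0<..T}" and "\<epsilon> > 0"
    and z: "\<And>n i. i < m n \<Longrightarrow> z n i \<in> Dpaths T" "\<And>n i. i < m n \<Longrightarrow> stop T (\<tau> n i) (z n i) = z n i"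
      "\<And>n i r. i < m n \<Longrightarrow> r \<in> {0..T} \<Longrightarrow> norm (z n i r - \<omega> (min (\<tau> n i) r)) \<le> a * cell_osc n"
  shows "\<exists>\<eta>>0. \<exists>N. \<forall>n\<ge>N. \<forall>i<m n. s - \<eta> \<le> \<tau> n i \<and> \<tau> n i < s \<longrightarrow> \<bar>G (\<tau> n i) (z n i) - G s \<omega>\<bar> \<le> \<epsilon>"
proof -
  obtain \<eta> where \<eta>: "\<eta> > 0" "\<And>t y. t \<in> {0..T} \<Longrightarrow> s - \<eta> \<le> t \<Longrightarrow> t < s \<Longrightarrow> y \<in> Dpaths T \<Longrightarrow> stop T t y = y \<Longrightarrow>
    (\<And>r. r \<in> {0..T} \<Longrightarrow> norm (y r - \<omega> (min t r)) \<le> \<eta>) \<Longrightarrow> \<bar>G t y - G s \<omega>\<bar> \<le> \<epsilon>"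
    using left_limit[OF assms(1-3)] by blast
  have "(\<lambda>n. a * cell_osc n) \<longlonglongrightarrow> 0" using tendsto_mult_left[OF cell_osc_tendsto_0, of a] by simp
  then have "\<forall>\<^sub>F n in sequentially. a * cell_osc n < \<eta>" using \<eta>(1) by (rule order_tendstoD)
  then obtain N where N: "\<And>n. n \<ge> N \<Longrightarrow> a * cell_osc n < \<eta>" by (auto simp: eventually_sequentially)
  have "\<bar>G (\<tau> n i) (z n i) - G s \<omega>\<bar> \<le> \<epsilon>" if "n \<ge> N" "i < m n" "s - \<eta> \<le> \<tau> n i" "\<tau> n i < s" for n i
  proof (rule \<eta>(2))
    show "\<tau> n i \<in> {0..T}" using that(2) by (intro grid.grid_in) simp
    show "norm (z n i r - \<omega> (min (\<tau> n i) r)) \<le> \<eta>" if "r \<in> {0..T}" for r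
      using z(3)[OF \<open>i < m n\<close> that] N[OF \<open>n \<ge> N\<close>] by simp
  qed (use that z in auto)
  then show ?thesis using \<eta>(1) by blast
qed

end

section \<open>The functional Ito formula\<close>

context partitioned_path begin

text \<open>
  The step path just before its jump at \<open>\<tau> n k\<close>. It has the value of \<open>\<omega>\<close> at \<open>\<tau> n k\<close> and will jump to
  its value at \<open>\<tau> n (Suc k)\<close>.
\<close>

definition step_state :: "nat \<Rightarrow> nat \<Rightarrow> real \<Rightarrow> real^'d" where "step_state n k = stepped T (\<tau> n) \<omega> k"

lemma step_state_Dpaths: "k \<le> m n \<Longrightarrow> step_state n k \<in> Dpaths T"
  unfolding step_state_def by (rule grid.stepped_Dpaths[OF \<omega>_D])

lemma step_state_Suc: "step_state n (Suc k) = bump T (\<tau> n k) (step_state n k) (\<delta> n k)"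
  by (simp add: step_state_def \<delta>_def)

lemma step_state_0: "step_state n 0 = stop T 0 \<omega>" by (simp add: step_state_def \<tau>_ends)

lemma stop_step_state: "k \<le> m n \<Longrightarrow> stop T (\<tau> n k) (step_state n k) = step_state n k"
  unfolding step_state_def by (rule grid.stop_stepped[OF _ \<omega>_D])

lemma stop_step_state_Suc: "k < m n \<Longrightarrow> stop T (\<tau> n k) (step_state n (Suc k)) = step_state n (Suc k)"
  unfolding step_state_def by (rule grid.stop_stepped_Suc)

lemma step_state_close:
  assumes "k \<le> m n" "r \<in> {0..T}"
  shows "norm (step_state n k r - \<omega> (min (\<tau> n k) r)) \<le> cell_osc n"
  unfolding step_state_def using assms grid.grid_Suc[of _ n] cell_osc_nonneg[of n]
  by (intro grid.stepped_close cell_close) (auto intro: less_imp_le)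

lemma step_state_in: "k \<le> m n \<Longrightarrow> \<omega> \<in> paths_in T R \<Longrightarrow> step_state n k \<in> paths_in T R"
proof -
  assume k: "k \<le> m n" and R: "\<omega> \<in> paths_in T R"
  have "norm (step_state n k r) \<le> R" if "r \<in> {0..T}" for r
    using grid.stepped_range[OF k that, of \<omega>] R unfolding step_state_def paths_in_def by force
  then show ?thesis using step_state_Dpaths[OF k] by (simp add: paths_in_def)
qed

lemma step_state_segment:
  assumes k: "k < m n" and R: "\<omega> \<in> paths_in T R" and \<theta>: "\<theta> \<in> {0..1}"
  shows "bump T (\<tau> n k) (step_state n k) (\<theta> *\<^sub>R \<delta> n k) \<in> paths_in T (3 * R)"
proof -
  have in_T: "\<tau> n k \<in> {0..T}" "\<tau> n (Suc k) \<in> {0..T}" by (rule cell_ends[OF k])+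
  then have "norm (\<delta> n k) \<le> R + R"
    using R unfolding \<delta>_def paths_in_def by (intro order.trans[OF norm_triangle_ineq4] add_mono) auto
  then have "norm (\<theta> *\<^sub>R \<delta> n k) \<le> 1 * (R + R)"
    unfolding norm_scaleR using \<theta> by (intro mult_mono) auto
  moreover have "bump T (\<tau> n k) (step_state n k) (\<theta> *\<^sub>R \<delta> n k) \<in> paths_in T (R + norm (\<theta> *\<^sub>R \<delta> n k))"
    using k R in_T by (intro paths_in_bump step_state_in) auto
  ultimately show ?thesis by (elim paths_in_mono) simp
qed

text \<open>
  The intermediate point in the Taylor expansion at the grid point \<open>\<tau> n k\<close>.
\<close>

definition \<theta> :: "nat \<Rightarrow> nat \<Rightarrow> real" where
  "\<theta> n k = (SOME \<theta>. \<theta> \<in> {0<..<1} \<and> F (\<tau> n k) (step_state n (Suc k)) = F (\<tau> n k) (step_state n k) +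
     v_grad T F (\<tau> n k) (step_state n k) \<bullet> \<delta> n k +
      (\<Sum>j\<in>UNIV. \<Sum>i\<in>UNIV. v_iter T F [i, j] (\<tau> n k) (bump T (\<tau> n k) (step_state n k) (\<theta> *\<^sub>R \<delta> n k))
         * (\<delta> n k $ i * \<delta> n k $ j)) / 2)"

definition mid_state :: "nat \<Rightarrow> nat \<Rightarrow> real \<Rightarrow> real^'d" where
  "mid_state n k = bump T (\<tau> n k) (step_state n k) (\<theta> n k *\<^sub>R \<delta> n k)"

definition second_order :: "nat \<Rightarrow> nat \<Rightarrow> real" where
  "second_order n k = (\<Sum>j\<in>UNIV. \<Sum>i\<in>UNIV. v_iter T F [i, j] (\<tau> n k) (mid_state n k) * (\<delta> n k $ i * \<delta> n k $ j))"

lemma \<theta>: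
  assumes k: "k < m n"
  shows "\<theta> n k \<in> {0<..<1}"
    and "F (\<tau> n k) (step_state n (Suc k)) = F (\<tau> n k) (step_state n k) +
      v_grad T F (\<tau> n k) (step_state n k) \<bullet> \<delta> n k + second_order n k / 2"
proof -
  have in_T: "\<tau> n k \<in> {0..T}" by (rule cell_ends[OF k])
  have yk: "stop T (\<tau> n k) (step_state n k) = step_state n k" using k by (intro stop_step_state) simp
  define P where "P r \<longleftrightarrow> r \<in> {0<..<1} \<and> F (\<tau> n k) (step_state n (Suc k)) = F (\<tau> n k) (step_state n k) +
     v_grad T F (\<tau> n k) (step_state n k) \<bullet> \<delta> n k +
      (\<Sum>j\<in>UNIV. \<Sum>i\<in>UNIV. v_iter T F [i, j] (\<tau> n k) (bump T (\<tau> n k) (step_state n k) (r *\<^sub>R \<delta> n k))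
         * (\<delta> n k $ i * \<delta> n k $ j)) / 2" for r
  obtain r where "r \<in> {0<..<1}" "F (\<tau> n k) (bump T (\<tau> n k) (step_state n k) (\<delta> n k)) =
     F (\<tau> n k) (stop T (\<tau> n k) (step_state n k)) + v_grad T F (\<tau> n k) (stop T (\<tau> n k) (step_state n k)) \<bullet> \<delta> n k +
      (\<Sum>j\<in>UNIV. \<Sum>i\<in>UNIV. v_iter T F [i, j] (\<tau> n k) (bump T (\<tau> n k) (step_state n k) (r *\<^sub>R \<delta> n k))
         * (\<delta> n k $ i * \<delta> n k $ j)) / 2"
    by (rule bump_Taylor[OF F_facts(3,4) in_T step_state_Dpaths[OF less_imp_le[OF k]], of "\<delta> n k"])
  then have "P r" unfolding P_def step_state_Suc yk by (rule conjI)
  then have "P (SOME r. P r)" by (rule someI)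
  also have "(SOME r. P r) = \<theta> n k" unfolding \<theta>_def P_def ..
  finally show "\<theta> n k \<in> {0<..<1}" "F (\<tau> n k) (step_state n (Suc k)) = F (\<tau> n k) (step_state n k) +
      v_grad T F (\<tau> n k) (step_state n k) \<bullet> \<delta> n k + second_order n k / 2"
    unfolding P_def second_order_def mid_state_def by (rule conjunct1, rule conjunct2)
qed

lemma mid_state_facts:
  assumes k: "k < m n"
  shows "mid_state n k \<in> Dpaths T" "stop T (\<tau> n k) (mid_state n k) = mid_state n k"
    "\<omega> \<in> paths_in T R \<Longrightarrow> mid_state n k \<in> paths_in T (3 * R)"
    "r \<in> {0..T} \<Longrightarrow> norm (mid_state n k r - \<omega> (min (\<tau> n k) r)) \<le> 2 * cell_osc n"
proof -
  have in_T: "\<tau> n k \<in> {0..T}" by (rule cell_ends[OF k])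
  show "mid_state n k \<in> Dpaths T" unfolding mid_state_def using k in_T by (intro bump_Dpaths step_state_Dpaths) auto
  show "stop T (\<tau> n k) (mid_state n k) = mid_state n k" unfolding mid_state_def by (rule stop_bump[OF in_T])
  show "mid_state n k \<in> paths_in T (3 * R)" if "\<omega> \<in> paths_in T R"
    unfolding mid_state_def using k that \<theta>(1)[OF k] by (intro step_state_segment) auto
  show "norm (mid_state n k r - \<omega> (min (\<tau> n k) r)) \<le> 2 * cell_osc n" if r: "r \<in> {0..T}"
  proof -
    have min_in: "min (\<tau> n k) r \<in> {0..T}" using in_T r by auto
    have "norm (\<theta> n k *\<^sub>R \<delta> n k) \<le> 1 * cell_osc n"
      unfolding norm_scaleR using \<theta>(1)[OF k] \<delta>_le[OF k] by (intro mult_mono) auto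
    then have "norm (if \<tau> n k \<le> r then \<theta> n k *\<^sub>R \<delta> n k else 0) \<le> cell_osc n" using cell_osc_nonneg[of n] by simp
    moreover have "norm (step_state n k (min (\<tau> n k) r) - \<omega> (min (\<tau> n k) r)) \<le> cell_osc n"
      using step_state_close[OF less_imp_le[OF k] min_in] by simp
    moreover have "mid_state n k r - \<omega> (min (\<tau> n k) r) = (step_state n k (min (\<tau> n k) r) - \<omega> (min (\<tau> n k) r)) +
        (if \<tau> n k \<le> r then \<theta> n k *\<^sub>R \<delta> n k else 0)"
      using r by (simp add: mid_state_def bump_apply)
    ultimately show ?thesis by (metis add_mono mult_2 norm_triangle_le)
  qed
qed

lemma paths_in_3: "\<omega> \<in> paths_in T R \<Longrightarrow> \<omega> \<in> paths_in T (3 * R)"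
proof (rule paths_in_mono)
  assume "\<omega> \<in> paths_in T R"
  then have "norm (\<omega> 0) \<le> R" using T by (simp add: paths_in_def)
  then show "R \<le> 3 * R" using norm_ge_zero[of "\<omega> 0"] by linarith
qed

definition second_order_sum :: "nat \<Rightarrow> real \<Rightarrow> real" where
  "second_order_sum n t = (\<Sum>k | k < m n \<and> \<tau> n (Suc k) \<le> t. second_order n k)"

lemma second_order_sum_convergent: "convergent (\<lambda>n. second_order_sum n t)"
proof -
  obtain R where R: "\<omega> \<in> paths_in T R" using \<omega>_bounded by blast
  obtain C where C: "derivative_bound (3 * R) C" using derivative_bound_exists by blast
  define S where "S i j n = (\<Sum>k | k < m n \<and> \<tau> n (Suc k) \<le> t. v_iter T F [i, j] (\<tau> n k) (mid_state n k) * (\<delta> n k $ i * \<delta> n k $ j))" for i j n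
  have "convergent (S i j)" for i j
    unfolding S_def
  proof (rule covariation_sums_upto[where h = "\<lambda>s. v_iter T F [i, j] s \<omega>" and C = C, OF left_limit_weightsI])
    show "\<bar>v_iter T F [i, j] u \<omega>\<bar> \<le> C" if "u \<in> {0..T}" for u
      using C paths_in_3[OF R] that by (simp add: derivative_bound_def del: v_iter.simps)
    show "\<bar>v_iter T F [i, j] (\<tau> n k) (mid_state n k)\<bar> \<le> C" if "k < m n" for n k
    proof -
      have "\<tau> n k \<in> {0..T}" by (rule cell_ends[OF that])
      then show ?thesis using C mid_state_facts(3)[OF that R] by (simp add: derivative_bound_def del: v_iter.simps)
    qed
    fix s \<epsilon> :: real assume s: "s \<in> {0<..T}" "\<epsilon> > 0"
    show "\<exists>\<eta>>0. \<forall>u\<in>{0..T}. s - \<eta> \<le> u \<and> u < s \<longrightarrow> \<bar>v_iter T F [i, j] u \<omega> - v_iter T F [i, j] s \<omega>\<bar> \<le> \<epsilon>"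
      by (rule left_limit_along_path[OF F_facts(6) s])
    show "\<exists>\<eta>>0. \<exists>N. \<forall>n\<ge>N. \<forall>k<m n. s - \<eta> \<le> \<tau> n k \<and> \<tau> n k < s \<longrightarrow>
        \<bar>v_iter T F [i, j] (\<tau> n k) (mid_state n k) - v_iter T F [i, j] s \<omega>\<bar> \<le> \<epsilon>"
      by (rule left_limit_along_grid[where a = 2, OF F_facts(6) s mid_state_facts(1,2,4)])
  qed
  then have "(\<lambda>n. \<Sum>j\<in>UNIV. \<Sum>i\<in>UNIV. S i j n) \<longlonglongrightarrow> (\<Sum>j\<in>UNIV. \<Sum>i\<in>UNIV. lim (S i j))"
    by (intro tendsto_sum) (simp add: convergent_LIMSEQ_iff)
  moreover have "(\<Sum>j\<in>UNIV. \<Sum>i\<in>UNIV. S i j n) = second_order_sum n t" for n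
  proof -
    have "(\<Sum>i\<in>UNIV. S i j n) = (\<Sum>k | k < m n \<and> \<tau> n (Suc k) \<le> t. \<Sum>i\<in>UNIV. v_iter T F [i, j] (\<tau> n k) (mid_state n k) * (\<delta> n k $ i * \<delta> n k $ j))" for j
      unfolding S_def by (rule sum.swap)
    then have "(\<Sum>j\<in>UNIV. \<Sum>i\<in>UNIV. S i j n) = (\<Sum>j\<in>UNIV. \<Sum>k | k < m n \<and> \<tau> n (Suc k) \<le> t.
        \<Sum>i\<in>UNIV. v_iter T F [i, j] (\<tau> n k) (mid_state n k) * (\<delta> n k $ i * \<delta> n k $ j))"
      by (simp only:)
    also have "\<dots> = second_order_sum n t"
      unfolding second_order_sum_def second_order_def by (rule sum.swap)
    finally show ?thesis .
  qed
  ultimately show ?thesis by (auto simp: convergent_def)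
qed

definition second_order_limit :: "real \<Rightarrow> real" where
  "second_order_limit t = lim (\<lambda>n. second_order_sum n t)"

lemma second_order_sum_tendsto: "(\<lambda>n. second_order_sum n t) \<longlonglongrightarrow> second_order_limit t"
  unfolding second_order_limit_def using second_order_sum_convergent[of t] by (simp add: convergent_LIMSEQ_iff)

definition total_qv :: "real \<Rightarrow> real" where
  "total_qv t = (\<Sum>i\<in>UNIV. qv m \<tau> (\<lambda>s. \<omega> s $ i) t)"

lemma total_qv_tendsto:
  assumes "t \<in> {0..T}"
  shows "(\<lambda>n. \<Sum>k | k < m n \<and> \<tau> n (Suc k) \<le> t. (norm (\<delta> n k))\<^sup>2) \<longlonglongrightarrow> total_qv t"
proof -
  have "(\<lambda>n. \<Sum>i\<in>UNIV. qv_sum m \<tau> (\<lambda>s. \<omega> s $ i) t n) \<longlonglongrightarrow> total_qv t"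
    unfolding total_qv_def
    by (intro tendsto_sum Q1_continuous_facts(3)[OF T part \<omega>_components(1,3) assms])
  moreover have "(\<Sum>i\<in>UNIV. qv_sum m \<tau> (\<lambda>s. \<omega> s $ i) t n) = (\<Sum>k | k < m n \<and> \<tau> n (Suc k) \<le> t. (norm (\<delta> n k))\<^sup>2)" for n
    unfolding qv_sum_def power2_norm_eq_inner inner_vec_def \<delta>_def
    by (subst sum.swap) (simp add: power2_eq_square)
  ultimately show ?thesis by simp
qed

lemma total_qv_cont: "continuous_on {0..T} total_qv"
  unfolding total_qv_def[abs_def]
  by (intro continuous_on_sum Q1_continuous_facts(1)[OF T part \<omega>_components(1,3)])

lemma second_order_bound_exists:
  obtains K where "0 \<le> K" "\<And>n k. k < m n \<Longrightarrow> \<bar>second_order n k\<bar> \<le> K * (norm (\<delta> n k))\<^sup>2"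
proof -
  obtain R where R: "\<omega> \<in> paths_in T R" using \<omega>_bounded by blast
  obtain C where C: "derivative_bound (3 * R) C" using derivative_bound_exists by blast
  show thesis
  proof (rule that[of "2 * ((real CARD('d))\<^sup>2 * C)"])
    fix n k assume k: "k < m n"
    show "\<bar>second_order n k\<bar> \<le> 2 * ((real CARD('d))\<^sup>2 * C) * (norm (\<delta> n k))\<^sup>2"
      using second_order_bound[OF C cell_ends(1)[OF k] step_state_Dpaths[OF less_imp_le[OF k]] step_state_segment[OF k R]]
        \<theta>(2)[OF k] stop_step_state[OF less_imp_le[OF k]] by (simp add: step_state_Suc)
  qed (use C in \<open>simp add: derivative_bound_def\<close>)
qed

text \<open>
  Second order sums are dominated by quadratic sums, so their limit is dominated by \<open>d[\<omega>]\<close>.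
\<close>

lemma second_order_limit_increment:
  obtains K where "0 \<le> K" "\<And>s t. 0 \<le> s \<Longrightarrow> s \<le> t \<Longrightarrow> t \<le> T \<Longrightarrow>
    \<bar>second_order_limit t - second_order_limit s\<bar> \<le> K * (total_qv t - total_qv s)"
proof -
  obtain K where K: "0 \<le> K" "\<And>n k. k < m n \<Longrightarrow> \<bar>second_order n k\<bar> \<le> K * (norm (\<delta> n k))\<^sup>2"
    using second_order_bound_exists by blast
  show thesis
  proof (rule that[OF K(1)])
    fix s t assume st: "0 \<le> s" "s \<le> t" "t \<le> T"
    define A where "A n t = {k. k < m n \<and> \<tau> n (Suc k) \<le> t}" for n t
    have sub: "A n s \<subseteq> A n t" for n using st(2) by (auto simp: A_def)
    have fin: "finite (A n t)" for n t by (simp add: A_def)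
    have "\<bar>second_order_sum n t - second_order_sum n s\<bar> \<le>
        K * ((\<Sum>k\<in>A n t. (norm (\<delta> n k))\<^sup>2) - (\<Sum>k\<in>A n s. (norm (\<delta> n k))\<^sup>2))" for n
    proof -
      have "second_order_sum n t - second_order_sum n s = (\<Sum>k\<in>A n t - A n s. second_order n k)"
        unfolding second_order_sum_def A_def[symmetric] using sub fin by (simp add: sum_diff)
      also have "\<bar>\<dots>\<bar> \<le> (\<Sum>k\<in>A n t - A n s. K * (norm (\<delta> n k))\<^sup>2)"
        using K(2) by (intro order.trans[OF sum_abs] sum_mono) (auto simp: A_def)
      also have "\<dots> = K * ((\<Sum>k\<in>A n t. (norm (\<delta> n k))\<^sup>2) - (\<Sum>k\<in>A n s. (norm (\<delta> n k))\<^sup>2))"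
        using sub fin by (simp add: sum_diff flip: sum_distrib_left)
      finally show ?thesis .
    qed
    moreover have "(\<lambda>n. \<bar>second_order_sum n t - second_order_sum n s\<bar>) \<longlonglongrightarrow>
        \<bar>second_order_limit t - second_order_limit s\<bar>"
      by (intro tendsto_intros second_order_sum_tendsto)
    moreover have "(\<lambda>n. K * ((\<Sum>k\<in>A n t. (norm (\<delta> n k))\<^sup>2) - (\<Sum>k\<in>A n s. (norm (\<delta> n k))\<^sup>2))) \<longlonglongrightarrow>
        K * (total_qv t - total_qv s)"
      unfolding A_def using st by (intro tendsto_intros total_qv_tendsto) auto
    ultimately show "\<bar>second_order_limit t - second_order_limit s\<bar> \<le> K * (total_qv t - total_qv s)"
      by (intro LIMSEQ_le) auto
  qed
qed

text \<open>
  The approximating sums change by the square of one increment over a cell, and they converge uniformly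
  to the quadratic variation by \<open>monotone_limit_uniform\<close>. This covers long cells as well.
\<close>

lemma total_qv_cells: "\<exists>E. E \<longlonglongrightarrow> 0 \<and> (\<forall>n. \<forall>k<m n. total_qv (\<tau> n (Suc k)) - total_qv (\<tau> n k) \<le> E n)"
proof -
  define f where "f n t = (\<Sum>k | k < m n \<and> \<tau> n (Suc k) \<le> t. (norm (\<delta> n k))\<^sup>2)" for n t
  have "uniform_limit {0..T} f total_qv sequentially"
  proof (rule monotone_limit_uniform)
    show "mono_on {0..T} (f n)" for n unfolding f_def by (intro mono_onI sum_mono2) auto
    show "(\<lambda>n. f n t) \<longlonglongrightarrow> total_qv t" if "t \<in> {0..T}" for t
      unfolding f_def by (rule total_qv_tendsto[OF that])
  qed (use T total_qv_cont in auto)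
  then have unif: "\<And>\<epsilon>. \<epsilon> > 0 \<Longrightarrow> \<forall>\<^sub>F n in sequentially. \<forall>t\<in>{0..T}. dist (f n t) (total_qv t) < \<epsilon>"
    by (simp add: uniform_limit_iff)
  define E where "E n = (MAX k\<in>{..<m n}. total_qv (\<tau> n (Suc k)) - total_qv (\<tau> n k))" for n
  have E_ge: "total_qv (\<tau> n (Suc k)) - total_qv (\<tau> n k) \<le> E n" if "k < m n" for n k
    unfolding E_def using that by (intro Max_ge) auto
  have total_mono: "total_qv s \<le> total_qv t" if "0 \<le> s" "s \<le> t" "t \<le> T" for s t
  proof (rule LIMSEQ_le[OF total_qv_tendsto total_qv_tendsto])
    show "\<exists>N. \<forall>n\<ge>N. (\<Sum>k | k < m n \<and> \<tau> n (Suc k) \<le> s. (norm (\<delta> n k))\<^sup>2) \<le> (\<Sum>k | k < m n \<and> \<tau> n (Suc k) \<le> t. (norm (\<delta> n k))\<^sup>2)"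
      using that(2) by (intro exI allI impI sum_mono2) auto
  qed (use that in auto)
  have "E \<longlonglongrightarrow> 0"
  proof (rule tendstoI)
    fix \<epsilon> :: real assume "\<epsilon> > 0"
    have "(\<lambda>n. (cell_osc n)\<^sup>2) \<longlonglongrightarrow> 0\<^sup>2" by (intro tendsto_intros cell_osc_tendsto_0)
    then have "\<forall>\<^sub>F n in sequentially. (cell_osc n)\<^sup>2 < \<epsilon> / 3"
      using \<open>\<epsilon> > 0\<close> by (intro order_tendstoD(2)[of _ 0]) auto
    moreover have "\<forall>\<^sub>F n in sequentially. \<forall>t\<in>{0..T}. dist (f n t) (total_qv t) < \<epsilon> / 3"
      using \<open>\<epsilon> > 0\<close> by (intro unif) simp
    ultimately show "\<forall>\<^sub>F n in sequentially. dist (E n) 0 < \<epsilon>"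
    proof eventually_elim
      case (elim n)
      have "E n \<in> (\<lambda>k. total_qv (\<tau> n (Suc k)) - total_qv (\<tau> n k)) ` {..<m n}"
        unfolding E_def using m_pos[of n] by (intro Max_in) auto
      then obtain k where k: "k < m n" "E n = total_qv (\<tau> n (Suc k)) - total_qv (\<tau> n k)" by blast
      have in_T: "\<tau> n k \<in> {0..T}" "\<tau> n (Suc k) \<in> {0..T}" by (rule cell_ends[OF k(1)])+
      have "{i. i < m n \<and> \<tau> n (Suc i) \<le> \<tau> n (Suc k)} = {..k}"
      proof (intro set_eqI iffI)
        fix i assume "i \<in> {i. i < m n \<and> \<tau> n (Suc i) \<le> \<tau> n (Suc k)}"
        then show "i \<in> {..k}"
          using grid.grid_mono[of "Suc k" i n] grid.grid_Suc[of i n] by (cases "i \<le> k") auto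
      qed (use grid.grid_mono[of "Suc _" "Suc k" n] k(1) in auto)
      moreover have "{i. i < m n \<and> \<tau> n (Suc i) \<le> \<tau> n k} = {..<k}"
      proof (intro set_eqI iffI)
        fix i assume "i \<in> {i. i < m n \<and> \<tau> n (Suc i) \<le> \<tau> n k}"
        then show "i \<in> {..<k}"
          using grid.grid_mono[of k i n] grid.grid_Suc[of i n] by (cases "i < k") auto
      qed (use grid.grid_mono[of "Suc _" k n] k(1) in auto)
      ultimately have "f n (\<tau> n (Suc k)) - f n (\<tau> n k) = (norm (\<delta> n k))\<^sup>2"
        by (simp add: f_def lessThan_Suc_atMost[symmetric])
      also have "\<dots> \<le> (cell_osc n)\<^sup>2" using \<delta>_le[OF k(1)] by (intro power_mono) auto
      finally have "f n (\<tau> n (Suc k)) - f n (\<tau> n k) < \<epsilon> / 3" using elim(1) by simp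
      moreover have "dist (f n (\<tau> n k)) (total_qv (\<tau> n k)) < \<epsilon> / 3"
        "dist (f n (\<tau> n (Suc k))) (total_qv (\<tau> n (Suc k))) < \<epsilon> / 3" using elim(2) in_T by blast+
      moreover have "0 \<le> E n" unfolding k(2)
        using total_mono[of "\<tau> n k" "\<tau> n (Suc k)"] in_T grid.grid_Suc[OF k(1)] by auto
      ultimately show ?case unfolding k(2) dist_real_def by linarith
    qed
  qed
  then show ?thesis using E_ge by blast
qed

lemma grid_cell:
  assumes "s \<in> {0..<T}"
  obtains k where "k < m n" "s \<in> {\<tau> n k..<\<tau> n (Suc k)}"
proof -
  have "s \<in> {0..T}" using assms by auto
  from grid.grid_position[OF order_refl this] show thesis
    using assms \<tau>_ends that by (metis atLeastLessThan_iff not_le)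
qed

text \<open>
  The horizontal derivative along the step path. On the cell that starts at \<open>\<tau> n k\<close> the path is
  \<open>y n (Suc k)\<close>, which has already made the jump at \<open>\<tau> n k\<close>. The value \<open>0\<close> at \<open>T\<close>, where no horizontal
  derivative exists, does not affect integrals.
\<close>

definition drift :: "nat \<Rightarrow> real \<Rightarrow> real" where
  "drift n s = (if s < T then h_deriv T F s (step_state n (Suc (LEAST k. s < \<tau> n (Suc k)))) else 0)"

definition limit_drift :: "real \<Rightarrow> real" where
  "limit_drift s = (if s < T then h_deriv T F s \<omega> else 0)"

lemma drift_cell:
  assumes k: "k < m n" and s: "s \<in> {\<tau> n k..<\<tau> n (Suc k)}"
  shows "drift n s = h_deriv T F s (step_state n (Suc k))"
proof -
  have "(LEAST j. s < \<tau> n (Suc j)) = k"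
  proof (rule Least_equality)
    show "k \<le> j" if "s < \<tau> n (Suc j)" for j
    proof (rule ccontr)
      assume "\<not> k \<le> j"
      then have "\<tau> n (Suc j) \<le> \<tau> n k" using k by (intro grid.grid_mono) auto
      then show False using that s by auto
    qed
  qed (use s in auto)
  moreover have "s < T" using s grid.grid_in[of "Suc k" n] k by auto
  ultimately show ?thesis by (simp add: drift_def)
qed

lemma drift_bound: "\<exists>C>0. \<forall>s\<in>{0..T}. \<bar>limit_drift s\<bar> \<le> C \<and> (\<forall>n. \<bar>drift n s\<bar> \<le> C)"
proof -
  obtain R where R: "\<omega> \<in> paths_in T R" using \<omega>_bounded by blast
  obtain C where C: "derivative_bound R C" using derivative_bound_exists by blast
  have C0: "0 < C" using C by (simp add: derivative_bound_def)
  have "\<bar>limit_drift s\<bar> \<le> C" if "s \<in> {0..T}" for s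
    using C R C0 that by (auto simp: limit_drift_def derivative_bound_def less_imp_le)
  moreover have "\<bar>drift n s\<bar> \<le> C" if s: "s \<in> {0..T}" for n s
  proof (cases "s < T")
    case True
    then have s': "s \<in> {0..<T}" using s by simp
    then obtain k where k: "k < m n" "s \<in> {\<tau> n k..<\<tau> n (Suc k)}" by (rule grid_cell)
    then have "step_state n (Suc k) \<in> paths_in T R" by (intro step_state_in R) simp
    then show ?thesis using C s' by (auto simp: drift_cell[OF k] derivative_bound_def less_imp_le)
  qed (use C0 in \<open>simp add: drift_def\<close>)
  ultimately show ?thesis using C0 by blast
qed

lemma drift_tendsto:
  assumes s: "s \<in> {0..T}"
  shows "(\<lambda>n. drift n s) \<longlonglongrightarrow> limit_drift s"
proof (cases "s < T")
  case True
  then have s': "s \<in> {0..<T}" using s by simp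
  show ?thesis
  proof (rule LIMSEQ_I)
    fix r :: real assume "r > 0"
    then obtain \<eta> where \<eta>: "\<eta> > 0" "\<And>x. x \<in> Dpaths T \<Longrightarrow>
        sup_dist T (stop T s \<omega>) (stop T s x) < \<eta> \<Longrightarrow> \<bar>h_deriv T F s \<omega> - h_deriv T F s x\<bar> < r"
      using F_facts(12) s' \<omega>_D unfolding continuous_fixed_times_def by metis
    have "\<forall>\<^sub>F n in sequentially. cell_osc n < \<eta>" using cell_osc_tendsto_0 \<eta>(1) by (rule order_tendstoD)
    then have "\<forall>\<^sub>F n in sequentially. norm (drift n s - limit_drift s) < r"
    proof eventually_elim
      case (elim n)
      obtain k where k: "k < m n" "s \<in> {\<tau> n k..<\<tau> n (Suc k)}" using s' by (rule grid_cell)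
      have yD: "step_state n (Suc k) \<in> Dpaths T" using k by (intro step_state_Dpaths) simp
      have "sup_dist T (stop T s \<omega>) (stop T s (step_state n (Suc k))) \<le> cell_osc n"
      proof (rule sup_dist_le)
        fix q assume q: "q \<in> {0..T}"
        have "min s q \<in> {0..T}" "min (\<tau> n (Suc k)) (min s q) = min s q" using q s k(2) by auto
        then show "dist (stop T s \<omega> q) (stop T s (step_state n (Suc k)) q) \<le> cell_osc n"
          using step_state_close[of "Suc k" n "min s q"] k(1) q by (simp add: stop_apply dist_norm norm_minus_commute)
      qed (use T s \<omega>_D yD stop_Dpaths in auto)
      then have "\<bar>h_deriv T F s \<omega> - h_deriv T F s (step_state n (Suc k))\<bar> < r" using elim by (intro \<eta>(2) yD) simp
      then show ?case using True by (simp add: drift_cell[OF k] limit_drift_def abs_minus_commute)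
    qed
    then show "\<exists>no. \<forall>n\<ge>no. norm (drift n s - limit_drift s) < r" by (simp add: eventually_sequentially)
  qed
qed (simp add: drift_def limit_drift_def)

lemma drift_has_integral_cell:
  assumes k: "k < m n" and ab: "\<tau> n k \<le> a" "a \<le> b" "b \<le> \<tau> n (Suc k)"
  shows "(drift n has_integral (F b (step_state n (Suc k)) - F a (step_state n (Suc k)))) {a..b}"
proof -
  obtain R where R: "\<omega> \<in> paths_in T R" using \<omega>_bounded by blast
  obtain C where C: "derivative_bound R C" using derivative_bound_exists by blast
  have in_T: "\<tau> n k \<in> {0..T}" "\<tau> n (Suc k) \<in> {0..T}" by (rule cell_ends[OF k])+
  have yR: "step_state n (Suc k) \<in> paths_in T R" using k by (intro step_state_in R) simp
  have "((\<lambda>u. h_deriv T F u (step_state n (Suc k))) has_integral (F b (step_state n (Suc k)) - F a (step_state n (Suc k)))) {a..b}"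
  proof (rule horizontal_FTC(2)[OF F_facts(1,2), where M = C])
    show "step_state n (Suc k) \<in> Dpaths T" using yR by (simp add: paths_in_def)
    show "stop T (\<tau> n k) (step_state n (Suc k)) = step_state n (Suc k)" by (rule stop_step_state_Suc[OF k])
    show "\<bar>h_deriv T F u (step_state n (Suc k))\<bar> < C" if "u \<in> {a..<b}" for u
      using C yR that ab in_T by (auto simp: derivative_bound_def)
  qed (use ab in_T in auto)
  then show ?thesis
    by (rule has_integral_spike_finite[of "{b}", rotated 2]) (use ab k in \<open>auto simp: drift_cell\<close>)
qed

text \<open>
  The Ito formula for the step path: a telescoping sum of \<open>drift_has_integral_cell\<close> over the cells and
  of the Taylor expansions \<open>\<theta>\<close> at the grid points.
\<close>

lemma grid_Ito:
  assumes "k \<le> m n"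
  shows "(drift n has_integral (F (\<tau> n k) (step_state n k) - F 0 \<omega> - (\<Sum>i<k. v_grad T F (\<tau> n i) (step_state n i) \<bullet> \<delta> n i)
      - (\<Sum>i<k. second_order n i) / 2)) {0..\<tau> n k}"
  using assms
proof (induction k)
  case 0
  then show ?case using \<omega>_D T by (simp add: \<tau>_ends step_state_0 F_stop has_integral_refl)
next
  case (Suc k)
  then have k: "k < m n" by simp
  have 0: "0 \<le> \<tau> n k" using grid.grid_in[of k n] k by simp
  have 1: "(drift n has_integral (F (\<tau> n k) (step_state n k) - F 0 \<omega> - (\<Sum>i<k. v_grad T F (\<tau> n i) (step_state n i) \<bullet> \<delta> n i)
      - (\<Sum>i<k. second_order n i) / 2)) {0..\<tau> n k}" using Suc by simp
  have 2: "(drift n has_integral (F (\<tau> n (Suc k)) (step_state n (Suc k)) - F (\<tau> n k) (step_state n (Suc k)))) {\<tau> n k..\<tau> n (Suc k)}"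
    using k grid.grid_Suc[OF k] by (intro drift_has_integral_cell) auto
  from has_integral_combine[OF 0 less_imp_le[OF grid.grid_Suc[OF k]] 1 2]
  show ?case using \<theta>(2)[OF k] by (simp add: algebra_simps add_divide_distrib)
qed

lemma step_path_value:
  assumes k: "k < m n" and r: "r \<in> {\<tau> n k..<\<tau> n (Suc k)}"
  shows "step_path T m \<tau> \<omega> n r = \<omega> (\<tau> n (Suc k))"
proof -
  have in_T: "0 \<le> r" "r < T" using r grid.grid_in[of k n] grid.grid_in[of "Suc k" n] k by auto
  have "r \<notin> {\<tau> n i..<\<tau> n (Suc i)}" if "i < m n" "i \<noteq> k" for i
    using grid.grid_mono[of "Suc i" k n] grid.grid_mono[of "Suc k" i n] r k that by (cases "i < k") auto
  then have "(\<Sum>i<m n. indicator {\<tau> n i..<\<tau> n (Suc i)} r *\<^sub>R \<omega> (\<tau> n (Suc i))) =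
      (\<Sum>i\<in>{k}. indicator {\<tau> n i..<\<tau> n (Suc i)} r *\<^sub>R \<omega> (\<tau> n (Suc i)))"
    using k by (intro sum.mono_neutral_right) auto
  also have "\<dots> = \<omega> (\<tau> n (Suc k))"
    using r by (simp only: sum.insert sum.empty finite.emptyI empty_iff not_False_eq_True add_0_right
      indicator_simps scaleR_one)
  finally show ?thesis unfolding step_path_def using in_T by (simp only: restrict_apply) simp
qed

lemma stop_left_step_path:
  assumes k: "0 < k" "k < m n"
  shows "stop_left T (\<tau> n k) (step_path T m \<tau> \<omega> n) = step_state n k"
proof (rule extensionalityI)
  have km: "k - 1 < m n" "Suc (k - 1) = k" using k by auto
  have before: "\<tau> n (k - 1) < \<tau> n k" using grid.grid_Suc[OF km(1)] km(2) by simp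
  have in_T: "\<tau> n k \<in> {0..T}" by (rule cell_ends(1)[OF k(2)])
  have "0 \<le> \<tau> n (k - 1)" using grid.grid_in[of "k - 1" n] km(1) by simp
  then have pos: "0 < \<tau> n k" using before by simp
  have "\<forall>\<^sub>F r in at_left (\<tau> n k). r \<in> {\<tau> n (k - 1)<..<\<tau> n k}"
    by (rule eventually_at_left_real[OF before])
  then have "\<forall>\<^sub>F r in at_left (\<tau> n k). \<omega> (\<tau> n k) = step_path T m \<tau> \<omega> n r"
    by eventually_elim (use step_path_value[OF km(1)] km(2) in auto)
  then have "(step_path T m \<tau> \<omega> n \<longlongrightarrow> \<omega> (\<tau> n k)) (at_left (\<tau> n k))"
    by (rule Lim_transform_eventually[OF tendsto_const])
  then have left: "left_value (step_path T m \<tau> \<omega> n) (\<tau> n k) = \<omega> (\<tau> n k)"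
    using pos by (simp add: left_value_def tendsto_Lim)
  show "stop_left T (\<tau> n k) (step_path T m \<tau> \<omega> n) \<in> extensional {0..T}" by (simp add: stop_left_def)
  show "step_state n k \<in> extensional {0..T}" using step_state_Dpaths[of k n] k by (simp add: Dpaths_def)
  fix r assume r: "r \<in> {0..T}"
  show "stop_left T (\<tau> n k) (step_path T m \<tau> \<omega> n) r = step_state n k r"
    using less_imp_le[OF k(2)] r
  proof (cases rule: grid.grid_position)
    case 1
    then show ?thesis using r by (simp add: \<tau>_ends)
  next
    case 2
    then show ?thesis using grid.stepped_after[of k n r \<omega>] k r left by (simp add: stop_left_def step_state_def)
  next
    case (3 j)
    then have "r < \<tau> n k" using grid.grid_mono[of "Suc j" k n] k by auto
    then show ?thesis
      using grid.stepped_between[of k n j r \<omega>] 3 k r step_path_value[of j n r] by (simp add: stop_left_def step_state_def)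
  qed
qed

text \<open>
  At time \<open>0\<close> the left value is by convention the value at \<open>0\<close>, so the first summand of the integral
  is evaluated at a constant path instead of at \<open>y n 0\<close>.
\<close>

lemma stop_left_step_path_0: "stop_left T 0 (step_path T m \<tau> \<omega> n) = (\<lambda>s\<in>{0..T}. \<omega> (\<tau> n 1))"
proof -
  have "step_path T m \<tau> \<omega> n 0 = \<omega> (\<tau> n 1)"
    using step_path_value[of 0 n 0] m_pos[of n] grid.grid_Suc[of 0 n] by (simp add: \<tau>_ends)
  then show ?thesis by (auto simp: stop_left_def left_value_def fun_eq_iff)
qed

lemma integrand_bound:
  "\<exists>C>0. \<forall>n. \<forall>k<m n. norm (v_grad T F (\<tau> n k) (stop_left T (\<tau> n k) (step_path T m \<tau> \<omega> n))) \<le> C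
     \<and> norm (v_grad T F (\<tau> n k) (step_state n k)) \<le> C"
proof -
  obtain R where R: "\<omega> \<in> paths_in T R" using \<omega>_bounded by blast
  obtain C where C: "derivative_bound R C" using derivative_bound_exists by blast
  have C0: "0 < C" using C by (simp add: derivative_bound_def)
  have G: "norm (v_grad T F (\<tau> n k) (step_state n k)) \<le> C" if k: "k < m n" for n k
  proof -
    have "\<tau> n k \<in> {0..T}" "step_state n k \<in> paths_in T R" using k by (auto intro!: grid.grid_in step_state_in R simp del: atLeastAtMost_iff)
    then show ?thesis using C by (simp add: derivative_bound_def)
  qed
  have "norm (v_grad T F (\<tau> n k) (stop_left T (\<tau> n k) (step_path T m \<tau> \<omega> n))) \<le> C" if k: "k < m n" for n k
  proof (cases "k = 0")
    case True
    have "(\<lambda>s\<in>{0..T}. \<omega> (\<tau> n 1)) \<in> Dpaths T"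
    proof (rule continuous_Dpaths)
      have "continuous_on {0..T} (\<lambda>s. \<omega> (\<tau> n 1))" by (rule continuous_on_const)
      then show "continuous_on {0..T} (\<lambda>s\<in>{0..T}. \<omega> (\<tau> n 1))"
        by (subst continuous_on_cong[OF refl]) auto
    qed simp
    moreover have "\<tau> n 1 \<in> {0..T}" using m_pos[of n] by (intro grid.grid_in) simp
    ultimately have "(\<lambda>s\<in>{0..T}. \<omega> (\<tau> n 1)) \<in> paths_in T R" using R by (simp add: paths_in_def)
    then show ?thesis using C T True by (simp add: \<tau>_ends stop_left_step_path_0 derivative_bound_def)
  next
    case False
    then show ?thesis using G[OF k] k by (simp add: stop_left_step_path)
  qed
  then show ?thesis using G C0 by blast
qed

text \<open>
  Three corrections to \<open>grid_Ito\<close>, each of the order of the oscillation: the first summand, evaluated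
  at another path; the summand of the cell that contains \<open>t\<close>; and the replacement of the step path by
  \<open>\<omega>\<close> in the values of \<open>F\<close>, by the Lipschitz condition.
\<close>

lemma path_int_sum_expansion:
  "\<exists>K. \<forall>n. \<forall>t\<in>{0..T}. drift n integrable_on {0..t} \<and>
     \<bar>path_int_sum T m \<tau> (v_grad T F) \<omega> t n - (F t \<omega> - F 0 \<omega> - integral {0..t} (drift n) - second_order_sum n t / 2)\<bar> \<le> K * cell_osc n"
proof -
  obtain C where C: "C > 0" "\<And>n k. k < m n \<Longrightarrow> norm (v_grad T F (\<tau> n k) (stop_left T (\<tau> n k) (step_path T m \<tau> \<omega> n))) \<le> C"
     "\<And>n k. k < m n \<Longrightarrow> norm (v_grad T F (\<tau> n k) (step_state n k)) \<le> C"
    using integrand_bound by blast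
  obtain L where L: "L > 0" "\<And>t x y \<epsilon>. t \<in> {0..T} \<Longrightarrow> x \<in> Dpaths T \<Longrightarrow> y \<in> Dpaths T \<Longrightarrow>
    (\<And>r. r \<in> {0..T} \<Longrightarrow> norm (x (min t r) - y (min t r)) \<le> \<epsilon>) \<Longrightarrow> \<bar>F t x - F t y\<bar> \<le> L * \<epsilon>"
    using Lip_bound by (metis (no_types, lifting))
  define K where "K = 2 * C + C + 2 * L"
  have "drift n integrable_on {0..t} \<and>
     \<bar>path_int_sum T m \<tau> (v_grad T F) \<omega> t n - (F t \<omega> - F 0 \<omega> - integral {0..t} (drift n) - second_order_sum n t / 2)\<bar> \<le> K * cell_osc n"
    if t: "t \<in> {0..T}" for n t
  proof -
    have e0: "0 \<le> cell_osc n" by (rule cell_osc_nonneg)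
    define g where "g k = v_grad T F (\<tau> n k) (stop_left T (\<tau> n k) (step_path T m \<tau> \<omega> n))" for k
    define G where "G k = v_grad T F (\<tau> n k) (step_state n k)" for k
    define inc where "inc k = \<omega> (min (\<tau> n (Suc k)) t) - \<omega> (min (\<tau> n k) t)" for k
    have S: "path_int_sum T m \<tau> (v_grad T F) \<omega> t n = (\<Sum>i<m n. g i \<bullet> inc i)"
      by (simp add: path_int_sum_def g_def inc_def)
    have near: "\<bar>F t x - F t \<omega>\<bar> \<le> L * cell_osc n" if x: "x = step_state n k" "k \<le> m n" and tk: "t \<le> \<tau> n k" for x k
    proof (rule L(2)[OF t])
      show "x \<in> Dpaths T" unfolding x(1) using x(2) by (rule step_state_Dpaths)
      fix r assume r: "r \<in> {0..T}"
      have "min t r \<in> {0..T}" "min (\<tau> n k) (min t r) = min t r" using r t tk by auto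
      then show "norm (x (min t r) - \<omega> (min t r)) \<le> cell_osc n" unfolding x(1) using step_state_close[OF x(2), of "min t r"] by simp
    qed (rule \<omega>_D)
    have first: "\<bar>(\<Sum>i<k. g i \<bullet> \<delta> n i) - (\<Sum>i<k. G i \<bullet> \<delta> n i)\<bar> \<le> 2 * C * cell_osc n" if k: "k \<le> m n" for k
    proof (cases k)
      case 0
      then show ?thesis using C(1) e0 by simp
    next
      case (Suc k')
      have "(\<Sum>i<k. g i \<bullet> \<delta> n i) - (\<Sum>i<k. G i \<bullet> \<delta> n i) = (\<Sum>i<k. (g i - G i) \<bullet> \<delta> n i)"
        by (simp add: sum_subtractf inner_diff_left)
      also have "\<dots> = (\<Sum>i\<in>{0}. (g i - G i) \<bullet> \<delta> n i)"
        using k Suc by (intro sum.mono_neutral_right) (auto simp: g_def G_def stop_left_step_path)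
      also have "\<dots> = (g 0 - G 0) \<bullet> \<delta> n 0" by simp
      also have "\<bar>\<dots>\<bar> \<le> norm (g 0 - G 0) * norm (\<delta> n 0)" by (rule Cauchy_Schwarz_ineq2)
      also have "\<dots> \<le> (C + C) * cell_osc n"
        using C(2,3)[OF m_pos] \<delta>_le[OF m_pos] C(1) e0 unfolding g_def G_def
        by (intro mult_mono order.trans[OF norm_triangle_ineq4] add_mono) auto
      finally show ?thesis by simp
    qed
    consider "t = T" | k where "k < m n" "t \<in> {\<tau> n k..<\<tau> n (Suc k)}"
      using grid_cell[of t n] t by (metis atLeastAtMost_iff atLeastLessThan_iff order_le_less)
    then show ?thesis
    proof cases
      case 1
      have sets: "{k. k < m n \<and> \<tau> n (Suc k) \<le> t} = {..<m n}"
        using grid.grid_in[of "Suc _" n] 1 by auto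
      have inc: "inc k = \<delta> n k" if "k < m n" for k
        using grid.grid_in[of k n] grid.grid_in[of "Suc k" n] that 1 by (simp add: inc_def \<delta>_def min_def)
      have "(drift n has_integral (F t (step_state n (m n)) - F 0 \<omega> - (\<Sum>i<m n. G i \<bullet> \<delta> n i) - second_order_sum n t / 2)) {0..t}"
        using grid_Ito[OF order_refl, of n] by (simp add: second_order_sum_def sets[unfolded 1] G_def 1 \<tau>_ends)
      then have int: "drift n integrable_on {0..t}"
        "integral {0..t} (drift n) = F t (step_state n (m n)) - F 0 \<omega> - (\<Sum>i<m n. G i \<bullet> \<delta> n i) - second_order_sum n t / 2"
        by (simp_all add: has_integral_iff)
      have "path_int_sum T m \<tau> (v_grad T F) \<omega> t n = (\<Sum>i<m n. g i \<bullet> \<delta> n i)"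
        unfolding S using inc by (intro sum.cong) auto
      moreover have "\<bar>F t (step_state n (m n)) - F t \<omega>\<bar> \<le> L * cell_osc n" using 1 by (intro near) (auto simp: \<tau>_ends)
      moreover have "0 \<le> C * cell_osc n" "0 \<le> L * cell_osc n" using C(1) L(1) e0 by simp_all
      ultimately show ?thesis using int first[OF order_refl] unfolding K_def distrib_right
        by (intro conjI) (simp, linarith)
    next
      case (2 k)
      have sets: "{i. i < m n \<and> \<tau> n (Suc i) \<le> t} = {..<k}"
      proof (intro set_eqI iffI)
        fix i assume "i \<in> {i. i < m n \<and> \<tau> n (Suc i) \<le> t}"
        then show "i \<in> {..<k}" using 2 grid.grid_mono[of "Suc k" "Suc i" n] by (cases "i < k") auto
      next
        fix i assume "i \<in> {..<k}"
        then show "i \<in> {i. i < m n \<and> \<tau> n (Suc i) \<le> t}" using 2 grid.grid_mono[of "Suc i" k n] by auto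
      qed
      have 0: "0 \<le> \<tau> n k" using grid.grid_in[of k n] 2 by simp
      have "(drift n has_integral (F (\<tau> n k) (step_state n k) - F 0 \<omega> - (\<Sum>i<k. G i \<bullet> \<delta> n i) - second_order_sum n t / 2)
          + (F t (step_state n (Suc k)) - F (\<tau> n k) (step_state n (Suc k)))) {0..t}"
      proof (rule has_integral_combine[OF 0])
        show "(drift n has_integral (F (\<tau> n k) (step_state n k) - F 0 \<omega> - (\<Sum>i<k. G i \<bullet> \<delta> n i) - second_order_sum n t / 2)) {0..\<tau> n k}"
          using grid_Ito[of k n] 2(1) by (simp add: second_order_sum_def sets G_def)
        show "(drift n has_integral (F t (step_state n (Suc k)) - F (\<tau> n k) (step_state n (Suc k)))) {\<tau> n k..t}"
          using 2 by (intro drift_has_integral_cell) auto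
      qed (use 2 in auto)
      then have int: "drift n integrable_on {0..t}"
        "integral {0..t} (drift n) = (F (\<tau> n k) (step_state n k) - F 0 \<omega> - (\<Sum>i<k. G i \<bullet> \<delta> n i) - second_order_sum n t / 2)
          + (F t (step_state n (Suc k)) - F (\<tau> n k) (step_state n (Suc k)))"
        by (simp_all add: has_integral_iff)
      have zero: "inc i = 0" if "i < m n" "k < i" for i
        using grid.grid_mono[of "Suc k" i n] grid.grid_Suc[OF that(1)] that 2(2) by (simp add: inc_def min_def)
      have inc: "inc i = \<delta> n i" if "i < k" for i
        using grid.grid_mono[of "Suc i" k n] grid.grid_Suc[of i n] that 2 by (simp add: inc_def \<delta>_def min_def)
      have "path_int_sum T m \<tau> (v_grad T F) \<omega> t n = (\<Sum>i<Suc k. g i \<bullet> inc i)"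
        unfolding S using 2(1) zero by (intro sum.mono_neutral_right) auto
      also have "\<dots> = (\<Sum>i<k. g i \<bullet> \<delta> n i) + g k \<bullet> inc k" using inc by simp
      finally have sum: "path_int_sum T m \<tau> (v_grad T F) \<omega> t n = (\<Sum>i<k. g i \<bullet> \<delta> n i) + g k \<bullet> inc k" .
      have "inc k = \<omega> t - \<omega> (\<tau> n k)" using 2(2) by (simp add: inc_def min_def)
      then have "norm (inc k) \<le> cell_osc n" using 2 by (auto intro!: cell_close)
      then have last: "\<bar>g k \<bullet> inc k\<bar> \<le> C * cell_osc n"
        using C(1,2) 2(1) e0 by (intro order.trans[OF Cauchy_Schwarz_ineq2] mult_mono) (auto simp: g_def)
      have "\<bar>F t (step_state n (Suc k)) - F t \<omega>\<bar> \<le> L * cell_osc n" using 2 by (intro near) auto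
      moreover have "\<bar>F (\<tau> n k) (step_state n (Suc k)) - F (\<tau> n k) (step_state n k)\<bar> \<le> L * cell_osc n"
      proof (rule L(2))
        show "\<tau> n k \<in> {0..T}" "step_state n (Suc k) \<in> Dpaths T" "step_state n k \<in> Dpaths T"
          using 2(1) by (auto intro!: grid.grid_in step_state_Dpaths simp del: atLeastAtMost_iff)
        fix r assume r: "r \<in> {0..T}"
        have "min (\<tau> n k) r \<in> {0..T}" using r 0 by auto
        then show "norm (step_state n (Suc k) (min (\<tau> n k) r) - step_state n k (min (\<tau> n k) r)) \<le> cell_osc n"
          using \<delta>_le[OF 2(1)] e0 by (simp add: step_state_Suc bump_apply)
      qed
      ultimately show ?thesis using int sum last first[OF less_imp_le[OF 2(1)]] unfolding K_def distrib_right
        by (intro conjI) (simp, linarith)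
    qed
  qed
  then show ?thesis by blast
qed

lemma drift_integrable: "t \<in> {0..T} \<Longrightarrow> drift n integrable_on {0..t}"
  using path_int_sum_expansion by blast

lemma limit_drift_integrals:
  assumes t: "t \<in> {0..T}"
  shows "limit_drift integrable_on {0..t}"
    and "(\<lambda>n. integral {0..t} (drift n)) \<longlonglongrightarrow> integral {0..t} limit_drift"
proof -
  obtain C where C: "\<And>s n. s \<in> {0..T} \<Longrightarrow> \<bar>drift n s\<bar> \<le> C" using drift_bound by blast
  have *: "norm (drift n s) \<le> C" "(\<lambda>n. drift n s) \<longlonglongrightarrow> limit_drift s" if "s \<in> {0..t}" for n s
    using C[of s n] drift_tendsto[of s] t that by auto
  show "limit_drift integrable_on {0..t}"
    by (rule dominated_convergence(1)[where h = "\<lambda>_. C", OF drift_integrable[OF t] _ *]) auto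
  show "(\<lambda>n. integral {0..t} (drift n)) \<longlonglongrightarrow> integral {0..t} limit_drift"
    by (rule dominated_convergence(2)[where h = "\<lambda>_. C", OF drift_integrable[OF t] _ *]) auto
qed

lemma drift_L1: "(\<lambda>n. integral {0..T} (\<lambda>s. \<bar>drift n s - limit_drift s\<bar>)) \<longlonglongrightarrow> 0"
  and drift_diff_abs_integrable: "(\<lambda>s. \<bar>drift n s - limit_drift s\<bar>) integrable_on {0..T}"
proof -
  obtain C where C: "\<And>s n. s \<in> {0..T} \<Longrightarrow> \<bar>drift n s\<bar> \<le> C" "\<And>s. s \<in> {0..T} \<Longrightarrow> \<bar>limit_drift s\<bar> \<le> C"
    using drift_bound by blast
  have TT: "T \<in> {0..T}" using T by simp
  have bd: "\<bar>drift n s - limit_drift s\<bar> \<le> 2 * C" if "s \<in> {0..T}" for n s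
    using C(1)[OF that, of n] C(2)[OF that] by linarith
  have abs_int: "(\<lambda>s. \<bar>drift n s - limit_drift s\<bar>) integrable_on {0..T}" for n
  proof -
    have "(\<lambda>s. drift n s - limit_drift s) absolutely_integrable_on {0..T}"
      using bd by (intro absolutely_integrable_integrable_bound[where g = "\<lambda>_. 2 * C"]
          integrable_diff drift_integrable[OF TT] limit_drift_integrals(1)[OF TT]) auto
    then have "(norm \<circ> (\<lambda>s. drift n s - limit_drift s)) integrable_on {0..T}"
      by (intro set_lebesgue_integral_eq_integral(1) absolutely_integrable_norm)
    then show ?thesis by (simp add: o_def)
  qed
  then show "(\<lambda>s. \<bar>drift n s - limit_drift s\<bar>) integrable_on {0..T}" .
  have lim: "(\<lambda>n. \<bar>drift n s - limit_drift s\<bar>) \<longlonglongrightarrow> 0" if "s \<in> {0..T}" for s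
    using tendsto_rabs[OF tendsto_diff[OF drift_tendsto[OF that] tendsto_const[of "limit_drift s"]]] by simp
  have "(\<lambda>n. integral {0..T} (\<lambda>s. \<bar>drift n s - limit_drift s\<bar>)) \<longlonglongrightarrow> integral {0..T} (\<lambda>s. 0 :: real)"
    using bd by (intro dominated_convergence(2)[where h = "\<lambda>_. 2 * C", OF abs_int _ _ lim]) auto
  then show "(\<lambda>n. integral {0..T} (\<lambda>s. \<bar>drift n s - limit_drift s\<bar>)) \<longlonglongrightarrow> 0" by simp
qed

text \<open>
  The difference between the increment of \<open>F\<close> along \<open>\<omega>\<close> and the pathwise integral.
\<close>

definition finite_variation_part :: "real \<Rightarrow> real" where
  "finite_variation_part t = integral {0..t} limit_drift + second_order_limit t / 2"

lemma path_int_sum_tendsto: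
  assumes t: "t \<in> {0..T}"
  shows "path_int_sum T m \<tau> (v_grad T F) \<omega> t \<longlonglongrightarrow> F t \<omega> - F 0 \<omega> - finite_variation_part t"
proof -
  obtain K where K: "\<And>n. \<bar>path_int_sum T m \<tau> (v_grad T F) \<omega> t n -
      (F t \<omega> - F 0 \<omega> - integral {0..t} (drift n) - second_order_sum n t / 2)\<bar> \<le> K * cell_osc n"
    using path_int_sum_expansion t by blast
  have "(\<lambda>n. K * cell_osc n) \<longlonglongrightarrow> 0" using tendsto_mult_left[OF cell_osc_tendsto_0, of K] by simp
  then have "(\<lambda>n. path_int_sum T m \<tau> (v_grad T F) \<omega> t n -
      (F t \<omega> - F 0 \<omega> - integral {0..t} (drift n) - second_order_sum n t / 2)) \<longlonglongrightarrow> 0"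
    by (rule Lim_null_comparison[rotated]) (use K in simp)
  moreover have "(\<lambda>n. F t \<omega> - F 0 \<omega> - integral {0..t} (drift n) - second_order_sum n t / 2) \<longlonglongrightarrow>
      F t \<omega> - F 0 \<omega> - integral {0..t} limit_drift - second_order_limit t / 2"
    by (intro tendsto_intros limit_drift_integrals(2)[OF t] second_order_sum_tendsto) simp
  ultimately have "(\<lambda>n. (path_int_sum T m \<tau> (v_grad T F) \<omega> t n -
      (F t \<omega> - F 0 \<omega> - integral {0..t} (drift n) - second_order_sum n t / 2)) +
      (F t \<omega> - F 0 \<omega> - integral {0..t} (drift n) - second_order_sum n t / 2)) \<longlonglongrightarrow>
      0 + (F t \<omega> - F 0 \<omega> - integral {0..t} limit_drift - second_order_limit t / 2)"
    by (rule tendsto_add)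
  then show ?thesis by (simp add: finite_variation_part_def algebra_simps)
qed

lemma path_int_eq: "t \<in> {0..T} \<Longrightarrow> path_int T m \<tau> (v_grad T F) \<omega> t = F t \<omega> - F 0 \<omega> - finite_variation_part t"
  unfolding path_int_def by (rule limI[OF path_int_sum_tendsto])

end

section \<open>The isometry formula\<close>

context partitioned_path begin

lemma finite_variation_part_increment:
  obtains C K where "0 \<le> C" "0 \<le> K" "\<And>s t. 0 \<le> s \<Longrightarrow> s \<le> t \<Longrightarrow> t \<le> T \<Longrightarrow>
    \<bar>finite_variation_part t - finite_variation_part s\<bar> \<le> C * (t - s) + K * (total_qv t - total_qv s)"
    "\<And>s t. 0 \<le> s \<Longrightarrow> s \<le> t \<Longrightarrow> t \<le> T \<Longrightarrow>
    \<bar>finite_variation_part t - finite_variation_part s\<bar> \<le> \<bar>integral {s..t} limit_drift\<bar> + K * (total_qv t - total_qv s)"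
proof -
  obtain C where C: "0 < C" "\<And>s. s \<in> {0..T} \<Longrightarrow> \<bar>limit_drift s\<bar> \<le> C" using drift_bound by blast
  obtain K where K: "0 \<le> K" "\<And>s t. 0 \<le> s \<Longrightarrow> s \<le> t \<Longrightarrow> t \<le> T \<Longrightarrow>
    \<bar>second_order_limit t - second_order_limit s\<bar> \<le> K * (total_qv t - total_qv s)"
    using second_order_limit_increment by blast
  have *: "\<bar>finite_variation_part t - finite_variation_part s\<bar> \<le> \<bar>integral {s..t} limit_drift\<bar> + K / 2 * (total_qv t - total_qv s)"
    if st: "0 \<le> s" "s \<le> t" "t \<le> T" for s t
  proof -
    have "integral {0..s} limit_drift + integral {s..t} limit_drift = integral {0..t} limit_drift"
      using st by (intro Henstock_Kurzweil_Integration.integral_combine limit_drift_integrals(1)) auto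
    then have "finite_variation_part t - finite_variation_part s =
        integral {s..t} limit_drift + (second_order_limit t - second_order_limit s) / 2"
      by (simp add: finite_variation_part_def algebra_simps add_divide_distrib diff_divide_distrib)
    moreover have "\<bar>(second_order_limit t - second_order_limit s) / 2\<bar> \<le> K / 2 * (total_qv t - total_qv s)"
      using K(2)[OF st] by simp
    ultimately show ?thesis by linarith
  qed
  have **: "\<bar>integral {s..t} limit_drift\<bar> \<le> C * (t - s)" if st: "0 \<le> s" "s \<le> t" "t \<le> T" for s t
  proof -
    have "limit_drift integrable_on {s..t}"
      using st by (intro integrable_on_subinterval[OF limit_drift_integrals(1)[of t]]) auto
    then have "norm (integral (cbox s t) limit_drift) \<le> C * measure lborel (cbox s t)"
      using C st by (intro integrable_bound) auto
    then show ?thesis using st by simp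
  qed
  show thesis
  proof (rule that[of C "K / 2"])
    fix s t assume st: "0 \<le> s" "s \<le> t" "t \<le> T"
    show "\<bar>finite_variation_part t - finite_variation_part s\<bar> \<le> C * (t - s) + K / 2 * (total_qv t - total_qv s)"
      using *[OF st] **[OF st] by linarith
  qed (use C(1) K(1) * in auto)
qed

lemma F_close_along_steps:
  obtains L where "0 \<le> L" "\<And>n k t. k < m n \<Longrightarrow> t \<in> {\<tau> n k, \<tau> n (Suc k)} \<Longrightarrow> \<bar>F t (step_state n (Suc k)) - F t \<omega>\<bar> \<le> L * cell_osc n"
proof -
  obtain L where L: "L > 0" "\<And>t x y \<epsilon>. t \<in> {0..T} \<Longrightarrow> x \<in> Dpaths T \<Longrightarrow> y \<in> Dpaths T \<Longrightarrow>
    (\<And>r. r \<in> {0..T} \<Longrightarrow> norm (x (min t r) - y (min t r)) \<le> \<epsilon>) \<Longrightarrow> \<bar>F t x - F t y\<bar> \<le> L * \<epsilon>"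
    using Lip_bound by (metis (no_types, lifting))
  show thesis
  proof (rule that[of L])
    fix n k t assume k: "k < m n" and t: "t \<in> {\<tau> n k, \<tau> n (Suc k)}"
    have in_T: "\<tau> n k \<in> {0..T}" "\<tau> n (Suc k) \<in> {0..T}" by (rule cell_ends[OF k])+
    then have t': "t \<in> {0..T}" "t \<le> \<tau> n (Suc k)" using t grid.grid_Suc[OF k] by auto
    show "\<bar>F t (step_state n (Suc k)) - F t \<omega>\<bar> \<le> L * cell_osc n"
    proof (rule L(2)[OF t'(1) _ \<omega>_D])
      show "step_state n (Suc k) \<in> Dpaths T" using k by (intro step_state_Dpaths) simp
      fix r assume r: "r \<in> {0..T}"
      have "min t r \<in> {0..T}" "min (\<tau> n (Suc k)) (min t r) = min t r" using r t' by auto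
      then show "norm (step_state n (Suc k) (min t r) - \<omega> (min t r)) \<le> cell_osc n"
        using step_state_close[of "Suc k" n "min t r"] k by simp
    qed
  qed (use L(1) in simp)
qed

definition F_jump :: "nat \<Rightarrow> real" where
  "F_jump n = (MAX i\<in>{..<m n}. \<bar>F (\<tau> n (Suc i)) \<omega> - F (\<tau> n i) \<omega>\<bar>)"

lemma F_jump_ge: "k < m n \<Longrightarrow> \<bar>F (\<tau> n (Suc k)) \<omega> - F (\<tau> n k) \<omega>\<bar> \<le> F_jump n"
  unfolding F_jump_def by (intro Max_ge) auto

text \<open>
  The total variation is finite, so it suffices that the increments over the cells tend to \<open>0\<close>
  uniformly. For the second order part this is \<open>total_qv_cells\<close>. The drift along the step path
  integrates over a cell to an increment of \<open>F\<close>, up to the Lipschitz error, and this is small by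
  assumption also for long cells; the drift along \<open>\<omega>\<close> is close to it in \<open>L\<^sup>1\<close>.
\<close>

lemma finite_variation_squares:
  assumes "F_jump \<longlonglongrightarrow> 0"
  shows "(\<lambda>n. \<Sum>k<m n. (finite_variation_part (\<tau> n (Suc k)) - finite_variation_part (\<tau> n k))\<^sup>2) \<longlonglongrightarrow> 0"
proof -
  obtain C K where C: "0 \<le> C" and K: "0 \<le> K"
    and V1: "\<And>s t. 0 \<le> s \<Longrightarrow> s \<le> t \<Longrightarrow> t \<le> T \<Longrightarrow>
      \<bar>finite_variation_part t - finite_variation_part s\<bar> \<le> C * (t - s) + K * (total_qv t - total_qv s)"
    and V2: "\<And>s t. 0 \<le> s \<Longrightarrow> s \<le> t \<Longrightarrow> t \<le> T \<Longrightarrow>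
      \<bar>finite_variation_part t - finite_variation_part s\<bar> \<le> \<bar>integral {s..t} limit_drift\<bar> + K * (total_qv t - total_qv s)"
    using finite_variation_part_increment by blast
  obtain E where E: "E \<longlonglongrightarrow> 0" "\<And>n k. k < m n \<Longrightarrow> total_qv (\<tau> n (Suc k)) - total_qv (\<tau> n k) \<le> E n"
    using total_qv_cells by blast
  obtain L where L: "0 \<le> L" "\<And>n k t. k < m n \<Longrightarrow> t \<in> {\<tau> n k, \<tau> n (Suc k)} \<Longrightarrow> \<bar>F t (step_state n (Suc k)) - F t \<omega>\<bar> \<le> L * cell_osc n"
    using F_close_along_steps by blast
  define J where "J n = integral {0..T} (\<lambda>s. \<bar>drift n s - limit_drift s\<bar>)" for n
  define V where "V n k = finite_variation_part (\<tau> n (Suc k)) - finite_variation_part (\<tau> n k)" for n k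
  define M where "M n = F_jump n + 2 * (L * cell_osc n) + J n + K * E n" for n
  define B where "B = C * T + K * (total_qv T - total_qv 0)"
  have TT: "T \<in> {0..T}" using T by simp
  have V_le_M: "\<bar>V n k\<bar> \<le> M n" if k: "k < m n" for n k
  proof -
    have in_T: "0 \<le> \<tau> n k" "\<tau> n k \<le> \<tau> n (Suc k)" "\<tau> n (Suc k) \<le> T"
      using grid.grid_in[of k n] grid.grid_in[of "Suc k" n] grid.grid_Suc[OF k] k by auto
    let ?I = "{\<tau> n k..\<tau> n (Suc k)}"
    have hd: "(drift n has_integral (F (\<tau> n (Suc k)) (step_state n (Suc k)) - F (\<tau> n k) (step_state n (Suc k)))) ?I"
      using in_T by (intro drift_has_integral_cell[OF k]) auto
    have ld: "limit_drift integrable_on ?I" "(\<lambda>s. \<bar>drift n s - limit_drift s\<bar>) integrable_on ?I"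
      using in_T by (auto intro: integrable_on_subinterval[OF limit_drift_integrals(1)[OF TT]]
          integrable_on_subinterval[OF drift_diff_abs_integrable])
    have "\<bar>integral ?I (drift n) - integral ?I limit_drift\<bar> \<le> J n"
    proof -
      have "integral ?I (drift n) - integral ?I limit_drift = integral ?I (\<lambda>s. drift n s - limit_drift s)"
        using hd ld by (subst integral_diff) (auto simp: has_integral_iff)
      also have "\<bar>\<dots>\<bar> \<le> integral ?I (\<lambda>s. \<bar>drift n s - limit_drift s\<bar>)"
        using hd ld integral_norm_bound_integral[of "\<lambda>s. drift n s - limit_drift s" ?I "\<lambda>s. \<bar>drift n s - limit_drift s\<bar>"]
        by (auto simp: has_integral_iff intro: integrable_diff)
      also have "\<dots> \<le> J n" unfolding J_def
        using in_T by (intro integral_subset_le ld drift_diff_abs_integrable) auto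
      finally show ?thesis .
    qed
    moreover have "\<bar>integral ?I (drift n)\<bar> \<le> F_jump n + 2 * (L * cell_osc n)"
    proof -
      have "integral ?I (drift n) = F (\<tau> n (Suc k)) (step_state n (Suc k)) - F (\<tau> n k) (step_state n (Suc k))"
        using hd by (rule integral_unique)
      then show ?thesis
        using F_jump_ge[OF k] L(2)[OF k, of "\<tau> n k"] L(2)[OF k, of "\<tau> n (Suc k)"] by simp
    qed
    moreover have "\<bar>V n k\<bar> \<le> \<bar>integral ?I limit_drift\<bar> + K * (total_qv (\<tau> n (Suc k)) - total_qv (\<tau> n k))"
      unfolding V_def by (rule V2[OF in_T])
    moreover have "K * (total_qv (\<tau> n (Suc k)) - total_qv (\<tau> n k)) \<le> K * E n"
      using E(2)[OF k] K by (rule mult_left_mono)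
    ultimately show ?thesis unfolding M_def by linarith
  qed
  have V_sum: "(\<Sum>k<m n. \<bar>V n k\<bar>) \<le> B" for n
  proof -
    have "(\<Sum>k<m n. \<bar>V n k\<bar>) \<le> (\<Sum>k<m n. C * (\<tau> n (Suc k) - \<tau> n k) + K * (total_qv (\<tau> n (Suc k)) - total_qv (\<tau> n k)))"
    proof (rule sum_mono)
      fix k assume "k \<in> {..<m n}"
      then show "\<bar>V n k\<bar> \<le> C * (\<tau> n (Suc k) - \<tau> n k) + K * (total_qv (\<tau> n (Suc k)) - total_qv (\<tau> n k))"
        unfolding V_def using grid.grid_in[of k n] grid.grid_in[of "Suc k" n] grid.grid_Suc[of k n] by (intro V1) auto
    qed
    also have "\<dots> = B"
      unfolding sum.distrib sum_distrib_left[symmetric] sum_lessThan_telescope[of "\<tau> n"]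
        sum_lessThan_telescope[of "\<lambda>k. total_qv (\<tau> n k)"] by (simp add: \<tau>_ends B_def)
    finally show ?thesis .
  qed
  have "(\<lambda>n. M n * B) \<longlonglongrightarrow> (0 + 2 * (L * 0) + 0 + K * 0) * B"
    unfolding M_def J_def by (intro tendsto_intros assms cell_osc_tendsto_0 drift_L1 E(1))
  then have lim: "(\<lambda>n. M n * B) \<longlonglongrightarrow> 0" by simp
  have "(\<lambda>n. \<Sum>k<m n. (V n k)\<^sup>2) \<longlonglongrightarrow> 0"
  proof (rule Lim_null_comparison[OF _ lim], intro always_eventually allI)
    fix n
    have "0 \<le> M n" using V_le_M[OF m_pos[of n]] by linarith
    have "(\<Sum>k<m n. (V n k)\<^sup>2) \<le> (\<Sum>k<m n. M n * \<bar>V n k\<bar>)"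
    proof (rule sum_mono)
      fix k assume "k \<in> {..<m n}"
      then have "\<bar>V n k\<bar> * \<bar>V n k\<bar> \<le> M n * \<bar>V n k\<bar>" by (intro mult_right_mono V_le_M) auto
      then show "(V n k)\<^sup>2 \<le> M n * \<bar>V n k\<bar>" by (simp add: power2_eq_square)
    qed
    also have "\<dots> = M n * (\<Sum>k<m n. \<bar>V n k\<bar>)" by (simp add: sum_distrib_left)
    also have "\<dots> \<le> M n * B" using V_sum \<open>0 \<le> M n\<close> by (intro mult_left_mono)
    finally show "norm (\<Sum>k<m n. (V n k)\<^sup>2) \<le> M n * B" by (simp add: sum_nonneg)
  qed
  then show ?thesis by (simp add: V_def)
qed

lemma gradient_sums:
  "trace_integrable T m \<tau> \<omega> (\<lambda>s. outer_square (v_grad T F s \<omega>))"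
  "(\<lambda>n. \<Sum>k<m n. (v_grad T F (\<tau> n k) \<omega> \<bullet> \<delta> n k)\<^sup>2) \<longlonglongrightarrow>
    trace_integral T m \<tau> \<omega> (\<lambda>s. outer_square (v_grad T F s \<omega>))"
proof -
  define g where "g i s = v_grad T F s \<omega> $ i" for i s
  obtain R where R: "\<omega> \<in> paths_in T R" using \<omega>_bounded by blast
  obtain C where C: "derivative_bound R C" using derivative_bound_exists by blast
  have C0: "0 < C" using C by (simp add: derivative_bound_def)
  have g_bound: "\<bar>g i s\<bar> \<le> C" if "s \<in> {0..T}" for i s
    using C R that unfolding g_def derivative_bound_def by (blast intro: order.trans[OF component_le_norm_cart])
  have prod_bound: "\<bar>g i s * g j s\<bar> \<le> C * C" if "s \<in> {0..T}" for i j s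
    unfolding abs_mult using g_bound[OF that] C0 by (intro mult_mono) auto
  have prod_lim: "\<exists>\<eta>>0. \<forall>u\<in>{0..T}. s - \<eta> \<le> u \<and> u < s \<longrightarrow> \<bar>g i u * g j u - g i s * g j s\<bar> \<le> \<epsilon>"
    if s: "s \<in> {0<..T}" and "\<epsilon> > 0" for s \<epsilon> i j
  proof -
    have \<epsilon>': "\<epsilon> / (2 * C) > 0" using \<open>\<epsilon> > 0\<close> C0 by simp
    have "\<exists>\<eta>>0. \<forall>u\<in>{0..T}. s - \<eta> \<le> u \<and> u < s \<longrightarrow> \<bar>g i u - g i s\<bar> \<le> \<epsilon> / (2 * C)" for i
      using left_limit_along_path[OF F_facts(5) s \<epsilon>', of i] by (simp add: g_def)
    then obtain \<eta> where \<eta>: "\<And>i. \<eta> i > 0"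
      "\<And>i u. u \<in> {0..T} \<Longrightarrow> s - \<eta> i \<le> u \<Longrightarrow> u < s \<Longrightarrow> \<bar>g i u - g i s\<bar> \<le> \<epsilon> / (2 * C)" by metis
    have "\<bar>g i u * g j u - g i s * g j s\<bar> \<le> \<epsilon>"
      if u: "u \<in> {0..T}" "s - min (\<eta> i) (\<eta> j) \<le> u" "u < s" for u
    proof -
      have "g i u * g j u - g i s * g j s = g i u * (g j u - g j s) + (g i u - g i s) * g j s"
        by (simp add: algebra_simps)
      also have "\<bar>\<dots>\<bar> \<le> \<bar>g i u\<bar> * \<bar>g j u - g j s\<bar> + \<bar>g i u - g i s\<bar> * \<bar>g j s\<bar>"
        unfolding abs_mult[symmetric] by (rule abs_triangle_ineq)
      also have "\<dots> \<le> C * (\<epsilon> / (2 * C)) + \<epsilon> / (2 * C) * C"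
      proof (intro add_mono mult_mono)
        show "\<bar>g i u\<bar> \<le> C" "\<bar>g j s\<bar> \<le> C" using u s by (intro g_bound; force)+
        show "\<bar>g j u - g j s\<bar> \<le> \<epsilon> / (2 * C)" "\<bar>g i u - g i s\<bar> \<le> \<epsilon> / (2 * C)"
          using u by (intro \<eta>(2); force)+
      qed (use C0 \<epsilon>' in auto)
      also have "\<dots> = \<epsilon>" using C0 by simp
      finally show ?thesis .
    qed
    then show ?thesis using \<eta>(1) by (intro exI[of _ "min (\<eta> i) (\<eta> j)"]) auto
  qed
  have grid_lim: "\<exists>\<eta>>0. \<exists>N. \<forall>n\<ge>N. \<forall>k<m n. s - \<eta> \<le> \<tau> n k \<and> \<tau> n k < s \<longrightarrow>
      \<bar>g i (\<tau> n k) * g j (\<tau> n k) - g i s * g j s\<bar> \<le> \<epsilon>"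
    if s: "s \<in> {0<..T}" and "\<epsilon> > 0" for s \<epsilon> i j
    using prod_lim[OF that, of i j] grid.grid_in by (metis less_imp_le)
  have grid_bound: "\<bar>g i (\<tau> n k) * g j (\<tau> n k)\<bar> \<le> C * C" if "k < m n" for n k i j
    using that by (intro prod_bound grid.grid_in) simp
  note cov = covariation_sums[OF left_limit_weightsI[OF prod_bound grid_bound prod_lim grid_lim]]
  have A: "outer_square (v_grad T F s \<omega>) $ i $ j = g i s * g j s" for s i j
    by (simp add: outer_square_def g_def)
  show "trace_integrable T m \<tau> \<omega> (\<lambda>s. outer_square (v_grad T F s \<omega>))"
    unfolding trace_integrable_def A using cov(1) by blast
  have "(\<lambda>n. \<Sum>i\<in>UNIV. \<Sum>j\<in>UNIV. \<Sum>k<m n. g i (\<tau> n k) * g j (\<tau> n k) * (\<delta> n k $ j * \<delta> n k $ i)) \<longlonglongrightarrow>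
      trace_integral T m \<tau> \<omega> (\<lambda>s. outer_square (v_grad T F s \<omega>))"
    unfolding trace_integral_def A by (intro tendsto_sum cov(2))
  moreover have "(\<Sum>i\<in>UNIV. \<Sum>j\<in>UNIV. \<Sum>k<m n. g i (\<tau> n k) * g j (\<tau> n k) * (\<delta> n k $ j * \<delta> n k $ i)) =
      (\<Sum>k<m n. (v_grad T F (\<tau> n k) \<omega> \<bullet> \<delta> n k)\<^sup>2)" for n
  proof -
    have "(v_grad T F (\<tau> n k) \<omega> \<bullet> \<delta> n k)\<^sup>2 =
        (\<Sum>i\<in>UNIV. \<Sum>j\<in>UNIV. g i (\<tau> n k) * g j (\<tau> n k) * (\<delta> n k $ j * \<delta> n k $ i))" for k
      unfolding power2_eq_square inner_vec_def sum_product by (intro sum.cong refl) (simp add: g_def)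
    then have "(\<Sum>k<m n. (v_grad T F (\<tau> n k) \<omega> \<bullet> \<delta> n k)\<^sup>2) =
        (\<Sum>k<m n. \<Sum>i\<in>UNIV. \<Sum>j\<in>UNIV. g i (\<tau> n k) * g j (\<tau> n k) * (\<delta> n k $ j * \<delta> n k $ i))" by simp
    also have "\<dots> = (\<Sum>i\<in>UNIV. \<Sum>k<m n. \<Sum>j\<in>UNIV. g i (\<tau> n k) * g j (\<tau> n k) * (\<delta> n k $ j * \<delta> n k $ i))"
      by (rule sum.swap)
    also have "\<dots> = (\<Sum>i\<in>UNIV. \<Sum>j\<in>UNIV. \<Sum>k<m n. g i (\<tau> n k) * g j (\<tau> n k) * (\<delta> n k $ j * \<delta> n k $ i))"
      by (intro sum.cong refl sum.swap)
    finally show ?thesis by simp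
  qed
  ultimately show "(\<lambda>n. \<Sum>k<m n. (v_grad T F (\<tau> n k) \<omega> \<bullet> \<delta> n k)\<^sup>2) \<longlonglongrightarrow>
    trace_integral T m \<tau> \<omega> (\<lambda>s. outer_square (v_grad T F s \<omega>))" by simp
qed

text \<open>
  On short cells the Hoelder estimate applies; on long ones the increments of \<open>F\<close> and of \<open>\<omega>\<close> are
  both uniformly small.
\<close>

lemma remainder_squares:
  assumes "F_jump \<longlonglongrightarrow> 0" and \<nu>: "0 < \<nu>" "1 / 2 < \<nu> + \<nu>\<^sup>2" and c: "0 \<le> c"
    and Hoelder: "\<And>s t. s \<in> {0..T} \<Longrightarrow> t \<in> {0..T} \<Longrightarrow> norm (\<omega> t - \<omega> s) \<le> c * \<bar>t - s\<bar> powr \<nu>"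
  shows "(\<lambda>n. \<Sum>k<m n. (F (\<tau> n (Suc k)) \<omega> - F (\<tau> n k) \<omega> - v_grad T F (\<tau> n k) \<omega> \<bullet> \<delta> n k)\<^sup>2) \<longlonglongrightarrow> 0"
proof -
  obtain K where K: "K > 0" "\<And>s t. 0 \<le> s \<Longrightarrow> s < t \<Longrightarrow> t \<le> T \<Longrightarrow> t - s \<le> 1 \<Longrightarrow>
    \<bar>F t \<omega> - F s \<omega> - v_grad T F s \<omega> \<bullet> (\<omega> t - \<omega> s)\<bar> \<le> K * (t - s) powr min 1 (\<nu> + \<nu>\<^sup>2)"
    using Hoelder_remainder_bound[OF \<omega>_D \<nu>(1) c Hoelder] by blast
  obtain R where R: "\<omega> \<in> paths_in T R" using \<omega>_bounded by blast
  obtain C where C: "derivative_bound R C" using derivative_bound_exists by blast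
  have C0: "0 < C" using C by (simp add: derivative_bound_def)
  have in_T: "\<tau> n k \<in> {0..T}" "\<tau> n (Suc k) \<in> {0..T}" if "k < m n" for n k
    by (rule cell_ends[OF that])+
  show ?thesis
  proof (rule sums_of_squares_small[where l = "\<lambda>n k. \<tau> n (Suc k) - \<tau> n k" and K = K and T = T
        and q = "min 1 (\<nu> + \<nu>\<^sup>2)" and r = "\<lambda>n. F_jump n + C * cell_osc n"])
    show "(\<Sum>k<m n. \<tau> n (Suc k) - \<tau> n k) = T" for n
      by (simp add: sum_lessThan_telescope \<tau>_ends)
    show "(\<lambda>n. F_jump n + C * cell_osc n) \<longlonglongrightarrow> 0"
      using tendsto_add[OF assms(1) tendsto_mult_left[OF cell_osc_tendsto_0, of C]] by simp
    fix n k assume k: "k < m n"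
    show "0 < \<tau> n (Suc k) - \<tau> n k" using grid.grid_Suc[OF k] by simp
    show "\<bar>F (\<tau> n (Suc k)) \<omega> - F (\<tau> n k) \<omega> - v_grad T F (\<tau> n k) \<omega> \<bullet> \<delta> n k\<bar>
        \<le> K * (\<tau> n (Suc k) - \<tau> n k) powr min 1 (\<nu> + \<nu>\<^sup>2)" if "\<tau> n (Suc k) - \<tau> n k \<le> 1"
      unfolding \<delta>_def using in_T[OF k] grid.grid_Suc[OF k] that by (intro K(2)) auto
    have "\<bar>v_grad T F (\<tau> n k) \<omega> \<bullet> \<delta> n k\<bar> \<le> C * cell_osc n"
      using C R in_T(1)[OF k] \<delta>_le[OF k] C0 cell_osc_nonneg[of n] unfolding derivative_bound_def
      by (intro order.trans[OF Cauchy_Schwarz_ineq2] mult_mono) auto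
    then show "\<bar>F (\<tau> n (Suc k)) \<omega> - F (\<tau> n k) \<omega> - v_grad T F (\<tau> n k) \<omega> \<bullet> \<delta> n k\<bar> \<le> F_jump n + C * cell_osc n"
      using F_jump_ge[OF k] by linarith
  qed (use K(1) \<nu>(2) in auto)
qed

lemma qv_sum_T: "qv_sum m \<tau> x T n = (\<Sum>k<m n. (x (\<tau> n (Suc k)) - x (\<tau> n k))\<^sup>2)"
proof -
  have "{i. i < m n \<and> \<tau> n (Suc i) \<le> T} = {..<m n}" using grid.grid_in[of "Suc _" n] by auto
  then show ?thesis by (simp add: qv_sum_def)
qed

lemma isometry:
  assumes "F_jump \<longlonglongrightarrow> 0" and \<nu>: "0 < \<nu>" "1 / 2 < \<nu> + \<nu>\<^sup>2" and c: "0 \<le> c"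
    and Hoelder: "\<And>s t. s \<in> {0..T} \<Longrightarrow> t \<in> {0..T} \<Longrightarrow> norm (\<omega> t - \<omega> s) \<le> c * \<bar>t - s\<bar> powr \<nu>"
  defines "A \<equiv> trace_integral T m \<tau> \<omega> (\<lambda>s. outer_square (v_grad T F s \<omega>))"
  shows "qv_sum m \<tau> (\<lambda>t. F t \<omega>) T \<longlonglongrightarrow> A" "qv_sum m \<tau> (path_int T m \<tau> (v_grad T F) \<omega>) T \<longlonglongrightarrow> A"
proof -
  define a where "a n k = v_grad T F (\<tau> n k) \<omega> \<bullet> \<delta> n k" for n k
  define b where "b n k = F (\<tau> n (Suc k)) \<omega> - F (\<tau> n k) \<omega> - a n k" for n k
  define V where "V n k = finite_variation_part (\<tau> n (Suc k)) - finite_variation_part (\<tau> n k)" for n k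
  have a: "(\<lambda>n. \<Sum>k<m n. (a n k)\<^sup>2) \<longlonglongrightarrow> A" unfolding a_def A_def by (rule gradient_sums(2))
  have b: "(\<lambda>n. \<Sum>k<m n. (b n k)\<^sup>2) \<longlonglongrightarrow> 0" unfolding b_def a_def by (rule remainder_squares[OF assms(1-5)])
  have V: "(\<lambda>n. \<Sum>k<m n. (- V n k)\<^sup>2) \<longlonglongrightarrow> 0" using finite_variation_squares[OF assms(1)] by (simp only: V_def power2_minus)
  have ab: "(\<lambda>n. \<Sum>k<m n. (a n k + b n k)\<^sup>2) \<longlonglongrightarrow> A" by (rule sum_squares_perturb[OF a b])
  then show "qv_sum m \<tau> (\<lambda>t. F t \<omega>) T \<longlonglongrightarrow> A" by (simp add: qv_sum_T[abs_def] b_def)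
  have "(\<lambda>n. \<Sum>k<m n. (a n k + b n k + - V n k)\<^sup>2) \<longlonglongrightarrow> A" by (rule sum_squares_perturb[OF ab V])
  moreover have "(\<Sum>k<m n. (a n k + b n k + - V n k)\<^sup>2) = qv_sum m \<tau> (path_int T m \<tau> (v_grad T F) \<omega>) T n" for n
    unfolding qv_sum_T
  proof (rule sum.cong[OF refl])
    fix k assume "k \<in> {..<m n}"
    then have "\<tau> n k \<in> {0..T}" "\<tau> n (Suc k) \<in> {0..T}" by (auto intro!: grid.grid_in simp del: atLeastAtMost_iff)
    then show "(a n k + b n k + - V n k)\<^sup>2 =
        (path_int T m \<tau> (v_grad T F) \<omega> (\<tau> n (Suc k)) - path_int T m \<tau> (v_grad T F) \<omega> (\<tau> n k))\<^sup>2"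
      by (simp add: path_int_eq b_def V_def algebra_simps)
  qed
  ultimately show "qv_sum m \<tau> (path_int T m \<tau> (v_grad T F) \<omega>) T \<longlonglongrightarrow> A" by simp
qed

end

lemma Hoelder_continuous_on:
  assumes "0 < \<nu>" and Hoelder: "\<And>s t. s \<in> S \<Longrightarrow> t \<in> S \<Longrightarrow> norm (f t - f s) \<le> c * \<bar>t - s\<bar> powr \<nu>"
  shows "continuous_on S f"
  unfolding continuous_on_def
proof
  fix s assume s: "s \<in> S"
  have "((\<lambda>t. \<bar>t - s\<bar>) \<longlongrightarrow> \<bar>s - s\<bar>) (at s within S)" by (intro tendsto_intros)
  then have "((\<lambda>t. \<bar>t - s\<bar> powr \<nu>) \<longlongrightarrow> 0) (at s within S)"
    using \<open>0 < \<nu>\<close> by (intro tendsto_zero_powrI[where b = \<nu>]) auto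
  then have "((\<lambda>t. c * \<bar>t - s\<bar> powr \<nu>) \<longlongrightarrow> 0) (at s within S)" by (rule tendsto_mult_right_zero)
  moreover have "\<forall>\<^sub>F t in at s within S. norm (f t - f s) \<le> c * \<bar>t - s\<bar> powr \<nu>"
    using Hoelder[OF s] by (auto simp: eventually_at_filter)
  ultimately have "((\<lambda>t. f t - f s) \<longlongrightarrow> 0) (at s within S)" by (rule Lim_null_comparison[rotated])
  then show "(f \<longlongrightarrow> f s) (at s within S)" by (simp add: LIM_zero_iff)
qed

theorem theorem2p1:
  fixes T \<nu> :: real
    and m :: "nat \<Rightarrow> nat" and \<tau> :: "nat \<Rightarrow> nat \<Rightarrow> real"
    and \<omega> :: "real \<Rightarrow> real^'d"
    and F :: "'d fnl"
  assumes "T > 0"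
    and "partitions T m \<tau>"
    and "(sqrt 3 - 1) / 2 < \<nu>" and "\<nu> < 1"
    and "\<omega> \<in> Q T m \<tau> \<inter> Hoelder T \<nu>"
    and "osc m \<tau> \<omega> \<longlonglongrightarrow> 0"
    and "F \<in> C1b T 2 \<inter> Lip T"
    and "\<forall>i. (\<lambda>t x. v_grad T F t x $ i) \<in> C1b T 1"
    and "(\<lambda>n. MAX i\<in>{..<m n}. \<bar>F (\<tau> n (Suc i)) \<omega> - F (\<tau> n i) \<omega>\<bar>) \<longlonglongrightarrow> 0"
  defines "I \<equiv> path_int T m \<tau> (v_grad T F) \<omega>"
    and "A \<equiv> (\<lambda>s. outer_square (v_grad T F s \<omega>))"
  shows "(\<forall>t\<in>{0..T}. convergent (path_int_sum T m \<tau> (v_grad T F) \<omega> t)) \<and>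
    convergent (qv_sum m \<tau> (\<lambda>t. F t \<omega>) T) \<and>
    convergent (qv_sum m \<tau> I T) \<and>
    trace_integrable T m \<tau> \<omega> A \<and>
    qv m \<tau> (\<lambda>t. F t \<omega>) T = qv m \<tau> I T \<and>
    qv m \<tau> I T = trace_integral T m \<tau> \<omega> A"
proof -
  obtain c0 where c0: "\<forall>s\<in>{0..T}. \<forall>t\<in>{0..T}. norm (\<omega> t - \<omega> s) \<le> c0 * \<bar>t - s\<bar> powr \<nu>"
    using assms(5) by (auto simp: Hoelder_def)
  have Hoelder: "norm (\<omega> t - \<omega> s) \<le> \<bar>c0\<bar> * \<bar>t - s\<bar> powr \<nu>" if "s \<in> {0..T}" "t \<in> {0..T}" for s t
    using c0 that by (intro order.trans[OF _ mult_right_mono[OF abs_ge_self[of c0]]]) auto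
  have "0 < (sqrt 3 - 1) / 2" by simp
  then have \<nu>: "0 < \<nu>" using assms(3) by (rule less_trans)
  have "(sqrt 3)\<^sup>2 < (2 * \<nu> + 1)\<^sup>2" using assms(3) by (intro power_strict_mono) auto
  then have \<nu>2: "1 / 2 < \<nu> + \<nu>\<^sup>2" by (simp add: power2_eq_square algebra_simps)
  have "continuous_on {0..T} \<omega>" by (rule Hoelder_continuous_on[OF \<nu> Hoelder])
  then interpret partitioned_path T F m \<tau> \<omega>
    using assms(1,2,5-8) by unfold_locales auto
  have "F_jump \<longlonglongrightarrow> 0" using assms(9) by (simp add: F_jump_def[abs_def])
  note iso = isometry[OF this \<nu> \<nu>2 abs_ge_zero Hoelder]
  have "\<forall>t\<in>{0..T}. convergent (path_int_sum T m \<tau> (v_grad T F) \<omega> t)"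
    using path_int_sum_tendsto by (blast intro: convergentI)
  moreover have "qv m \<tau> (\<lambda>t. F t \<omega>) T = trace_integral T m \<tau> \<omega> A" "qv m \<tau> I T = trace_integral T m \<tau> \<omega> A"
    using limI[OF iso(1)] limI[OF iso(2)] by (simp_all add: qv_def I_def A_def)
  moreover have "convergent (qv_sum m \<tau> (\<lambda>t. F t \<omega>) T)" "convergent (qv_sum m \<tau> I T)"
    using iso unfolding I_def by (blast intro: convergentI)+
  ultimately show ?thesis using gradient_sums(1) by (simp add: A_def)
qed

end
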